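(* Fix $p\in(0,1)$, and let $\varepsilon>0$ be a fixed, sufficiently small real number (i.e., there is $\varepsilon_0>0$ such that the following holds for every $\varepsilon\in(0,\varepsilon_0)$). For each integer $n\geq 2$, let $\mathsf{w}^{(n)}$ be an alternating word over the alphabet $\{s_1,\ldots,s_{n-1}\}$. Assume that, as $n\to\infty$, \[\max_{i\in[n-1]}\mathfrak{O}_i(\mathsf{w}^{(n)})=o\left( n^2/(\log n)^{1+\varepsilon}\right)\quad\text{and}\quad |\{i\in[n-1]:\mathfrak{O}_i(\mathsf{w}^{(n)})\leq n^{2\varepsilon}\}|=o(n^{1-\varepsilon}).\] Let $v^{(n)}$ be the random permutation represented by $\mathsf{sub}_p(\mathsf{w}^{(n)})$. Then, as $n\to\infty$, \[\mathbb E(\mathrm{inv}(v^{(n)}))=\left(\sqrt{2/\pi}+o(1)\right)\sqrt{\frac{p}{1-p}}\,\sum_{i=1}^{n-1}\sqrt{\mathfrak{O}_i(\mathsf{w}^{(n)})}.\]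
   Context: $[n]=\{1,\ldots,n\}$ and $\mathfrak{S}_n$ is the symmetric group of permutations of $[n]$. For $1\leq i\leq n-1$, $s_i\in\mathfrak{S}_n$ is the adjacent transposition swapping $i$ and $i+1$. A word over $\{s_1,\ldots,s_{n-1}\}$ is a finite sequence of letters; it represents the permutation that is the product of its letters. $\mathfrak{O}_i(\mathsf{w})$ denotes the number of occurrences of the letter $s_i$ in the word $\mathsf{w}$. A word $\mathsf{w}$ is alternating if for all $i\in[n-2]$ the letters $s_i$ and $s_{i+1}$ alternate within $\mathsf{w}$ (i.e., after deleting all letters other than $s_i$ and $s_{i+1}$, no two consecutive letters are equal). For $w\in\mathfrak{S}_n$, $\mathrm{inv}(w)$ is the number of inversions of $w$, i.e., pairs $(j,j')$ with $1\leq j<j'\leq n$ and $w^{-1}(j)>w^{-1}(j')$. For a word $\mathsf{w}$, $\mathsf{sub}_p(\mathsf{w})$ is the random subword obtained by independently deleting each letter of $\mathsf{w}$ with probability $1-p$ (so each letter is kept with probability $p$). *)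

theory Defs
  imports
    "HOL-Probability.Probability"
    "HOL-Library.Landau_Symbols"
    "HOL-Combinatorics.Combinatorics"
begin

text \<open>
  The letter \<open>s\<^sub>i\<close> is represented by its index \<open>i\<close>, so a word over
  \<open>{s\<^sub>1, \<dots>, s\<^sub>n\<^sub>-\<^sub>1}\<close> is a list with entries in \<open>{1..n - 1}\<close>, and the number of
  occurrences of \<open>s\<^sub>i\<close> in \<open>w\<close> is \<^term>\<open>count_list w i\<close>. Permutations of \<open>{1..n}\<close> are functions
  on \<^typ>\<open>nat\<close> that fix everything outside \<open>{1..n}\<close>.
\<close>

definition is_word :: "nat \<Rightarrow> nat list \<Rightarrow> bool" where
  "is_word n w \<longleftrightarrow> set w \<subseteq> {1..n - 1}"

definition alternating :: "nat \<Rightarrow> nat list \<Rightarrow> bool" where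
  "alternating n w \<longleftrightarrow> (\<forall>i\<in>{1..n - 2}. distinct_adj (filter (\<lambda>x. x = i \<or> x = Suc i) w))"

text \<open>Products are compositions of functions, with the rightmost letter acting first.\<close>

primrec word_perm :: "nat list \<Rightarrow> nat \<Rightarrow> nat" where
  "word_perm [] = id"
| "word_perm (i # w) = Transposition.transpose i (Suc i) \<circ> word_perm w"

definition inversions :: "nat \<Rightarrow> (nat \<Rightarrow> nat) \<Rightarrow> nat" where
  "inversions n v = card {(j, j'). 1 \<le> j \<and> j < j' \<and> j' \<le> n \<and> inv v j > inv v j'}"

primrec random_subword :: "real \<Rightarrow> 'a list \<Rightarrow> 'a list pmf" where
  "random_subword p [] = return_pmf []"
| "random_subword p (x # w) =
     bind_pmf (bernoulli_pmf p) (\<lambda>keep.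
       map_pmf (\<lambda>u. if keep then x # u else u) (random_subword p w))"

definition random_perm :: "real \<Rightarrow> nat list \<Rightarrow> (nat \<Rightarrow> nat) pmf" where
  "random_perm p w = map_pmf word_perm (random_subword p w)"

end

(*
For a word read from left to right, the entry that starts at position x performs a walk: whenever a
letter s_i with i = x or i + 1 = x comes up, it crosses with probability p. Two walks of the same
random subword use the same coin when they meet, but this dependence is invisible to the sign of
their difference: with ties counted 1/2, P(X_a > X_b) equals the value for INDEPENDENT walks, since
the mixed difference of an antisymmetric function vanishes at a meeting. Hence E(inv) is a sum over
pairs a < b of a one-particle quantity.

In an alternating word a single walk is persistent: it keeps its direction with probability p and
otherwise turns around. With d = 1 or -1 the current direction and v = p/(1-p), the position
corrected by (v/2) d is a martingale whose steps have conditional variance exactly v. The number of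
steps is governed by a 1-Lipschitz clock, so a walk started at a makes about
T(a) = O_(a-1) + O_a steps. Comparing with the heat kernel by a supermartingale argument gives a
central limit theorem with an explicit error, and summing the resulting Gaussian tails over b > a
gives sqrt(v T(a) / pi), approximately sqrt(2 / pi) sqrt(v O_a), for every a that is not within a
multiple of sqrt(T(a)) of the ends of {1..n}.
*)
theory Submission
  imports Defs
begin

section \<open>Reduction to independent walks\<close>

text \<open>The correction \<open>(v/2) d\<close> is forced: going on moves the corrected position
  by 1, turning moves it by \<open>v\<close> the other way, and \<open>p = (1 - p) v\<close>. The
  first obstacle is that the number of steps is random. The clock is a function of the position and
  1-Lipschitz at the end of the word, so its final reading differs from the one at \<open>a\<close>
  by at most the displacement, which has order \<open>sqrt (T a)\<close> and is small against
  \<open>T a\<close>. The second obstacle is a turn at an end, where the martingale property fails;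
  it is paid for by a multiple of \<open>(N - a)^2 - v t\<close>, which drops at a turn in
  proportion to the distance from \<open>a\<close> to that end. The indicator of an inversion is not
  smooth and is replaced by a heat kernel of width \<open>sqrt (T a) / h\<close>, where
  \<open>h\<close> is large but stays fixed as n grows. Entries nearer to an end than
  \<open>h^3 sqrt (T a)\<close> are only bounded crudely and cost O(\<open>h^3 K\<close>) in total,
  \<open>K\<close> being the largest count. This is small against the main sum because neighbouring
  counts differ by at most 1: a large \<open>K\<close> makes all counts large.\<close>

primrec walk_exp :: "real \<Rightarrow> nat list \<Rightarrow> (nat \<Rightarrow> real) \<Rightarrow> nat \<Rightarrow> real" where
  "walk_exp p [] f x = f x"
| "walk_exp p (i # w) f x =
     p * walk_exp p w f (Transposition.transpose i (Suc i) x) + (1 - p) * walk_exp p w f x"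

text \<open>Two independent walks: each of them tosses its own coin at every letter.\<close>

primrec pair_exp :: "real \<Rightarrow> nat list \<Rightarrow> (nat \<Rightarrow> nat \<Rightarrow> real) \<Rightarrow> nat \<Rightarrow> nat \<Rightarrow> real" where
  "pair_exp p [] f x y = f x y"
| "pair_exp p (i # w) f x y =
     (let x' = Transposition.transpose i (Suc i) x; y' = Transposition.transpose i (Suc i) y in
      p * p * pair_exp p w f x' y' + p * (1 - p) * pair_exp p w f x' y
      + (1 - p) * p * pair_exp p w f x y' + (1 - p) * (1 - p) * pair_exp p w f x y)"

lemma walk_exp_add: "walk_exp p w (\<lambda>x. f x + g x) x = walk_exp p w f x + walk_exp p w g x"
  by (induction w arbitrary: x) (simp_all add: algebra_simps)

lemma walk_exp_cmult: "walk_exp p w (\<lambda>x. c * f x) x = c * walk_exp p w f x"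
  by (induction w arbitrary: x) (simp_all add: algebra_simps)

lemma walk_exp_const [simp]: "walk_exp p w (\<lambda>_. c) x = c"
  by (induction w arbitrary: x) (simp_all add: algebra_simps)

lemma walk_exp_uminus: "walk_exp p w (\<lambda>x. - f x) x = - walk_exp p w f x"
  using walk_exp_cmult[of p w "-1" f x] by simp

lemma walk_exp_diff: "walk_exp p w (\<lambda>x. f x - g x) x = walk_exp p w f x - walk_exp p w g x"
  using walk_exp_add[of p w f "\<lambda>x. - g x" x] by (simp add: walk_exp_uminus)

lemma walk_exp_sum: "walk_exp p w (\<lambda>x. \<Sum>k\<in>A. f k x) x = (\<Sum>k\<in>A. walk_exp p w (f k) x)"
  by (induction A rule: infinite_finite_induct) (simp_all add: walk_exp_add)

lemma is_word_Cons: "is_word n (i # w) \<longleftrightarrow> 1 \<le> i \<and> i < n \<and> is_word n w"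
  by (auto simp: is_word_def)

lemma transpose_Suc_in_range:
  assumes "1 \<le> i" "i < n" "x \<in> {1..n}"
  shows "Transposition.transpose i (Suc i) x \<in> {1..n}"
  using assms by (auto simp: Transposition.transpose_def)

lemma walk_exp_mono:
  assumes "0 \<le> p" "p \<le> 1" "is_word n w" "x \<in> {1..n}" "\<And>y. y \<in> {1..n} \<Longrightarrow> f y \<le> g y"
  shows "walk_exp p w f x \<le> walk_exp p w g x"
  using assms(3,4)
proof (induction w arbitrary: x)
  case (Cons i w)
  then show ?case
    using assms(1,2) transpose_Suc_in_range[of i n x]
    by (auto simp: is_word_Cons intro!: add_mono mult_left_mono)
qed (use assms in auto)

lemma walk_exp_abs_le:
  assumes "0 \<le> p" "p \<le> 1" "is_word n w" "x \<in> {1..n}"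
  shows "\<bar>walk_exp p w f x\<bar> \<le> walk_exp p w (\<lambda>x. \<bar>f x\<bar>) x"
proof -
  have "walk_exp p w f x \<le> walk_exp p w (\<lambda>x. \<bar>f x\<bar>) x"
    "walk_exp p w (\<lambda>x. - f x) x \<le> walk_exp p w (\<lambda>x. \<bar>f x\<bar>) x"
    using assms by (intro walk_exp_mono; auto)+
  then show ?thesis by (simp add: walk_exp_uminus)
qed

lemma bij_betw_transpose_Suc:
  assumes "1 \<le> i" "i < n"
  shows "bij_betw (Transposition.transpose i (Suc i)) {1..n} {1..n}"
proof (rule bij_betwI[where g = "Transposition.transpose i (Suc i)"])
  show "Transposition.transpose i (Suc i) \<in> {1..n} \<rightarrow> {1..n}"
    using transpose_Suc_in_range[OF assms] by blast
qed (use transpose_Suc_in_range[OF assms] in \<open>auto simp del: One_nat_def\<close>)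

text \<open>Every letter permutes \<open>{1..n}\<close>, so the uniform starting distribution is
  invariant. Later this turns a sum of expectations over all starting points into a sum of plain
  values.\<close>

lemma sum_walk_exp:
  assumes "is_word n w"
  shows "(\<Sum>x=1..n. walk_exp p w f x) = (\<Sum>x=1..n. f x)"
  using assms
proof (induction w)
  case (Cons i w)
  have "(\<Sum>x=1..n. walk_exp p w f (Transposition.transpose i (Suc i) x)) = (\<Sum>x=1..n. walk_exp p w f x)"
    using Cons.prems by (intro sum.reindex_bij_betw bij_betw_transpose_Suc) (auto simp: is_word_Cons)
  with Cons show ?case
    by (simp add: sum.distrib is_word_Cons flip: sum_distrib_left) (simp add: algebra_simps)
qed auto

lemma pair_exp_eq_walk_exp:
  "pair_exp p w f x y = walk_exp p w (\<lambda>x'. walk_exp p w (f x') y) x"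
proof (induction w arbitrary: x y)
  case (Cons i w)
  then show ?case
    by (simp add: Let_def walk_exp_add walk_exp_cmult) (simp add: algebra_simps)
qed simp

lemma pair_exp_swap: "pair_exp p w f x y = pair_exp p w (\<lambda>y x. f x y) y x"
  by (induction w arbitrary: x y) (simp_all add: Let_def algebra_simps)

text \<open>The value at ties makes \<open>step_half - 1/2\<close> antisymmetric.\<close>

definition step_half :: "nat \<Rightarrow> nat \<Rightarrow> real" where
  "step_half x y = (if y < x then 1 else if x = y then 1/2 else 0)"

text \<open>Exchanging the two walks replaces \<open>step_half\<close> by its complement, ties
  included. For \<open>x = y\<close> the value is therefore exactly 1/2, which is what a meeting of
  two entries calls for.\<close>

lemma pair_exp_step_half_sum: "pair_exp p w step_half x y + pair_exp p w step_half y x = 1"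
proof -
  have "pair_exp p w step_half y x = pair_exp p w (\<lambda>x y. step_half y x) x y"
    by (rule pair_exp_swap)
  also have "\<dots> = walk_exp p w (\<lambda>x'. walk_exp p w (\<lambda>y'. 1 - step_half x' y') y) x"
    unfolding pair_exp_eq_walk_exp
    by (intro arg_cong2[where f = "walk_exp p w"] ext refl) (auto simp: step_half_def)
  also have "\<dots> = 1 - pair_exp p w step_half x y"
    by (simp add: walk_exp_diff pair_exp_eq_walk_exp)
  finally show ?thesis by simp
qed

section \<open>Random subwords and the expected number of inversions\<close>

lemma finite_set_pmf_random_subword: "finite (set_pmf (random_subword p w))"
  by (induction w) auto

lemma expectation_random_subword_Cons:
  fixes f :: "'a list \<Rightarrow> real"
  assumes "0 \<le> p" "p \<le> 1"
  shows "measure_pmf.expectation (random_subword p (x # w)) f =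
    p * measure_pmf.expectation (random_subword p w) (\<lambda>u. f (x # u))
    + (1 - p) * measure_pmf.expectation (random_subword p w) f"
proof -
  have "measure_pmf.expectation (random_subword p (x # w)) f =
    (\<Sum>b\<in>UNIV. pmf (bernoulli_pmf p) b *\<^sub>R measure_pmf.expectation
       (map_pmf (\<lambda>u. if b then x # u else u) (random_subword p w)) f)"
    unfolding random_subword.simps
    by (rule pmf_expectation_bind[where A = UNIV]) (auto simp: finite_set_pmf_random_subword)
  then show ?thesis using assms by (simp add: UNIV_bool)
qed

lemma bij_word_perm: "bij (word_perm w)"
proof (induction w)
  case (Cons i w)
  then show ?case
    unfolding word_perm.simps by (intro bij_comp) simp_all
qed (unfold word_perm.simps, rule bij_id)

lemma inv_word_perm_Cons:
  "inv (word_perm (i # w)) x = inv (word_perm w) (Transposition.transpose i (Suc i) x)"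
  using bij_word_perm[of w] by (simp add: o_inv_distrib)

lemma expectation_step_half:
  assumes p: "0 \<le> p" "p \<le> 1" and "x \<noteq> y"
  shows "measure_pmf.expectation (random_subword p w)
    (\<lambda>u. step_half (inv (word_perm u) x) (inv (word_perm u) y)) = pair_exp p w step_half x y"
  using assms(3)
proof (induction w arbitrary: x y)
  case (Cons i w)
  let ?s = "Transposition.transpose i (Suc i)" and ?P = "pair_exp p w step_half"
  have ne: "?s x \<noteq> ?s y" using Cons.prems by (metis transpose_involutory)
  \<comment> \<open>If the letter fixes x or y, both sides have the same two terms. If it exchanges
    x and y, the left side is P(y,x) + P(x,y) = 1 and the right side is P(y,y) + P(x,x) = 1/2 + 1/2.
    Common and independent coins differ by p (1 - p) times the difference of the two sides.\<close>
  have mixed: "?P (?s x) (?s y) + ?P x y = ?P (?s x) y + ?P x (?s y)"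
  proof (cases "?s x = x \<or> ?s y = y")
    case False
    then have "?s x = y" "?s y = x"
      using Cons.prems by (auto simp: Transposition.transpose_def split: if_splits)
    then show ?thesis
      using pair_exp_step_half_sum[of p w x y] pair_exp_step_half_sum[of p w x x]
        pair_exp_step_half_sum[of p w y y] by simp
  qed auto
  have "measure_pmf.expectation (random_subword p (i # w))
    (\<lambda>u. step_half (inv (word_perm u) x) (inv (word_perm u) y)) = p * ?P (?s x) (?s y) + (1 - p) * ?P x y"
    using Cons.IH[OF ne] Cons.IH[OF Cons.prems]
    by (simp add: expectation_random_subword_Cons[OF p] inv_word_perm_Cons del: word_perm.simps random_subword.simps)
  also have "\<dots> = pair_exp p (i # w) step_half x y
      + p * (1 - p) * (?P (?s x) (?s y) + ?P x y - (?P (?s x) y + ?P x (?s y)))"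
    by (simp add: Let_def algebra_simps)
  finally show ?case using mixed by simp
qed simp

definition right_inv :: "real \<Rightarrow> nat \<Rightarrow> nat list \<Rightarrow> nat \<Rightarrow> real" where
  "right_inv p n w a = (\<Sum>b\<in>{a<..n}. pair_exp p w step_half a b)"

lemma inversions_eq_sum:
  assumes "bij v"
  shows "real (inversions n v) = (\<Sum>a=1..n. \<Sum>b\<in>{a<..n}. step_half (inv v a) (inv v b))"
proof -
  have "{(j, j'). 1 \<le> j \<and> j < j' \<and> j' \<le> n \<and> inv v j > inv v j'}
      = Sigma {1..n} (\<lambda>j. {j'\<in>{j<..n}. inv v j > inv v j'})" by auto
  then have "real (inversions n v) = (\<Sum>a=1..n. real (card {j'\<in>{a<..n}. inv v a > inv v j'}))"
    by (simp add: inversions_def)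
  also have "\<dots> = (\<Sum>a=1..n. \<Sum>b\<in>{a<..n}. step_half (inv v a) (inv v b))"
  proof (rule sum.cong[OF refl])
    fix a
    have "step_half (inv v a) (inv v b) = (if inv v a > inv v b then 1 else 0)" if "b \<in> {a<..n}" for b
    proof -
      have "inv v a \<noteq> inv v b"
        using that bij_imp_bij_inv[OF assms] by (metis bij_pointE greaterThanAtMost_iff less_irrefl)
      then show ?thesis by (simp add: step_half_def)
    qed
    then have "(\<Sum>b\<in>{a<..n}. step_half (inv v a) (inv v b))
        = (\<Sum>b\<in>{a<..n}. if inv v a > inv v b then 1 else 0)"
      by (intro sum.cong) auto
    also have "\<dots> = real (card {j'\<in>{a<..n}. inv v a > inv v j'})"
      by (simp add: sum.If_cases Int_def)
    finally show "real (card {j'\<in>{a<..n}. inv v a > inv v j'})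
        = (\<Sum>b\<in>{a<..n}. step_half (inv v a) (inv v b))" by simp
  qed
  finally show ?thesis .
qed

lemma expectation_inversions:
  assumes "0 \<le> p" "p \<le> 1"
  shows "measure_pmf.expectation (random_perm p w) (\<lambda>v. real (inversions n v))
    = (\<Sum>a=1..n. right_inv p n w a)"
proof -
  have int: "integrable (measure_pmf (random_subword p w)) f" for f :: "nat list \<Rightarrow> real"
    by (rule integrable_measure_pmf_finite[OF finite_set_pmf_random_subword])
  have "measure_pmf.expectation (random_perm p w) (\<lambda>v. real (inversions n v))
     = measure_pmf.expectation (random_subword p w) (\<lambda>u. \<Sum>a=1..n. \<Sum>b\<in>{a<..n}.
         step_half (inv (word_perm u) a) (inv (word_perm u) b))"
    by (simp add: random_perm_def inversions_eq_sum[OF bij_word_perm])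
  also have "\<dots> = (\<Sum>a=1..n. right_inv p n w a)"
    unfolding right_inv_def
    by (subst Bochner_Integration.integral_sum, rule int, intro sum.cong refl,
        subst Bochner_Integration.integral_sum, rule int, intro sum.cong refl)
       (auto intro!: expectation_step_half assms)
  finally show ?thesis .
qed

section \<open>Directions, clock and supermartingales\<close>

text \<open>
  A direction \<open>d x = 1\<close> (\<open>d x = -1\<close>) means that the next letter touching position \<open>x\<close> is \<open>x\<close>
  (\<open>x - 1\<close>), and \<open>t x\<close> is the time of that event on a clock that advances by 1 along every step of
  a walk. At the positions 1 and \<open>n\<close> the turn at the boundary is performed immediately and costs an
  additional time unit.
\<close>

definition next_dir :: "nat \<Rightarrow> nat \<Rightarrow> (nat \<Rightarrow> int) \<Rightarrow> nat \<Rightarrow> int" where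
  "next_dir n i d x =
     (if x = i then if i = 1 then 1 else -1
      else if x = Suc i then if Suc i = n then -1 else 1 else d x)"

definition next_time :: "nat \<Rightarrow> nat \<Rightarrow> (nat \<Rightarrow> int) \<Rightarrow> nat \<Rightarrow> int" where
  "next_time n i t x =
     (if x = i then t x + (if i = 1 then 2 else 1)
      else if x = Suc i then t x + (if Suc i = n then 2 else 1) else t x)"

text \<open>Alternation in local form: \<open>d i = 1\<close> and \<open>d (Suc i) = -1\<close> say
  that \<open>i\<close> is the letter expected next at both positions that it touches.\<close>

primrec legal :: "nat \<Rightarrow> nat list \<Rightarrow> (nat \<Rightarrow> int) \<Rightarrow> bool" where
  "legal n [] d \<longleftrightarrow> True"
| "legal n (i # w) d \<longleftrightarrow> 1 \<le> i \<and> i < n \<and> d i = 1 \<and> d (Suc i) = -1 \<and> legal n w (next_dir n i d)"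

primrec end_dir :: "nat \<Rightarrow> nat list \<Rightarrow> (nat \<Rightarrow> int) \<Rightarrow> nat \<Rightarrow> int" where
  "end_dir n [] d = d"
| "end_dir n (i # w) d = end_dir n w (next_dir n i d)"

primrec end_time :: "nat \<Rightarrow> nat list \<Rightarrow> (nat \<Rightarrow> int) \<Rightarrow> nat \<Rightarrow> int" where
  "end_time n [] t = t"
| "end_time n (i # w) t = end_time n w (next_time n i t)"

text \<open>The last condition makes \<open>t\<close> a discrete potential of \<open>d\<close>. It
  forces \<open>t i = t (Suc i)\<close> whenever \<open>d i = 1\<close> and
  \<open>d (Suc i) = -1\<close>, so the two positions exchanged by a legal letter show the same
  clock reading and the clock of a walk depends only on where it is.\<close>

definition admissible :: "nat \<Rightarrow> (nat \<Rightarrow> int) \<Rightarrow> (nat \<Rightarrow> int) \<Rightarrow> bool" where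
  "admissible n d t \<longleftrightarrow> d 1 = 1 \<and> d n = -1 \<and> (\<forall>x\<in>{1..n}. d x = 1 \<or> d x = -1) \<and>
     (\<forall>x\<in>{1..<n}. 2 * (t (Suc x) - t x) = - (d x + d (Suc x)))"

lemma legal_is_word: "legal n w d \<Longrightarrow> is_word n w"
  by (induction w arbitrary: d) (auto simp: is_word_def)

text \<open>At an inner position the direction changes by 2 while the clock advances by 1, and these
  balance in the potential relation. At 1 and \<open>n\<close> the direction returns to its old
  value at once, and a second clock unit restores the balance with the neighbour.\<close>

lemma admissible_next:
  assumes adm: "admissible n d t" and i: "1 \<le> i" "i < n" and di: "d i = 1" "d (Suc i) = -1"
  shows "admissible n (next_dir n i d) (next_time n i t)"
proof -
  have "2 * (next_time n i t (Suc x) - next_time n i t x)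
      = - (next_dir n i d x + next_dir n i d (Suc x))" if x: "x \<in> {1..<n}" for x
  proof -
    have e: "2 * (t (Suc x) - t x) = - (d x + d (Suc x))"
      using adm x by (auto simp: admissible_def)
    consider "x = i" | "x = Suc i" | "Suc x = i" | "x \<noteq> i" "x \<noteq> Suc i" "Suc x \<noteq> i" by blast
    then show ?thesis
      using e di i x by cases (auto simp: next_dir_def next_time_def)
  qed
  moreover have "next_dir n i d 1 = 1" "next_dir n i d n = -1"
    using adm i by (auto simp: admissible_def next_dir_def)
  moreover have "next_dir n i d x = 1 \<or> next_dir n i d x = -1" if "x \<in> {1..n}" for x
    using that adm by (auto simp: next_dir_def admissible_def)
  ultimately show ?thesis by (auto simp: admissible_def)
qed

lemma admissible_end:
  "admissible n d t \<Longrightarrow> legal n w d \<Longrightarrow> admissible n (end_dir n w d) (end_time n w t)"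
proof (induction w arbitrary: d t)
  case (Cons i w)
  then have "admissible n (next_dir n i d) (next_time n i t)"
    by (intro admissible_next) auto
  with Cons show ?case by auto
qed simp

lemma admissible_lipschitz:
  assumes "admissible n d t" "x \<in> {1..n}" "y \<in> {1..n}"
  shows "\<bar>t x - t y\<bar> \<le> \<bar>int x - int y\<bar>"
proof -
  have aux: "1 \<le> x \<Longrightarrow> x + k \<le> n \<Longrightarrow> \<bar>t (x + k) - t x\<bar> \<le> int k" for x k
  proof (induction k)
    case (Suc k)
    have "2 * (t (Suc (x + k)) - t (x + k)) = - (d (x + k) + d (Suc (x + k)))"
      using assms(1) Suc.prems by (auto simp: admissible_def)
    moreover have "d (x + k) = 1 \<or> d (x + k) = -1" "d (Suc (x + k)) = 1 \<or> d (Suc (x + k)) = -1"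
      using assms(1) Suc.prems by (auto simp: admissible_def)
    ultimately have "\<bar>t (Suc (x + k)) - t (x + k)\<bar> \<le> 1" by auto
    with Suc show ?case by auto
  qed auto
  show ?thesis
  proof (cases "x \<le> y")
    case True
    then show ?thesis using aux[of x "y - x"] assms by auto
  next
    case False
    then show ?thesis using aux[of y "x - y"] assms by auto
  qed
qed

text \<open>The clock units spent at \<open>x\<close> while \<open>w\<close> is read. The factor 2
  at the ends comes from the additional unit for the turn there, and it keeps the value close to
  twice the count of a neighbouring letter.\<close>

definition touches :: "nat \<Rightarrow> nat list \<Rightarrow> nat \<Rightarrow> nat" where
  "touches n w x = (if x = 1 then 2 * count_list w 1 else if x = n then 2 * count_list w (n - 1)
     else count_list w (x - 1) + count_list w x)"

lemma end_time_eq: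
  assumes "is_word n w" "x \<in> {1..n}" "2 \<le> n"
  shows "end_time n w t x = t x + int (touches n w x)"
  using assms(1)
proof (induction w arbitrary: t)
  case (Cons i w)
  then have IH: "end_time n w (next_time n i t) x = next_time n i t x + int (touches n w x)"
    by (auto simp: is_word_Cons)
  have "next_time n i t x + int (touches n w x) = t x + int (touches n (i # w) x)"
  proof -
    have i: "1 \<le> i" "i < n" using Cons.prems by (auto simp: is_word_Cons)
    consider "x = 1" | "x \<noteq> 1" "x = n" | "x \<noteq> 1" "x \<noteq> n" by blast
    then show ?thesis
      using i assms(2,3) by cases (auto simp: next_time_def touches_def)
  qed
  with IH show ?case by simp
qed (auto simp: touches_def)

text \<open>Every letter \<open>x - 1\<close> raises the direction at \<open>x\<close> from -1 to 1,
  and every letter \<open>x\<close> lowers it again; the total change is read off at the two ends of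
  the word.\<close>

lemma count_diff_eq:
  assumes "legal n w d" "1 < x" "x < n"
  shows "2 * (int (count_list w (x - 1)) - int (count_list w x)) = end_dir n w d x - d x"
  using assms(1)
proof (induction w arbitrary: d)
  case (Cons i w)
  then have IH: "2 * (int (count_list w (x - 1)) - int (count_list w x))
      = end_dir n w (next_dir n i d) x - next_dir n i d x"
    by auto
  consider "x = i" | "x = Suc i" | "x \<noteq> i" "x \<noteq> Suc i" by blast
  then show ?case
    using IH Cons.prems assms(2,3) by cases (auto simp: next_dir_def)
qed auto

lemma count_lipschitz:
  assumes adm: "admissible n d t" and leg: "legal n w d" and x: "1 < x" "x < n"
  shows "\<bar>int (count_list w (x - 1)) - int (count_list w x)\<bar> \<le> 1"
proof -
  have "x \<in> {1..n}" using x by auto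
  then have "d x = 1 \<or> d x = -1" "end_dir n w d x = 1 \<or> end_dir n w d x = -1"
    using adm admissible_end[OF adm leg] unfolding admissible_def by blast+
  then show ?thesis using count_diff_eq[OF leg x] by auto
qed

text \<open>The last hypothesis says that \<open>d\<close> announces the first letter touching each
  inner position. It survives a letter \<open>i\<close>, since alternation forces the next letter at
  positions \<open>i\<close> and \<open>Suc i\<close> to be the other one.\<close>

lemma legal_if_consistent:
  assumes "alternating n w" "is_word n w" "d 1 = 1" "d n = -1"
    "\<And>i j u. \<lbrakk>1 \<le> i; Suc i < n; filter (\<lambda>x. x = i \<or> x = Suc i) w = j # u\<rbrakk>
       \<Longrightarrow> d (Suc i) = (if j = Suc i then 1 else -1)"
  shows "legal n w d"
  using assms
proof (induction w arbitrary: d)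
  case (Cons i w)
  have i: "1 \<le> i" "i < n" "is_word n w" using Cons.prems(2) by (auto simp: is_word_Cons)
  have alt: "distinct_adj (filter (\<lambda>x. x = k \<or> x = Suc k) (i # w))" if "1 \<le> k" "Suc k < n" for k
    using Cons.prems(1) that unfolding alternating_def by (auto simp del: filter.simps)
  have "alternating n w"
    unfolding alternating_def
  proof
    fix k assume "k \<in> {1..n - 2}"
    then have "1 \<le> k" "Suc k < n" by auto
    from alt[OF this] show "distinct_adj (filter (\<lambda>x. x = k \<or> x = Suc k) w)"
      by (auto split: if_splits dest: distinct_adj_ConsD)
  qed
  have di: "d i = 1"
  proof (cases "i = 1")
    case False
    then have "1 \<le> i - 1" "Suc (i - 1) < n"
      "filter (\<lambda>x. x = i - 1 \<or> x = Suc (i - 1)) (i # w) = i # filter (\<lambda>x. x = i - 1 \<or> x = Suc (i - 1)) w"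
      using i by auto
    from Cons.prems(5)[OF this] False i(1) show ?thesis by simp
  qed (use Cons.prems(3) in simp)
  have dSi: "d (Suc i) = -1"
  proof (cases "Suc i = n")
    case False
    then have "Suc i < n" "filter (\<lambda>x. x = i \<or> x = Suc i) (i # w) = i # filter (\<lambda>x. x = i \<or> x = Suc i) w"
      using i by auto
    from Cons.prems(5)[OF i(1) this] show ?thesis by simp
  qed (use Cons.prems(4) in simp)
  have "legal n w (next_dir n i d)"
  proof (rule Cons.IH)
    show "next_dir n i d 1 = 1" "next_dir n i d n = -1"
      using Cons.prems(3,4) i by (auto simp: next_dir_def)
  next
    fix k j u assume k: "1 \<le> k" "Suc k < n" and f: "filter (\<lambda>x. x = k \<or> x = Suc k) w = j # u"
    have j: "j = k \<or> j = Suc k"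
      using f by (auto simp: filter_eq_Cons_iff)
    consider "Suc k = i" | "k = i" | "Suc k \<noteq> i" "k \<noteq> i" by blast
    then show "next_dir n i d (Suc k) = (if j = Suc k then 1 else -1)"
    proof cases
      case 1
      then have "j \<noteq> i" using alt[OF k] f by auto
      with 1 k j show ?thesis by (auto simp: next_dir_def)
    next
      case 2
      then have "j \<noteq> i" using alt[OF k] f by auto
      with 2 k j show ?thesis by (auto simp: next_dir_def)
    next
      case 3
      then show ?thesis using Cons.prems(5)[OF k, of j u] f by (auto simp: next_dir_def)
    qed
  qed fact+
  with di dSi i show ?case by auto
qed (simp only: legal.simps)

lemma exists_admissible_legal:
  assumes "alternating n w" "is_word n w" "2 \<le> n"
  shows "\<exists>d t. admissible n d t \<and> legal n w d"
proof -
  \<comment> \<open>An inner position that no letter touches may have either direction; 1 is an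
    arbitrary choice.\<close>
  define d :: "nat \<Rightarrow> int" where "d = (\<lambda>x. if x = 1 then 1 else if x = n then -1 else
    case filter (\<lambda>y. y = x - 1 \<or> y = Suc (x - 1)) w of [] \<Rightarrow> 1 | j # u \<Rightarrow> if j = x then 1 else -1)"
  \<comment> \<open>Sums of the increments that \<open>admissible\<close> prescribes. The division
    is exact, because a sum of two signs is even.\<close>
  define t :: "nat \<Rightarrow> int" where "t = (\<lambda>x. \<Sum>y\<in>{1..<x}. - ((d y + d (Suc y)) div 2))"
  have d: "d x = 1 \<or> d x = -1" for x
    by (auto simp: d_def split: list.splits)
  have "legal n w d"
    using assms by (intro legal_if_consistent) (auto simp: d_def)
  moreover have "2 * (t (Suc x) - t x) = - (d x + d (Suc x))" if "x \<in> {1..<n}" for x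
    using that d[of x] d[of "Suc x"] by (auto simp: t_def)
  then have "admissible n d t"
    using d assms by (auto simp: admissible_def) (auto simp: d_def)
  ultimately show ?thesis by blast
qed

text \<open>\<open>G\<close> is a function of the clock and of the position corrected by \<open>s / 2\<close> times the direction.\<close>

lemma walk_exp_supermartingale:
  fixes G :: "int \<Rightarrow> real \<Rightarrow> real"
  assumes p: "0 \<le> p" "p \<le> 1"
    and right: "\<And>t N. p * G (t + 1) (N + 1) + (1 - p) * G (t + 1) (N - s) \<le> G t N"
    and left: "\<And>t N. p * G (t + 1) (N - 1) + (1 - p) * G (t + 1) (N + s) \<le> G t N"
    and bounce_left: "\<And>t. G (t + 1) (1 + s / 2) \<le> G t (1 - s / 2)"
    and bounce_right: "\<And>t. G (t + 1) (real n - s / 2) \<le> G t (real n + s / 2)"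
  shows "admissible n d t \<Longrightarrow> legal n w d \<Longrightarrow> x \<in> {1..n} \<Longrightarrow>
    walk_exp p w (\<lambda>x. G (end_time n w t x) (real x + s / 2 * real_of_int (end_dir n w d x))) x
      \<le> G (t x) (real x + s / 2 * real_of_int (d x))"
proof (induction w arbitrary: d t x)
  case (Cons i w)
  let ?s = "Transposition.transpose i (Suc i)"
  let ?d = "next_dir n i d" and ?t = "next_time n i t"
  let ?V = "\<lambda>x. G (?t x) (real x + s / 2 * real_of_int (?d x))"
  have i: "1 \<le> i" "i < n" and di: "d i = 1" "d (Suc i) = -1" and leg: "legal n w ?d"
    using Cons.prems by auto
  have adm: "admissible n ?d ?t"
    using admissible_next[OF Cons.prems(1) i di] .
  have sx: "?s x \<in> {1..n}" using transpose_Suc_in_range[OF i Cons.prems(3)] .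
  have ti: "t (Suc i) = t i"
  proof -
    have "2 * (t (Suc i) - t i) = - (d i + d (Suc i))"
      using Cons.prems(1) i unfolding admissible_def by auto
    with di show ?thesis by simp
  qed
  have "walk_exp p (i # w) (\<lambda>x. G (end_time n (i # w) t x)
      (real x + s / 2 * real_of_int (end_dir n (i # w) d x))) x \<le> p * ?V (?s x) + (1 - p) * ?V x"
    using Cons.IH[OF adm leg sx] Cons.IH[OF adm leg Cons.prems(3)] p
    by (auto intro!: add_mono mult_left_mono)
  also have "\<dots> \<le> G (t x) (real x + s / 2 * real_of_int (d x))"
  proof -
    \<comment> \<open>Only \<open>i = 1\<close> has content: of its two clock units, one belongs to
      the step that turns the walk to the left and the other to the bounce, which changes the
      corrected position from 1 - s/2 to 1 + s/2. The case \<open>Suc i = n\<close> of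
      \<open>Vr\<close> is its mirror image.\<close>
    have Vl: "?V i \<le> G (t i + 1) (real i - s / 2)"
      using bounce_left[of "t i + 1"] by (auto simp: next_time_def next_dir_def add.assoc)
    have Vr: "?V (Suc i) \<le> G (t i + 1) (real (Suc i) + s / 2)"
      using bounce_right[of "t i + 1"] ti by (auto simp: next_time_def next_dir_def algebra_simps)
    consider "x = i" | "x = Suc i" | "x \<noteq> i" "x \<noteq> Suc i" by blast
    then show ?thesis
    proof cases
      case 1
      have "p * ?V (Suc i) + (1 - p) * ?V i
          \<le> p * G (t i + 1) (real (Suc i) + s / 2) + (1 - p) * G (t i + 1) (real i - s / 2)"
        using Vl Vr p by (intro add_mono mult_left_mono) auto
      also have "\<dots> \<le> G (t i) (real i + s / 2)"
        using right[of "t i" "real i + s / 2"] by (simp add: algebra_simps)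
      finally show ?thesis using 1 di by simp
    next
      case 2
      have "p * ?V i + (1 - p) * ?V (Suc i)
          \<le> p * G (t i + 1) (real i - s / 2) + (1 - p) * G (t i + 1) (real (Suc i) + s / 2)"
        using Vl Vr p by (intro add_mono mult_left_mono) auto
      also have "\<dots> \<le> G (t i) (real (Suc i) - s / 2)"
        using left[of "t i" "real (Suc i) - s / 2"] by (simp add: algebra_simps)
      finally show ?thesis using 2 di ti by simp
    next
      case 3
      then have "?s x = x" "?t x = t x" "?d x = d x"
        by (auto simp: next_time_def next_dir_def)
      then show ?thesis by (simp add: algebra_simps)
    qed
  qed
  finally show ?case .
qed simp

section \<open>The Gaussian distribution function\<close>

definition gauss_cdf :: "real \<Rightarrow> real" where
  "gauss_cdf x = cdf std_normal_distribution x"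

lemma DERIV_std_normal_density:
  "(std_normal_density has_real_derivative - x * std_normal_density x) (at x)"
  unfolding std_normal_density_def
  by (auto intro!: derivative_eq_intros simp: field_simps)

lemma continuous_on_std_normal_density: "continuous_on A std_normal_density"
  by (meson DERIV_std_normal_density DERIV_continuous continuous_at_imp_continuous_on)

lemma gauss_cdf_diff:
  assumes "a \<le> y"
  shows "gauss_cdf y = gauss_cdf a + integral {a..y} std_normal_density"
proof (cases "a = y")
  case False
  then have ay: "a < y" using assms by simp
  interpret N: real_distribution std_normal_distribution by (rule real_dist_normal_dist)
  have "measure std_normal_distribution {a<..y}
      = (\<integral>x. indicator {a<..y} x \<partial>density lborel std_normal_density)"
    by simp
  also have "\<dots> = (\<integral>x. std_normal_density x * indicator {a<..y} x \<partial>lborel)"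
    by (rule integral_real_density) auto
  also have "\<dots> = set_lebesgue_integral lborel {a<..y} std_normal_density"
    by (simp add: set_lebesgue_integral_def mult.commute)
  also have "\<dots> = integral {a<..y} std_normal_density"
  proof (rule set_borel_integral_eq_integral(2))
    have "integrable lborel std_normal_density"
      using integrable_normal_density[of 1 0] by simp
    then show "set_integrable lborel {a<..y} std_normal_density"
      unfolding set_integrable_def by (intro integrable_mult_indicator) auto
  qed
  also have "\<dots> = integral {a..y} std_normal_density"
    by (rule integral_spike_set; rule negligible_subset[of "{a}"]) auto
  finally show ?thesis
    using N.cdf_diff_eq[OF ay] by (simp add: gauss_cdf_def)
qed simp

lemma DERIV_gauss_cdf:
  "(gauss_cdf has_real_derivative std_normal_density x) (at x)"
proof -
  have "((\<lambda>y. integral {x - 1..y} std_normal_density) has_real_derivative std_normal_density x)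
      (at x within {x - 1..x + 1})"
    by (intro integral_has_real_derivative continuous_on_std_normal_density) auto
  then have "((\<lambda>y. gauss_cdf (x - 1) + integral {x - 1..y} std_normal_density)
      has_real_derivative 0 + std_normal_density x) (at x within {x - 1..x + 1})"
    by (intro DERIV_add DERIV_const)
  then have "(gauss_cdf has_real_derivative std_normal_density x) (at x within {x - 1..x + 1})"
    unfolding add_0_left
    by (rule has_field_derivative_transform_within[of _ _ _ _ 1]) (auto simp: gauss_cdf_diff[of "x - 1", symmetric])
  moreover have "at x within {x - 1..x + 1} = at x"
    by (rule at_within_Icc_at) auto
  ultimately show ?thesis by simp
qed

lemmas DERIV_gauss_cdf_chain [derivative_intros] = DERIV_chain2[OF DERIV_gauss_cdf]
lemmas DERIV_std_normal_density_chain [derivative_intros] = DERIV_chain2[OF DERIV_std_normal_density]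

lemma gauss_cdf_bounds: "0 \<le> gauss_cdf x" "gauss_cdf x \<le> 1"
proof -
  interpret N: real_distribution std_normal_distribution by (rule real_dist_normal_dist)
  show "0 \<le> gauss_cdf x" "gauss_cdf x \<le> 1"
    by (simp_all add: gauss_cdf_def N.cdf_nonneg N.cdf_bounded_prob)
qed

lemma gauss_cdf_mono: "x \<le> y \<Longrightarrow> gauss_cdf x \<le> gauss_cdf y"
proof -
  interpret N: real_distribution std_normal_distribution by (rule real_dist_normal_dist)
  show "x \<le> y \<Longrightarrow> gauss_cdf x \<le> gauss_cdf y"
    by (simp add: gauss_cdf_def N.cdf_nondecreasing)
qed

lemma gauss_cdf_at_top: "(gauss_cdf \<longlongrightarrow> 1) at_top"
proof -
  interpret N: real_distribution std_normal_distribution by (rule real_dist_normal_dist)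
  show ?thesis using N.cdf_lim_at_top_prob by (simp add: gauss_cdf_def[abs_def])
qed

lemma gauss_cdf_at_bot: "(gauss_cdf \<longlongrightarrow> 0) at_bot"
proof -
  interpret N: real_distribution std_normal_distribution by (rule real_dist_normal_dist)
  show ?thesis using N.cdf_lim_at_bot by (simp add: gauss_cdf_def[abs_def])
qed

lemma std_normal_density_minus: "std_normal_density (- x) = std_normal_density x"
  by (simp add: std_normal_density_def)

lemma gauss_cdf_minus: "gauss_cdf (- x) = 1 - gauss_cdf x"
proof -
  have "((\<lambda>x. gauss_cdf x + gauss_cdf (- x)) has_real_derivative 0) (at x)" for x
    by (rule derivative_eq_intros refl)+ (simp add: std_normal_density_minus)
  then have const: "(\<lambda>y. gauss_cdf y + gauss_cdf (- y)) = (\<lambda>_. gauss_cdf x + gauss_cdf (- x))"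
    using DERIV_isconst_all by blast
  have "((\<lambda>y. gauss_cdf y + gauss_cdf (- y)) \<longlongrightarrow> 1 + 0) at_top"
    by (intro tendsto_add gauss_cdf_at_top filterlim_compose[OF gauss_cdf_at_bot]
      filterlim_uminus_at_bot_at_top)
  then have "gauss_cdf x + gauss_cdf (- x) = 1"
    unfolding const by (simp add: tendsto_const_iff)
  then show ?thesis by simp
qed

lemma gauss_cdf_0 [simp]: "gauss_cdf 0 = 1 / 2"
  using gauss_cdf_minus[of 0] by simp

text \<open>With u = y^2/2, the even moments follow from exp(-u) (1 + u + u^2/2) <= 1 and 1/sqrt(2
  pi) <= 1/2; the odd ones follow from these through |y| <= (1 + y^2)/2.\<close>

lemma std_normal_density_moment_bounds:
  fixes y :: real
  shows "std_normal_density y \<le> 1 / 2" "y\<^sup>2 * std_normal_density y \<le> 1"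
    "\<bar>y\<bar> * std_normal_density y \<le> 1" "\<bar>y\<bar> ^ 3 * std_normal_density y \<le> 3"
proof -
  define u where "u = y\<^sup>2 / 2"
  define c where "c = 1 / sqrt (2 * pi)"
  have u: "0 \<le> u" "y\<^sup>2 = 2 * u" by (auto simp: u_def)
  have "sqrt (2 * pi) \<ge> sqrt (2\<^sup>2)"
    by (intro real_sqrt_le_mono) (use pi_ge_two in auto)
  then have c: "0 < c" "c \<le> 1 / 2" by (auto simp: c_def field_simps)
  have g: "std_normal_density y = c * exp (- u)"
    by (simp add: std_normal_density_def c_def u_def)
  have g0: "0 \<le> std_normal_density y" by simp
  have "exp (- u) * (1 + u + u\<^sup>2 / 2) \<le> exp (- u) * exp u"
    using exp_lower_Taylor_quadratic[OF u(1)] by (intro mult_left_mono) auto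
  then have e: "exp (- u) * (1 + u + u\<^sup>2 / 2) \<le> 1" by (simp flip: exp_add)
  have "c * (exp (- u) * (1 + u + u\<^sup>2 / 2)) \<le> 1 / 2 * 1"
    using c e u(1) by (intro mult_mono) auto
  then have b: "std_normal_density y * (1 + u + u\<^sup>2 / 2) \<le> 1 / 2"
    by (simp add: g mult.assoc)
  have b1: "std_normal_density y * 1 \<le> std_normal_density y * (1 + u + u\<^sup>2 / 2)"
    and b2: "std_normal_density y * u \<le> std_normal_density y * (1 + u + u\<^sup>2 / 2)"
    and b3: "std_normal_density y * (u\<^sup>2 / 2) \<le> std_normal_density y * (1 + u + u\<^sup>2 / 2)"
    using u g0 by (intro mult_left_mono; simp)+
  show 1: "std_normal_density y \<le> 1 / 2" using b b1 by simp
  show 2: "y\<^sup>2 * std_normal_density y \<le> 1"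
  proof -
    have "y\<^sup>2 * std_normal_density y = 2 * (std_normal_density y * u)" using u by simp
    then show ?thesis using b b2 by linarith
  qed
  have 4: "y ^ 4 * std_normal_density y \<le> 4"
  proof -
    have "y ^ 4 = (y\<^sup>2)\<^sup>2" by simp
    also have "\<dots> = 4 * u\<^sup>2" using u by (simp add: power2_eq_square)
    finally have "y ^ 4 * std_normal_density y = 8 * (std_normal_density y * (u\<^sup>2 / 2))" by simp
    then show ?thesis using b b3 by linarith
  qed
  have "(\<bar>y\<bar> - 1)\<^sup>2 \<ge> 0" by simp
  then have "\<bar>y\<bar> \<le> (1 + y\<^sup>2) / 2" by (simp add: power2_eq_square algebra_simps)
  then have "\<bar>y\<bar> * std_normal_density y \<le> (1 + y\<^sup>2) / 2 * std_normal_density y"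
    by (intro mult_right_mono) auto
  then show "\<bar>y\<bar> * std_normal_density y \<le> 1" using 1 2 by (simp add: algebra_simps)
  have "y\<^sup>2 * (\<bar>y\<bar> - 1)\<^sup>2 \<ge> 0" by simp
  then have "\<bar>y\<bar> ^ 3 \<le> (y\<^sup>2 + y ^ 4) / 2"
    by (simp add: power2_eq_square algebra_simps eval_nat_numeral abs_if split: if_splits)
  then have "\<bar>y\<bar> ^ 3 * std_normal_density y \<le> (y\<^sup>2 + y ^ 4) / 2 * std_normal_density y"
    by (intro mult_right_mono) auto
  then show "\<bar>y\<bar> ^ 3 * std_normal_density y \<le> 3" using 4 2 by (simp add: algebra_simps)
qed

lemma DERIV_bound_imp_lipschitz:
  fixes f :: "real \<Rightarrow> real"
  assumes "\<And>z. z \<in> {min x y..max x y} \<Longrightarrow> (f has_real_derivative f' z) (at z)"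
    "\<And>z. z \<in> {min x y..max x y} \<Longrightarrow> \<bar>f' z\<bar> \<le> B"
  shows "\<bar>f x - f y\<bar> \<le> B * \<bar>x - y\<bar>"
  using field_differentiable_bound[of "{min x y..max x y}" f f' B x y] assms
  by (auto intro: has_field_derivative_at_within)

lemma gauss_cdf_lipschitz: "\<bar>gauss_cdf x - gauss_cdf y\<bar> \<le> \<bar>x - y\<bar>"
proof -
  have "\<bar>gauss_cdf x - gauss_cdf y\<bar> \<le> 1 * \<bar>x - y\<bar>"
  proof (rule DERIV_bound_imp_lipschitz[OF DERIV_gauss_cdf])
    show "\<bar>std_normal_density z\<bar> \<le> 1" for z
      using std_normal_density_moment_bounds(1)[of z] by simp
  qed
  then show ?thesis by simp
qed

text \<open>The third derivative of \<open>gauss_cdf\<close> is (y^2 - 1) times the density, bounded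
  by 3; Taylor's formula divides this by 3! = 6.\<close>

lemma gauss_cdf_taylor:
  "\<bar>gauss_cdf (y + h) - (gauss_cdf y + h * std_normal_density y - h\<^sup>2 / 2 * (y * std_normal_density y))\<bar>
     \<le> \<bar>h\<bar> ^ 3 / 2"
proof (cases "h = 0")
  case False
  define D where "D = (\<lambda>m::nat. if m = 0 then gauss_cdf else if m = 1 then std_normal_density
    else if m = 2 then (\<lambda>y. - y * std_normal_density y)
    else (\<lambda>y. (y\<^sup>2 - 1) * std_normal_density y))"
  have der: "DERIV (D m) t :> D (Suc m) t" if "m < 3" for m t
  proof -
    have "m = 0 \<or> m = 1 \<or> m = 2" using that by linarith
    then consider "m = 0" | "m = 1" | "m = 2" by blast
    then show ?thesis
    proof cases
      case 1
      then show ?thesis using DERIV_gauss_cdf by (simp add: D_def)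
    next
      case 2
      then show ?thesis using DERIV_std_normal_density by (simp add: D_def)
    next
      case 3
      have "((\<lambda>y. - y * std_normal_density y) has_real_derivative (t\<^sup>2 - 1) * std_normal_density t) (at t)"
        by (rule derivative_eq_intros refl)+ (simp add: power2_eq_square algebra_simps)
      then show ?thesis using 3 by (simp add: D_def eval_nat_numeral)
    qed
  qed
  have "\<exists>t. (if y + h < y then y + h < t \<and> t < y else y < t \<and> t < y + h) \<and> gauss_cdf (y + h)
      = (\<Sum>m<3. (D m y / fact m) * (y + h - y) ^ m) + (D 3 t / fact 3) * (y + h - y) ^ 3"
  proof (rule Taylor[of 3 D gauss_cdf "y - \<bar>h\<bar>" "y + \<bar>h\<bar>"])
    show "D 0 = gauss_cdf" by (simp add: D_def)
  qed (use der False in auto)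
  then obtain t where t: "gauss_cdf (y + h)
      = (\<Sum>m<3. (D m y / fact m) * (y + h - y) ^ m) + (D 3 t / fact 3) * (y + h - y) ^ 3"
    by blast
  then have *: "gauss_cdf (y + h) - (gauss_cdf y + h * std_normal_density y - h\<^sup>2 / 2 * (y * std_normal_density y))
      = (t\<^sup>2 * std_normal_density t - std_normal_density t) / 6 * h ^ 3"
    by (simp add: D_def eval_nat_numeral fact_numeral) (simp add: algebra_simps power2_eq_square)
  have "0 \<le> t\<^sup>2 * std_normal_density t" "0 \<le> std_normal_density t" by auto
  then have "\<bar>t\<^sup>2 * std_normal_density t - std_normal_density t\<bar> \<le> 3"
    using std_normal_density_moment_bounds(1,2)[of t] by linarith
  then have "\<bar>t\<^sup>2 * std_normal_density t - std_normal_density t\<bar> * \<bar>h\<bar> ^ 3 \<le> 3 * \<bar>h\<bar> ^ 3"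
    by (intro mult_right_mono) auto
  then show ?thesis unfolding * by (simp add: abs_mult power_abs mult.commute)
qed simp

section \<open>The heat kernel and its expansion along one step\<close>

text \<open>The solution of \<open>2 \<partial>f/\<partial>s = \<partial>\<^sup>2f/\<partial>x\<^sup>2\<close> that starts from the unit step (at \<open>s = 0\<close>, division by 0 makes it the constant \<open>1/2\<close>).\<close>

definition heat :: "real \<Rightarrow> real \<Rightarrow> real" where
  "heat s x = gauss_cdf (x / sqrt s)"

lemma heat_minus: "heat s (- x) = 1 - heat s x"
  by (simp add: heat_def gauss_cdf_minus)

lemma heat_bounds: "0 \<le> heat s x" "heat s x \<le> 1"
  by (simp_all add: heat_def gauss_cdf_bounds)

lemma heat_lipschitz:
  assumes "0 < s"
  shows "\<bar>heat s x - heat s y\<bar> \<le> \<bar>x - y\<bar> / sqrt s"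
  using gauss_cdf_lipschitz[of "x / sqrt s" "y / sqrt s"] assms
  by (simp add: heat_def flip: diff_divide_distrib)

lemma DERIV_heat_variance:
  assumes "0 < s"
  shows "((\<lambda>s. heat s x) has_real_derivative
    - (x / sqrt s * std_normal_density (x / sqrt s)) / (2 * s)) (at s)"
  unfolding heat_def
  using assms by (auto intro!: derivative_eq_intros simp: field_simps)

lemma heat_variance_lipschitz:
  assumes "0 < m" "m \<le> s" "m \<le> s'"
  shows "\<bar>heat s x - heat s' x\<bar> \<le> \<bar>s - s'\<bar> / m"
proof -
  have "\<bar>heat s x - heat s' x\<bar> \<le> 1 / m * \<bar>s - s'\<bar>"
  proof (rule DERIV_bound_imp_lipschitz[OF DERIV_heat_variance])
    fix z assume z: "z \<in> {min s s'..max s s'}"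
    then have zm: "m \<le> z" using assms by auto
    then show "0 < z" using assms by auto
    let ?y = "x / sqrt z"
    have "\<bar>- (?y * std_normal_density ?y) / (2 * z)\<bar> = \<bar>?y\<bar> * std_normal_density ?y / (2 * z)"
      using zm assms by (simp add: abs_mult)
    also have "\<dots> \<le> 1 / (2 * z)"
      using std_normal_density_moment_bounds(3)[of ?y] zm assms by (intro divide_right_mono) auto
    also have "\<dots> \<le> 1 / m" using zm assms by (intro frac_le) auto
    finally show "\<bar>- (?y * std_normal_density ?y) / (2 * z)\<bar> \<le> 1 / m" .
  qed
  then show ?thesis by simp
qed

text \<open>In terms of y = x / sqrt s, the second derivative in s is (3y - y^3)/4 times the density
  at y, divided by s^2; the moment bounds keep it below 2/s^2.\<close>

lemma heat_variance_taylor: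
  assumes s: "0 < s" and h: "0 \<le> h"
  shows "\<bar>heat (s + h) x - (heat s x - h * (x / sqrt s * std_normal_density (x / sqrt s)) / (2 * s))\<bar>
    \<le> h\<^sup>2 / s\<^sup>2"
proof (cases "h = 0")
  case False
  define y where "y = (\<lambda>s. x / sqrt s)"
  define D where "D = (\<lambda>m::nat. if m = 0 then (\<lambda>s. heat s x)
    else if m = 1 then (\<lambda>s. - (y s * std_normal_density (y s)) / (2 * s))
    else (\<lambda>s. (3 / 4 * (y s * std_normal_density (y s)) - y s ^ 3 * std_normal_density (y s) / 4) / s\<^sup>2))"
  have dy: "(y has_real_derivative - y r / (2 * r)) (at r)" if "0 < r" for r
    unfolding y_def using that by (auto intro!: derivative_eq_intros simp: field_simps)
  have der: "DERIV (D m) r :> D (Suc m) r" if "m < 2" "s \<le> r" for m r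
  proof (cases "m = 0")
    case True
    then show ?thesis using DERIV_heat_variance[of r x] that s by (simp add: D_def y_def)
  next
    case False
    then have m: "m = 1" using that by simp
    have r: "0 < r" using that s by simp
    note [derivative_intros] = DERIV_chain2[OF dy]
    have "((\<lambda>s. - (y s * std_normal_density (y s)) / (2 * s)) has_real_derivative
       (3 / 4 * (y r * std_normal_density (y r)) - y r ^ 3 * std_normal_density (y r) / 4) / r\<^sup>2) (at r)"
      using r by (auto intro!: derivative_eq_intros dy simp: field_simps eval_nat_numeral)
    then show ?thesis using m by (simp add: D_def)
  qed
  obtain r where r: "s < r" "heat (s + h) x
      = (\<Sum>m<2. (D m s / fact m) * (s + h - s) ^ m) + (D 2 r / fact 2) * (s + h - s)\<^sup>2"
    using Taylor_up[of 2 D "\<lambda>s. heat s x" s "s + h" s] der False h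
    by (auto simp: D_def)
  let ?y = "y r"
  have "heat (s + h) x - (heat s x - h * (x / sqrt s * std_normal_density (x / sqrt s)) / (2 * s))
      = (3 / 4 * (?y * std_normal_density ?y) - ?y ^ 3 * std_normal_density ?y / 4) / r\<^sup>2 / 2 * h\<^sup>2"
    unfolding r by (simp add: D_def y_def eval_nat_numeral)
  moreover have "\<bar>(3 / 4 * (?y * std_normal_density ?y) - ?y ^ 3 * std_normal_density ?y / 4) / r\<^sup>2 / 2 * h\<^sup>2\<bar>
      \<le> h\<^sup>2 / s\<^sup>2"
  proof -
    have "\<bar>?y * std_normal_density ?y\<bar> \<le> 1" "\<bar>?y ^ 3 * std_normal_density ?y\<bar> \<le> 3"
      using std_normal_density_moment_bounds(3,4)[of ?y] by (simp_all add: abs_mult power_abs)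
    then have "\<bar>3 / 4 * (?y * std_normal_density ?y) - ?y ^ 3 * std_normal_density ?y / 4\<bar> \<le> 2"
      by linarith
    then have "\<bar>3 / 4 * (?y * std_normal_density ?y) - ?y ^ 3 * std_normal_density ?y / 4\<bar> * h\<^sup>2
      \<le> 2 * h\<^sup>2" by (intro mult_right_mono) auto
    then have "\<bar>3 / 4 * (?y * std_normal_density ?y) - ?y ^ 3 * std_normal_density ?y / 4\<bar> * h\<^sup>2 / (2 * r\<^sup>2)
       \<le> 2 * h\<^sup>2 / (2 * r\<^sup>2)" by (intro divide_right_mono) auto
    also have "\<dots> \<le> h\<^sup>2 / s\<^sup>2"
      using r s by (simp add: frac_le power_mono)
    finally show ?thesis by (simp add: abs_mult)
  qed
  ultimately show ?thesis by simp
qed simp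

text \<open>A step of +1 with probability p and -v with probability 1 - p has mean 0 and variance v.
  The terms of first order cancel, those of second order give v/2 times the second space derivative,
  and the cubic remainders form the error.\<close>

lemma heat_step_same_variance:
  fixes p v :: real
  assumes p: "0 < p" "p < 1" and v: "v = p / (1 - p)" and s: "0 < s"
  shows "\<bar>p * heat s (x + 1) + (1 - p) * heat s (x - v)
      - (heat s x - v * (x / sqrt s * std_normal_density (x / sqrt s)) / (2 * s))\<bar>
    \<le> (1 + v ^ 3) / (s * sqrt s)"
proof -
  define y where "y = x / sqrt s"
  define h where "h = 1 / sqrt s"
  define g where "g = std_normal_density y"
  have h: "0 < h" "h\<^sup>2 = 1 / s" using s by (auto simp: h_def power_divide)
  have h3: "h ^ 3 = 1 / (s * sqrt s)" using s by (simp add: h_def power_divide power3_eq_cube)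
  have v0: "0 < v" "(1 - p) * v = p" using p v by auto
  have e1: "\<bar>gauss_cdf (y + h) - (gauss_cdf y + h * g - h\<^sup>2 / 2 * (y * g))\<bar> \<le> h ^ 3 / 2"
    using gauss_cdf_taylor[of y h] h by (simp add: g_def)
  have e2: "\<bar>gauss_cdf (y + - (v * h)) - (gauss_cdf y + - (v * h) * g - (v * h)\<^sup>2 / 2 * (y * g))\<bar> \<le> (v * h) ^ 3 / 2"
    using gauss_cdf_taylor[of y "- (v * h)"] h v0 by (simp add: g_def)
  have "p * heat s (x + 1) + (1 - p) * heat s (x - v) - (heat s x - v * (y * g) / (2 * s))
     = p * (gauss_cdf (y + h) - (gauss_cdf y + h * g - h\<^sup>2 / 2 * (y * g)))
      + (1 - p) * (gauss_cdf (y + - (v * h)) - (gauss_cdf y + - (v * h) * g - (v * h)\<^sup>2 / 2 * (y * g)))"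
  proof -
    have z: "p * h - (1 - p) * (v * h) = 0" and "(1 - p) * (v * h)\<^sup>2 = p * v * h\<^sup>2"
      using v0(2) by (simp_all add: power2_eq_square flip: mult.assoc)
    moreover have "p * h\<^sup>2 + p * v * h\<^sup>2 = v / s"
    proof -
      have "p + p * v = v" using v0 by (simp add: algebra_simps)
      then have "(p + p * v) * h\<^sup>2 = v * h\<^sup>2" by simp
      then show ?thesis using h by (simp add: algebra_simps)
    qed
    ultimately have q: "p * h\<^sup>2 + (1 - p) * (v * h)\<^sup>2 = v / s" by simp
    have ht: "heat s (x + 1) = gauss_cdf (y + h)" "heat s (x - v) = gauss_cdf (y + - (v * h))"
      "heat s x = gauss_cdf y"
      by (simp_all add: heat_def y_def h_def add_divide_distrib diff_divide_distrib)
    have "p * (A - (C + h * g - h\<^sup>2 / 2 * Y)) + (1 - p) * (B - (C + - (v * h) * g - (v * h)\<^sup>2 / 2 * Y))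
       = p * A + (1 - p) * B - C - (p * h - (1 - p) * (v * h)) * g
         + (p * h\<^sup>2 + (1 - p) * (v * h)\<^sup>2) / 2 * Y" for A B C Y
      by (simp add: field_simps)
    then show ?thesis unfolding z q ht by simp
  qed
  also have "\<bar>\<dots>\<bar> \<le> p * (h ^ 3 / 2) + (1 - p) * ((v * h) ^ 3 / 2)"
  proof -
    have "\<bar>\<dots>\<bar> \<le> p * \<bar>gauss_cdf (y + h) - (gauss_cdf y + h * g - h\<^sup>2 / 2 * (y * g))\<bar>
      + (1 - p) * \<bar>gauss_cdf (y + - (v * h)) - (gauss_cdf y + - (v * h) * g - (v * h)\<^sup>2 / 2 * (y * g))\<bar>"
      using p by (intro order_trans[OF abs_triangle_ineq]) (simp add: abs_mult)
    also have "\<dots> \<le> p * (h ^ 3 / 2) + (1 - p) * ((v * h) ^ 3 / 2)"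
      using p e1 e2 by (intro add_mono mult_left_mono) auto
    finally show ?thesis .
  qed
  also have "\<dots> \<le> 1 * h ^ 3 + 1 * (v * h) ^ 3"
    using p h v0 by (intro add_mono mult_mono) auto
  also have "\<dots> = (1 + v ^ 3) / (s * sqrt s)"
    using h3 by (simp add: power_mult_distrib algebra_simps add_divide_distrib)
  finally show ?thesis by (simp add: y_def g_def)
qed

text \<open>For steps after the variance is frozen: nothing compensates the term of second order, so
  the error has order 1/s instead of s^(-3/2).\<close>

lemma heat_clamped_step:
  fixes p v :: real
  assumes p: "0 < p" "p < 1" and v: "v = p / (1 - p)" and s: "1 \<le> s"
  shows "\<bar>p * heat s (x + 1) + (1 - p) * heat s (x - v) - heat s x\<bar> \<le> (1 + v + v\<^sup>2 + v ^ 3) / s"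
proof -
  let ?g = "x / sqrt s * std_normal_density (x / sqrt s)"
  have v0: "0 < v" using p v by auto
  have "\<bar>?g\<bar> \<le> 1"
    using std_normal_density_moment_bounds(3)[of "x / sqrt s"] by (simp add: abs_mult)
  then have "\<bar>v * ?g / (2 * s)\<bar> \<le> v / s"
  proof -
    assume g: "\<bar>?g\<bar> \<le> 1"
    have "\<bar>v * ?g / (2 * s)\<bar> = v * \<bar>?g\<bar> / (2 * s)" using v0 s by (simp add: abs_mult)
    also have "\<dots> \<le> v * 1 / (2 * s)" using g v0 s by (intro divide_right_mono mult_left_mono) auto
    also have "\<dots> \<le> v / s" using v0 s by (simp add: field_simps)
    finally show ?thesis .
  qed
  moreover have "(1 + v ^ 3) / (s * sqrt s) \<le> (1 + v ^ 3) / s"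
    using s v0 by (intro divide_left_mono) auto
  moreover have "(1 + v + v\<^sup>2 + v ^ 3) / s = (1 + v ^ 3) / s + v / s + v\<^sup>2 / s"
    by (simp add: add_divide_distrib)
  moreover have "0 \<le> v\<^sup>2 / s" using s by simp
  moreover have "\<bar>a - b\<bar> \<le> e1 + e2" if "\<bar>a - (b - q)\<bar> \<le> e1" "\<bar>q\<bar> \<le> e2" for a b q e1 e2 :: real
    using that by linarith
  note this[OF heat_step_same_variance[OF p v, of s x], of "v / s"]
  ultimately show ?thesis using s by linarith
qed

text \<open>By the heat equation, raising the variance by v produces the same term of second order
  as averaging over a step. What remains is the cubic error in space and the quadratic error in the
  variance.\<close>

lemma heat_step:
  fixes p v :: real
  assumes p: "0 < p" "p < 1" and v: "v = p / (1 - p)" and s: "1 \<le> s0" "s0 \<le> s"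
  shows "\<bar>p * heat s (x + 1) + (1 - p) * heat s (x - v) - heat (s + v) x\<bar>
    \<le> (1 + v + v\<^sup>2 + v ^ 3) / (s0 * sqrt s0)"
proof -
  have v0: "0 < v" using p v by auto
  have "(1 + v ^ 3) / (s * sqrt s) \<le> (1 + v ^ 3) / (s0 * sqrt s0)"
    using s v0 by (intro divide_left_mono mult_mono) auto
  moreover have "v\<^sup>2 / s\<^sup>2 \<le> v\<^sup>2 / (s0 * sqrt s0)"
  proof (intro divide_left_mono)
    have "sqrt s0 \<le> sqrt (s\<^sup>2)"
      using s by (intro real_sqrt_le_mono) (smt (verit) power2_eq_square mult_le_cancel_left1)
    then show "s0 * sqrt s0 \<le> s\<^sup>2"
      using s unfolding power2_eq_square by (intro mult_mono) auto
  qed (use s in auto)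
  moreover have "(1 + v + v\<^sup>2 + v ^ 3) / (s0 * sqrt s0)
      = (1 + v ^ 3) / (s0 * sqrt s0) + v / (s0 * sqrt s0) + v\<^sup>2 / (s0 * sqrt s0)"
    by (simp add: add_divide_distrib)
  moreover have "0 \<le> v / (s0 * sqrt s0)" using s v0 by simp
  moreover have "\<bar>a - c\<bar> \<le> e1 + e2" if "\<bar>a - (b - q)\<bar> \<le> e1" "\<bar>c - (b - q)\<bar> \<le> e2" for a b c q e1 e2 :: real
    using that by linarith
  note this[OF heat_step_same_variance[OF p v, of s x] heat_variance_taylor[of s v x]]
  ultimately show ?thesis using s v0 by linarith
qed

section \<open>Telescoping sums of Gaussian tails\<close>

lemma has_real_derivative_gauss_primitive:
  "((\<lambda>x. x * gauss_cdf x + std_normal_density x) has_real_derivative gauss_cdf x) (at x)"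
  by (auto intro!: derivative_eq_intros)

text \<open>This is Mills' bound: \<open>gauss_cdf (- y)\<close> is at most
  \<open>std_normal_density y / y\<close>. The difference of the two decreases in y, with derivative
  \<open>- std_normal_density y / y^2\<close>, and has no negative limit at infinity.\<close>

lemma gauss_primitive_nonneg:
  assumes "0 \<le> y"
  shows "0 \<le> - y * gauss_cdf (- y) + std_normal_density (- y)"
proof (cases "y = 0")
  case False
  then have y: "0 < y" using assms by simp
  define m where "m = (\<lambda>y. std_normal_density y / y - gauss_cdf (- y))"
  have dm: "(m has_real_derivative - std_normal_density z / z\<^sup>2) (at z)" if "0 < z" for z
    unfolding m_def using that
    by (auto intro!: derivative_eq_intros simp: std_normal_density_minus power2_eq_square field_simps)
  have mono: "m z \<le> m y" if "y \<le> z" for z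
  proof (rule DERIV_nonpos_imp_nonincreasing[OF that])
    fix x assume "y \<le> x" "x \<le> z"
    then show "\<exists>d. (m has_real_derivative d) (at x) \<and> d \<le> 0"
      using dm[of x] y by (intro exI[of _ "- std_normal_density x / x\<^sup>2"]) auto
  qed
  have "((\<lambda>z. - gauss_cdf (- z)) \<longlongrightarrow> - 0) at_top"
    by (intro tendsto_minus filterlim_compose[OF gauss_cdf_at_bot] filterlim_uminus_at_bot_at_top)
  moreover have "eventually (\<lambda>z. - gauss_cdf (- z) \<le> m y) at_top"
    using eventually_ge_at_top[of y]
  proof eventually_elim
    case (elim z)
    then have "0 \<le> std_normal_density z / z" using y by simp
    with mono[OF elim] show ?case by (simp add: m_def)
  qed
  ultimately have "- 0 \<le> m y"
    by (rule tendsto_upperbound) simp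
  then show ?thesis using y by (simp add: m_def field_simps std_normal_density_minus)
qed simp

text \<open>\<open>H\<close> is the primitive of the distribution function, so the sums of Gaussian tails below telescope.\<close>

lemma heat_tail_increment:
  assumes s: "0 < s"
  defines "H \<equiv> \<lambda>x. x * gauss_cdf x + std_normal_density x"
  shows "heat s (- real (Suc k)) \<le> sqrt s * (H (- real k / sqrt s) - H (- real (Suc k) / sqrt s))"
    "sqrt s * (H (- real k / sqrt s) - H (- real (Suc k) / sqrt s)) \<le> heat s (- real k)"
proof -
  let ?a = "- real (Suc k) / sqrt s" and ?b = "- real k / sqrt s"
  have ab: "?a < ?b" using s by (simp add: field_simps)
  obtain z where z: "?a < z" "z < ?b" "H ?b - H ?a = (?b - ?a) * gauss_cdf z"
    using MVT2[OF ab, of H gauss_cdf] has_real_derivative_gauss_primitive unfolding H_def by blast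
  have "sqrt s * (?b - ?a) = 1" using s by (simp add: field_simps)
  then have "sqrt s * (H ?b - H ?a) = gauss_cdf z" using z(3) by (simp flip: mult.assoc)
  then show "heat s (- real (Suc k)) \<le> sqrt s * (H ?b - H ?a)"
    "sqrt s * (H ?b - H ?a) \<le> heat s (- real k)"
    using z(1,2) gauss_cdf_mono[of ?a z] gauss_cdf_mono[of z ?b] by (simp_all add: heat_def)
qed

lemma sum_heat_upper:
  assumes s: "0 < s"
  shows "(\<Sum>k=1..m. heat s (- real k)) \<le> sqrt s / sqrt (2 * pi)"
proof -
  define H where "H = (\<lambda>x. x * gauss_cdf x + std_normal_density x)"
  have "(\<Sum>k=1..m. heat s (- real k)) = (\<Sum>k<m. heat s (- real (Suc k)))"
    by (intro sum.reindex_bij_witness[of _ Suc "\<lambda>k. k - 1"]) auto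
  also have "\<dots> \<le> (\<Sum>k<m. sqrt s * (H (- real k / sqrt s) - H (- real (Suc k) / sqrt s)))"
    unfolding H_def by (intro sum_mono heat_tail_increment(1) s)
  also have "\<dots> = sqrt s * (H (- real 0 / sqrt s) - H (- real m / sqrt s))"
    unfolding sum_distrib_left[symmetric]
    by (rule arg_cong[of _ _ "\<lambda>x. sqrt s * x"]) (rule sum_lessThan_telescope')
  also have "\<dots> \<le> sqrt s * H 0"
    using gauss_primitive_nonneg[of "real m / sqrt s"] s by (simp add: H_def)
  finally show ?thesis by (simp add: H_def std_normal_density_def)
qed

text \<open>The telescoping sum starts at k = 0, whose term \<open>heat s 0 = 1/2\<close> has to be
  removed. The loss s/m bounds the tail beyond m, since y times the density at y is at most
  1.\<close>

lemma sum_heat_lower: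
  assumes s: "0 < s" and m: "0 < m"
  shows "sqrt s / sqrt (2 * pi) - s / real m - 1 / 2 \<le> (\<Sum>k=1..m. heat s (- real k))"
proof -
  define H where "H = (\<lambda>x. x * gauss_cdf x + std_normal_density x)"
  let ?y = "real m / sqrt s"
  have y: "0 < ?y" using s m by simp
  have "H (- ?y) \<le> std_normal_density ?y"
    using mult_nonneg_nonneg[OF less_imp_le[OF y] gauss_cdf_bounds(1)[of "- ?y"]]
    unfolding H_def by (simp add: std_normal_density_minus)
  also have "\<dots> \<le> 1 / ?y"
    using std_normal_density_moment_bounds(3)[of ?y] y
    by (subst pos_le_divide_eq[OF y]) (simp only: abs_of_pos mult.commute)
  finally have "sqrt s * H (- ?y) \<le> sqrt s * (1 / ?y)" using s by (intro mult_left_mono) auto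
  also have "\<dots> = s / real m" using s by (simp add: field_simps)
  finally have H: "sqrt s * H (- ?y) \<le> s / real m" .
  have "sqrt s * (H (- real 0 / sqrt s) - H (- real m / sqrt s))
      = (\<Sum>k<m. sqrt s * (H (- real k / sqrt s) - H (- real (Suc k) / sqrt s)))"
    unfolding sum_distrib_left[symmetric]
    by (rule arg_cong[of _ _ "\<lambda>x. sqrt s * x"]) (rule sum_lessThan_telescope'[symmetric])
  also have "\<dots> \<le> (\<Sum>k<m. heat s (- real k))"
    unfolding H_def by (intro sum_mono heat_tail_increment(2) s)
  also have "\<dots> = heat s 0 + (\<Sum>k\<in>{1..<m}. heat s (- real k))"
    using m by (simp add: lessThan_atLeast0 sum.atLeast_Suc_lessThan)
  also have "\<dots> \<le> heat s 0 + (\<Sum>k\<in>{1..m}. heat s (- real k))"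
    using heat_bounds by (intro add_left_mono sum_mono2) auto
  finally have "sqrt s * H 0 - sqrt s * H (- ?y) \<le> 1 / 2 + (\<Sum>k=1..m. heat s (- real k))"
    by (simp add: heat_def right_diff_distrib)
  moreover have "sqrt s * H 0 = sqrt s / sqrt (2 * pi)"
    by (simp add: H_def std_normal_density_def)
  ultimately show ?thesis using H by linarith
qed

section \<open>Heat kernel comparison for a single walk\<close>

locale alternating_walk =
  fixes p v :: real and n :: nat and w :: "nat list" and d t :: "nat \<Rightarrow> int"
  assumes p: "0 < p" "p < 1" and v_def: "v = p / (1 - p)" and n: "2 \<le> n"
    and adm: "admissible n d t" and leg: "legal n w d"
begin

abbreviation "T a \<equiv> real (touches n w a)"
abbreviation "E \<equiv> walk_exp p w"
abbreviation "te \<equiv> end_time n w t"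
abbreviation "de \<equiv> end_dir n w d"

lemma word: "is_word n w"
  using legal_is_word[OF leg] .

lemma p_le: "0 \<le> p" "p \<le> 1"
  using p by auto

lemma v: "0 < v"
  using p by (auto simp: v_def)

lemma v_eqs: "(1 - p) * v = p" "p + p * v = v"
  using p by (auto simp: v_def field_simps)

lemma end_admissible: "admissible n de te"
  using admissible_end[OF adm leg] .

lemma dir_cases: "x \<in> {1..n} \<Longrightarrow> d x = 1 \<or> d x = -1" "x \<in> {1..n} \<Longrightarrow> de x = 1 \<or> de x = -1"
  using adm end_admissible unfolding admissible_def by blast+

lemma te_self: "a \<in> {1..n} \<Longrightarrow> real_of_int (te a) = real_of_int (t a) + T a"
  using end_time_eq[OF word _ n, of a t] by simp

lemma te_lipschitz:
  assumes "x \<in> {1..n}" "a \<in> {1..n}"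
  shows "\<bar>real_of_int (te x) - real_of_int (te a)\<bar> \<le> \<bar>real x - real a\<bar>"
  using admissible_lipschitz[OF end_admissible assms] by linarith

lemma t_lipschitz:
  assumes "x \<in> {1..n}" "a \<in> {1..n}"
  shows "\<bar>real_of_int (t x) - real_of_int (t a)\<bar> \<le> \<bar>real x - real a\<bar>"
  using admissible_lipschitz[OF adm assms] by linarith

lemma T_lipschitz:
  assumes "x \<in> {1..n}" "a \<in> {1..n}"
  shows "\<bar>T x - T a\<bar> \<le> 2 * \<bar>real x - real a\<bar>"
proof -
  have "T x - T a = (real_of_int (te x) - real_of_int (te a)) - (real_of_int (t x) - real_of_int (t a))"
    using te_self[OF assms(1)] te_self[OF assms(2)] by simp
  then have "\<bar>T x - T a\<bar> \<le> \<bar>real_of_int (te x) - real_of_int (te a)\<bar> + \<bar>real_of_int (t x) - real_of_int (t a)\<bar>"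
    by (simp only: abs_triangle_ineq4)
  from order_trans[OF this add_mono[OF te_lipschitz[OF assms] t_lipschitz[OF assms]]]
  show ?thesis by simp
qed

lemmas E_supermartingale = walk_exp_supermartingale[OF p_le _ _ _ _ adm leg, of _ v]

lemma quadratic_step:
  "p * (N + 1 - c)\<^sup>2 + (1 - p) * (N - v - c)\<^sup>2 = (N - c)\<^sup>2 + v"
  "p * (N - 1 - c)\<^sup>2 + (1 - p) * (N + v - c)\<^sup>2 = (N - c)\<^sup>2 + v"
proof -
  have "p * (N + e - c)\<^sup>2 + (1 - p) * (N - e * v - c)\<^sup>2
      = (N - c)\<^sup>2 + 2 * e * (N - c) * (p - (1 - p) * v) + e\<^sup>2 * (p + (1 - p) * v * v)" for e
    by (simp add: power2_eq_square algebra_simps)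
  also have "\<dots> e = (N - c)\<^sup>2 + e\<^sup>2 * v" for e
    using v_eqs by simp
  finally have *: "p * (N + e - c)\<^sup>2 + (1 - p) * (N - e * v - c)\<^sup>2 = (N - c)\<^sup>2 + e\<^sup>2 * v" for e .
  show "p * (N + 1 - c)\<^sup>2 + (1 - p) * (N - v - c)\<^sup>2 = (N - c)\<^sup>2 + v"
    using *[of 1] by simp
  show "p * (N - 1 - c)\<^sup>2 + (1 - p) * (N + v - c)\<^sup>2 = (N - c)\<^sup>2 + v"
    using *[of "-1"] by simp
qed

text \<open>Apart from the \<open>v\<close> that the clock accounts for, a turn at an end lowers the
  square by \<open>v\<close> times about twice the distance from \<open>c\<close> to that end. For
  the second moment the sign of this drop is enough; in the heat comparison its size pays for the
  turn.\<close>

lemma quadratic_bounce: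
  "(1 + v / 2 - c)\<^sup>2 = (1 - v / 2 - c)\<^sup>2 + v - v * (2 * c - 1)"
  "(real n - v / 2 - c)\<^sup>2 = (real n + v / 2 - c)\<^sup>2 + v - v * (2 * (real n - c) + 1)"
  by (simp_all add: power2_eq_square algebra_simps)

text \<open>The square of the corrected displacement minus \<open>v\<close> times the clock is a
  martingale along ordinary steps, and turns at the ends only lower it. The final clock reading
  exceeds the one at \<open>a\<close> by at most \<open>|x - a|\<close>, and this linear term is
  absorbed into the square.\<close>

lemma second_moment:
  assumes a: "a \<in> {1..n}"
  shows "E (\<lambda>x. (real x - real a)\<^sup>2) a \<le> 4 * v * T a + 6 * v\<^sup>2"
proof -
  define G where "G = (\<lambda>(\<tau>::int) N. (N - real a)\<^sup>2 - v * real_of_int \<tau>)"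
  define Z where "Z = (\<lambda>x. G (te x) (real x + v / 2 * real_of_int (de x)))"
  have "E Z a \<le> G (t a) (real a + v / 2 * real_of_int (d a))"
    unfolding Z_def
  proof (rule E_supermartingale[OF _ _ _ _ a])
    fix \<tau> N
    show "p * G (\<tau> + 1) (N + 1) + (1 - p) * G (\<tau> + 1) (N - v) \<le> G \<tau> N"
      using quadratic_step(1)[of N "real a"] by (simp add: G_def algebra_simps)
    show "p * G (\<tau> + 1) (N - 1) + (1 - p) * G (\<tau> + 1) (N + v) \<le> G \<tau> N"
      using quadratic_step(2)[of N "real a"] by (simp add: G_def algebra_simps)
    have "0 \<le> v * (2 * real a - 1)" "0 \<le> v * (2 * (real n - real a) + 1)"
      using v a by auto
    then show "G (\<tau> + 1) (1 + v / 2) \<le> G \<tau> (1 - v / 2)"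
      "G (\<tau> + 1) (real n - v / 2) \<le> G \<tau> (real n + v / 2)"
      unfolding G_def quadratic_bounce by (simp_all add: algebra_simps)
  qed
  also have "\<dots> = v\<^sup>2 / 4 - v * real_of_int (t a)"
    using dir_cases(1)[OF a] by (auto simp: G_def power2_eq_square)
  finally have Z: "E Z a \<le> v\<^sup>2 / 4 - v * real_of_int (t a)" .
  have "E (\<lambda>x. (real x - real a)\<^sup>2) a \<le> E (\<lambda>x. 4 * Z x + (4 * v * (real_of_int (t a) + T a) + 5 * v\<^sup>2)) a"
  proof (rule walk_exp_mono[OF p_le word a])
    fix x assume x: "x \<in> {1..n}"
    define z where "z = real x - real a"
    define e where "e = v / 2 * real_of_int (de x)"
    have "e\<^sup>2 = v\<^sup>2 / 4" using dir_cases(2)[OF x] by (auto simp: e_def power2_eq_square)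
    moreover have "0 \<le> (z + 2 * e)\<^sup>2" by simp
    ultimately have 1: "z\<^sup>2 \<le> 2 * (z + e)\<^sup>2 + v\<^sup>2 / 2"
      by (simp add: power2_eq_square algebra_simps)
    have "0 \<le> (\<bar>z\<bar> - 2 * v)\<^sup>2" by simp
    then have 2: "2 * v * \<bar>z\<bar> \<le> z\<^sup>2 / 2 + 2 * v\<^sup>2"
      by (simp add: power2_eq_square algebra_simps)
    have "real_of_int (te x) \<le> real_of_int (t a) + T a + \<bar>z\<bar>"
      using te_lipschitz[OF x a] te_self[OF a] unfolding z_def by linarith
    then have 3: "v * real_of_int (te x) \<le> v * (real_of_int (t a) + T a + \<bar>z\<bar>)"
      using v by (intro mult_left_mono) auto
    have "Z x = (z + e)\<^sup>2 - v * real_of_int (te x)"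
      by (simp add: Z_def G_def z_def e_def algebra_simps)
    then show "(real x - real a)\<^sup>2 \<le> 4 * Z x + (4 * v * (real_of_int (t a) + T a) + 5 * v\<^sup>2)"
      using 1 2 3 unfolding z_def[symmetric] by (simp add: algebra_simps)
  qed
  also have "\<dots> = 4 * E Z a + (4 * v * (real_of_int (t a) + T a) + 5 * v\<^sup>2)"
    by (simp add: walk_exp_add walk_exp_cmult)
  also have "\<dots> \<le> 4 * v * T a + 6 * v\<^sup>2"
    using Z by (simp add: algebra_simps)
  finally show ?thesis .
qed

lemma first_moment:
  assumes a: "a \<in> {1..n}" and T: "1 \<le> T a"
  shows "E (\<lambda>x. \<bar>real x - real a\<bar>) a \<le> (1 + 4 * v + 6 * v\<^sup>2) * sqrt (T a)"
proof -
  define r where "r = sqrt (T a)"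
  have r: "1 \<le> r" "r\<^sup>2 = T a" using T by (auto simp: r_def)
  \<comment> \<open>The inequality between arithmetic and geometric mean, balanced at scale r,
    stands in for Cauchy-Schwarz.\<close>
  have "E (\<lambda>x. \<bar>real x - real a\<bar>) a \<le> E (\<lambda>x. 1 / r * (real x - real a)\<^sup>2 + r) a"
  proof (rule walk_exp_mono[OF p_le word a])
    fix x
    have "0 \<le> (\<bar>real x - real a\<bar> - r)\<^sup>2" by simp
    then have "2 * (\<bar>real x - real a\<bar> * r) \<le> (real x - real a)\<^sup>2 + r\<^sup>2"
      by (simp add: power2_diff algebra_simps)
    moreover have "0 \<le> \<bar>real x - real a\<bar> * r" using r by simp
    ultimately have "\<bar>real x - real a\<bar> * r \<le> (real x - real a)\<^sup>2 + r\<^sup>2" by linarith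
    then show "\<bar>real x - real a\<bar> \<le> 1 / r * (real x - real a)\<^sup>2 + r"
      using r(1) by (simp add: field_simps power2_eq_square)
  qed
  also have "\<dots> = E (\<lambda>x. (real x - real a)\<^sup>2) a / r + r"
    by (simp only: walk_exp_add walk_exp_cmult walk_exp_const) simp
  also have "\<dots> \<le> (4 * v * r\<^sup>2 + 6 * v\<^sup>2) / r + r"
    using second_moment[OF a] r(1) unfolding r(2) by (intro add_right_mono divide_right_mono) auto
  also have "\<dots> \<le> (1 + 4 * v + 6 * v\<^sup>2) * r"
  proof -
    have "6 * v\<^sup>2 * 1 \<le> 6 * v\<^sup>2 * r\<^sup>2" using r(1) by (intro mult_left_mono) auto
    then have "6 * v\<^sup>2 / r \<le> 6 * v\<^sup>2 * r" using r(1) by (simp add: field_simps power2_eq_square)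
    moreover have "(4 * v * r\<^sup>2 + 6 * v\<^sup>2) / r = 4 * v * r + 6 * v\<^sup>2 / r"
      using r(1) by (simp add: add_divide_distrib power2_eq_square)
    ultimately show ?thesis by (simp add: algebra_simps)
  qed
  finally show ?thesis by (simp add: r_def)
qed

definition step_const :: real where "step_const = 1 + v + v\<^sup>2 + v ^ 3"
definition moment_const :: real where "moment_const = 1 + 4 * v + 6 * v\<^sup>2"
definition heat_const :: real where
  "heat_const = v + (v + 2 * step_const) * moment_const + step_const + 2 * v * moment_const + 2 * v + v\<^sup>2"

lemma const_pos: "1 \<le> step_const" "1 \<le> moment_const" "1 \<le> heat_const"
proof -
  show s: "1 \<le> step_const" and m: "1 \<le> moment_const"
    using v by (auto simp: step_const_def moment_const_def)
  have "0 \<le> (v + 2 * step_const) * moment_const" "0 \<le> 2 * v * moment_const" "0 \<le> v\<^sup>2"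
    using s m v by auto
  then show "1 \<le> heat_const" using s v unfolding heat_const_def by linarith
qed

text \<open>The reflection \<open>heat s (- x) = 1 - heat s x\<close> carries the estimate for a
  walk moving right over to one moving left.\<close>

lemma heat_mirror_step:
  fixes s x :: real
  assumes "\<And>x. \<bar>p * heat s (x + 1) + (1 - p) * heat s (x - v) - heat s' x\<bar> \<le> B"
  shows "\<bar>p * heat s (x - 1) + (1 - p) * heat s (x + v) - heat s' x\<bar> \<le> B"
proof -
  have "heat s (- x + 1) = 1 - heat s (x - 1)" "heat s (- x - v) = 1 - heat s (x + v)"
    "heat s' (- x) = 1 - heat s' x"
    using heat_minus[of s "x - 1"] heat_minus[of s "x + v"] heat_minus[of s' x] by simp_all
  then have "p * heat s (- x + 1) + (1 - p) * heat s (- x - v) - heat s' (- x)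
      = - (p * heat s (x - 1) + (1 - p) * heat s (x + v) - heat s' x)"
    by (simp only:) (simp add: algebra_simps)
  then show ?thesis using assms[of "- x"] by simp
qed

text \<open>
  In the supermartingale \<open>G\<close> the variance \<open>S\<close> runs backwards from the clock reading at \<open>a\<close> at the
  end of the word and is frozen afterwards. The term with \<open>\<kappa>\<close> pays for the Taylor error of a step,
  the one with \<open>\<kappa>'\<close> for the steps after the freezing, and the one with \<open>\<beta>\<close>, whose expectation
  drops by at least \<open>\<beta> v D\<close> at each turn at the boundary, for the error made at such a turn.
\<close>

lemma heat_expectation_one_sided:
  fixes sg :: real
  assumes a: "a \<in> {1..n}" and T: "1 \<le> T a" and s0: "1 \<le> s0"
    and D: "0 < D" "D \<le> real a" "D \<le> real n - real a" and sg: "sg = 1 \<or> sg = -1"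
  shows "sg * (E (\<lambda>x. heat s0 (real x - y)) a - heat (s0 + v * T a) (real a - y))
    \<le> heat_const * (1 / sqrt s0 + sqrt (T a) / s0 + T a / (s0 * sqrt s0) + T a / (D * sqrt s0))"
proof -
  define \<kappa> where "\<kappa> = step_const / (s0 * sqrt s0)"
  define \<kappa>' where "\<kappa>' = step_const / s0"
  \<comment> \<open>The 2 covers the two effects of a turn: the corrected position moves by
    \<open>v\<close> and the variance by at most \<open>v\<close>, and each changes the heat kernel
    by at most \<open>v / sqrt s0\<close>.\<close>
  define \<beta> where "\<beta> = 2 / (D * sqrt s0)"
  define S where "S = (\<lambda>\<tau>. s0 + v * max 0 (real_of_int (te a) - real_of_int \<tau>))"
  define G where "G = (\<lambda>\<tau> N. sg * heat (S \<tau>) (N - y) - \<kappa> * real_of_int \<tau>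
    - \<kappa>' * max 0 (real_of_int \<tau> - real_of_int (te a)) + \<beta> * ((N - real a)\<^sup>2 - v * real_of_int \<tau>))"
  have sq: "1 \<le> sqrt s0" using s0 by simp
  have \<kappa>0: "0 \<le> \<kappa>" "0 \<le> \<kappa>'" "\<kappa> \<le> \<kappa>'" "0 \<le> \<beta>"
    using s0 const_pos D sq by (auto simp: \<kappa>_def \<kappa>'_def \<beta>_def field_simps mult_left_le)
  have S: "s0 \<le> S \<tau>" for \<tau> using v by (simp add: S_def)
  have sgm: "sg * (b - c) \<le> B" if "\<bar>b - c\<bar> \<le> B" for b c B
    using sg that by auto
  have drift: "\<bar>p * heat (S (\<tau> + 1)) (x + 1) + (1 - p) * heat (S (\<tau> + 1)) (x - v) - heat (S \<tau>) x\<bar>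
      \<le> \<kappa> + \<kappa>' * (max 0 (real_of_int (\<tau> + 1) - real_of_int (te a)) - max 0 (real_of_int \<tau> - real_of_int (te a)))"
    for \<tau> x
  proof (cases "\<tau> < te a")
    case True
    then have "S \<tau> = S (\<tau> + 1) + v" by (simp add: S_def max_def algebra_simps)
    then have "\<bar>p * heat (S (\<tau> + 1)) (x + 1) + (1 - p) * heat (S (\<tau> + 1)) (x - v) - heat (S \<tau>) x\<bar> \<le> \<kappa>"
      using heat_step[OF p v_def s0 S[of "\<tau> + 1"], of x] by (simp add: \<kappa>_def step_const_def)
    moreover have "max 0 (real_of_int (\<tau> + 1) - real_of_int (te a)) = 0"
      "max 0 (real_of_int \<tau> - real_of_int (te a)) = 0"
      using True by (simp_all only: max_def flip: of_int_diff) auto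
    ultimately show ?thesis by simp
  next
    case False
    then have "S \<tau> = s0" "S (\<tau> + 1) = s0" by (simp_all add: S_def max_def)
    then have "\<bar>p * heat (S (\<tau> + 1)) (x + 1) + (1 - p) * heat (S (\<tau> + 1)) (x - v) - heat (S \<tau>) x\<bar> \<le> \<kappa>'"
      using heat_clamped_step[OF p v_def s0, of x] by (simp add: \<kappa>'_def step_const_def)
    with False \<kappa>0 show ?thesis by (simp add: max_def)
  qed
  have jump: "\<bar>heat (S (\<tau> + 1)) x - heat (S \<tau>) x'\<bar> \<le> \<beta> * v * D" if "\<bar>x - x'\<bar> \<le> v" for \<tau> x x'
  proof -
    have "\<bar>heat (S (\<tau> + 1)) x - heat (S (\<tau> + 1)) x'\<bar> \<le> \<bar>x - x'\<bar> / sqrt (S (\<tau> + 1))"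
      using S[of "\<tau> + 1"] s0 by (intro heat_lipschitz) auto
    also have "\<dots> \<le> v / sqrt s0"
      using S[of "\<tau> + 1"] s0 that by (intro frac_le) auto
    finally have 1: "\<bar>heat (S (\<tau> + 1)) x - heat (S (\<tau> + 1)) x'\<bar> \<le> v / sqrt s0" .
    have "\<bar>heat (S (\<tau> + 1)) x' - heat (S \<tau>) x'\<bar> \<le> \<bar>S (\<tau> + 1) - S \<tau>\<bar> / s0"
      using S s0 by (intro heat_variance_lipschitz) auto
    also have "\<dots> \<le> v / sqrt s0"
    proof (intro frac_le)
      have "\<bar>S (\<tau> + 1) - S \<tau>\<bar> = v * \<bar>max 0 (real_of_int (te a) - real_of_int (\<tau> + 1))
           - max 0 (real_of_int (te a) - real_of_int \<tau>)\<bar>"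
        using v by (simp add: S_def abs_mult flip: right_diff_distrib)
      also have "\<dots> \<le> v * 1"
        using v by (intro mult_left_mono) (auto simp: max_def)
      finally show "\<bar>S (\<tau> + 1) - S \<tau>\<bar> \<le> v" by simp
      show "sqrt s0 \<le> s0" using s0 by (simp add: sqrt_le_D real_le_lsqrt power2_eq_square)
    qed (use s0 v in auto)
    finally have 2: "\<bar>heat (S (\<tau> + 1)) x' - heat (S \<tau>) x'\<bar> \<le> v / sqrt s0" .
    have "\<beta> * v * D = v / sqrt s0 + v / sqrt s0" using D sq by (simp add: \<beta>_def field_simps)
    with 1 2 show ?thesis by linarith
  qed
  define Z where "Z = (\<lambda>x. G (te x) (real x + v / 2 * real_of_int (de x)))"
  have super: "E Z a \<le> G (t a) (real a + v / 2 * real_of_int (d a))"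
    unfolding Z_def
  proof (rule E_supermartingale[OF _ _ _ _ a])
    fix \<tau> N
    let ?m = "\<lambda>\<tau>. max 0 (real_of_int \<tau> - real_of_int (te a))"
    have qs: "\<beta> * (p * (N + 1 - real a)\<^sup>2 + (1 - p) * (N - v - real a)\<^sup>2) = \<beta> * ((N - real a)\<^sup>2 + v)"
      "\<beta> * (p * (N - 1 - real a)\<^sup>2 + (1 - p) * (N + v - real a)\<^sup>2) = \<beta> * ((N - real a)\<^sup>2 + v)"
      by (simp_all only: quadratic_step)
    have e: "N + 1 - y = N - y + 1" "N - v - y = N - y - v" "N - 1 - y = N - y - 1" "N + v - y = N - y + v"
      by simp_all
    have "p * G (\<tau> + 1) (N + 1) + (1 - p) * G (\<tau> + 1) (N - v) - G \<tau> N
      = sg * ((p * heat (S (\<tau> + 1)) (N - y + 1) + (1 - p) * heat (S (\<tau> + 1)) (N - y - v)) - heat (S \<tau>) (N - y))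
        - \<kappa> - \<kappa>' * (?m (\<tau> + 1) - ?m \<tau>)"
      using qs(1) unfolding G_def e by (simp add: algebra_simps)
    then show "p * G (\<tau> + 1) (N + 1) + (1 - p) * G (\<tau> + 1) (N - v) \<le> G \<tau> N"
      using sgm[OF drift[of \<tau> "N - y"]] by simp
    have "p * G (\<tau> + 1) (N - 1) + (1 - p) * G (\<tau> + 1) (N + v) - G \<tau> N
      = sg * ((p * heat (S (\<tau> + 1)) (N - y - 1) + (1 - p) * heat (S (\<tau> + 1)) (N - y + v)) - heat (S \<tau>) (N - y))
        - \<kappa> - \<kappa>' * (?m (\<tau> + 1) - ?m \<tau>)"
      using qs(2) unfolding G_def e by (simp add: algebra_simps)
    then show "p * G (\<tau> + 1) (N - 1) + (1 - p) * G (\<tau> + 1) (N + v) \<le> G \<tau> N"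
      using sgm[OF heat_mirror_step[OF drift[of \<tau>], of "N - y"]] by simp
  next
    fix \<tau>
    let ?m = "\<lambda>\<tau>. max 0 (real_of_int \<tau> - real_of_int (te a))"
    have m: "0 \<le> \<kappa>' * (?m (\<tau> + 1) - ?m \<tau>)" using \<kappa>0 by (simp add: max_def)
    have b: "\<beta> * v * D \<le> \<beta> * (v * (2 * real a - 1))" "\<beta> * v * D \<le> \<beta> * (v * (2 * (real n - real a) + 1))"
    proof -
      have "1 \<le> real a" using a by simp
      then have "D \<le> 2 * real a - 1" using D by linarith
      moreover have "D \<le> 2 * z + 1" if "D \<le> z" for z
        using D(1) that by linarith
      note this[OF D(3)]
      ultimately have "D \<le> 2 * real a - 1" "D \<le> 2 * (real n - real a) + 1" by simp_all
      then show "\<beta> * v * D \<le> \<beta> * (v * (2 * real a - 1))" "\<beta> * v * D \<le> \<beta> * (v * (2 * (real n - real a) + 1))"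
        using \<kappa>0 v unfolding mult.assoc by (intro mult_left_mono; simp)+
    qed
    have "G (\<tau> + 1) (1 + v / 2) - G \<tau> (1 - v / 2)
      = sg * (heat (S (\<tau> + 1)) (1 + v / 2 - y) - heat (S \<tau>) (1 - v / 2 - y)) - \<kappa>
        - \<kappa>' * (?m (\<tau> + 1) - ?m \<tau>) - \<beta> * (v * (2 * real a - 1))"
      unfolding G_def quadratic_bounce by (simp add: algebra_simps)
    moreover have "sg * (heat (S (\<tau> + 1)) (1 + v / 2 - y) - heat (S \<tau>) (1 - v / 2 - y)) \<le> \<beta> * v * D"
      using v by (intro sgm jump) auto
    ultimately show "G (\<tau> + 1) (1 + v / 2) \<le> G \<tau> (1 - v / 2)"
      using m b \<kappa>0 by linarith
    have "G (\<tau> + 1) (real n - v / 2) - G \<tau> (real n + v / 2)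
      = sg * (heat (S (\<tau> + 1)) (real n - v / 2 - y) - heat (S \<tau>) (real n + v / 2 - y)) - \<kappa>
        - \<kappa>' * (?m (\<tau> + 1) - ?m \<tau>) - \<beta> * (v * (2 * (real n - real a) + 1))"
      unfolding G_def quadratic_bounce by (simp add: algebra_simps)
    moreover have "sg * (heat (S (\<tau> + 1)) (real n - v / 2 - y) - heat (S \<tau>) (real n + v / 2 - y)) \<le> \<beta> * v * D"
      using v by (intro sgm jump) auto
    ultimately show "G (\<tau> + 1) (real n - v / 2) \<le> G \<tau> (real n + v / 2)"
      using m b \<kappa>0 by linarith
  qed
  \<comment> \<open>\<open>A\<close> is the price per unit of displacement \<open>|x - a|\<close>,
    which bounds the deviation of the clock reading \<open>te x\<close> from \<open>te a\<close>;
    \<open>B\<close> is the part of the error that does not depend on x.\<close>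
  define A where "A = v / s0 + \<kappa> + \<kappa>' + \<beta> * v"
  define B where "B = v / (2 * sqrt s0) + (\<kappa> + \<beta> * v) * (real_of_int (t a) + T a)"
  have "E (\<lambda>x. sg * heat s0 (real x - y)) a \<le> E (\<lambda>x. Z x + (A * \<bar>real x - real a\<bar> + B)) a"
  proof (rule walk_exp_mono[OF p_le word a])
    fix x assume x: "x \<in> {1..n}"
    define z where "z = \<bar>real x - real a\<bar>"
    define N where "N = real x + v / 2 * real_of_int (de x)"
    have N: "\<bar>real x - y - (N - y)\<bar> = v / 2" using dir_cases(2)[OF x] v by (auto simp: N_def)
    have tl: "\<bar>real_of_int (te x) - real_of_int (te a)\<bar> \<le> z"
      using te_lipschitz[OF x a] by (simp add: z_def)
    have "\<bar>heat s0 (real x - y) - heat s0 (N - y)\<bar> \<le> v / 2 / sqrt s0"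
      using heat_lipschitz[of s0 "real x - y" "N - y"] s0 unfolding N by simp
    moreover have "\<bar>heat s0 (N - y) - heat (S (te x)) (N - y)\<bar> \<le> v * z / s0"
    proof -
      have "\<bar>heat s0 (N - y) - heat (S (te x)) (N - y)\<bar> \<le> \<bar>s0 - S (te x)\<bar> / s0"
        using S s0 by (intro heat_variance_lipschitz) auto
      also have "\<bar>s0 - S (te x)\<bar> \<le> v * z"
        using v tl by (auto simp: S_def max_def z_def abs_mult intro!: mult_left_mono)
      finally show ?thesis using s0 by (simp add: divide_right_mono)
    qed
    ultimately have h: "sg * (heat s0 (real x - y) - heat (S (te x)) (N - y)) \<le> v / 2 / sqrt s0 + v * z / s0"
      by (intro sgm) linarith
    have t1: "(\<kappa> + \<beta> * v) * real_of_int (te x) \<le> (\<kappa> + \<beta> * v) * (real_of_int (t a) + T a + z)"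
      using tl te_self[OF a] \<kappa>0 v by (intro mult_left_mono) auto
    have t2: "\<kappa>' * max 0 (real_of_int (te x) - real_of_int (te a)) \<le> \<kappa>' * z"
      using tl \<kappa>0 by (intro mult_left_mono) (auto simp: max_def z_def)
    have t3: "0 \<le> \<beta> * (N - real a)\<^sup>2" using \<kappa>0 by simp
    have "Z x = sg * heat (S (te x)) (N - y) - \<kappa>' * max 0 (real_of_int (te x) - real_of_int (te a))
        + \<beta> * (N - real a)\<^sup>2 - (\<kappa> + \<beta> * v) * real_of_int (te x)"
      unfolding Z_def G_def N_def by (simp add: algebra_simps)
    then have "sg * heat s0 (real x - y) \<le> Z x + (v / 2 / sqrt s0 + v * z / s0)
        + (\<kappa> + \<beta> * v) * (real_of_int (t a) + T a + z) + \<kappa>' * z"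
      using h t1 t2 t3 by (simp add: right_diff_distrib)
    also have "\<dots> = Z x + (A * z + B)"
      by (simp add: A_def B_def algebra_simps add_divide_distrib)
    finally show "sg * heat s0 (real x - y) \<le> Z x + (A * \<bar>real x - real a\<bar> + B)"
      by (simp add: z_def)
  qed
  also have "\<dots> = E Z a + A * E (\<lambda>x. \<bar>real x - real a\<bar>) a + B"
    by (simp only: walk_exp_add walk_exp_cmult walk_exp_const)
  also have "\<dots> \<le> G (t a) (real a + v / 2 * real_of_int (d a)) + A * (moment_const * sqrt (T a)) + B"
    using first_moment[OF a T] \<kappa>0 v s0
    by (intro add_mono super mult_left_mono) (auto simp: A_def moment_const_def)
  finally have main: "sg * E (\<lambda>x. heat s0 (real x - y)) a
    \<le> G (t a) (real a + v / 2 * real_of_int (d a)) + A * (moment_const * sqrt (T a)) + B"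
    by (simp add: walk_exp_cmult)
  define N where "N = real a + v / 2 * real_of_int (d a)"
  have N: "\<bar>N - y - (real a - y)\<bar> = v / 2" "(N - real a)\<^sup>2 = v\<^sup>2 / 4"
    using dir_cases(1)[OF a] v by (auto simp: N_def power2_eq_square)
  have "te a \<ge> t a" using te_self[OF a] by simp
  then have St: "S (t a) = s0 + v * T a" using te_self[OF a] by (simp add: S_def max_def)
  have "\<bar>heat (S (t a)) (N - y) - heat (S (t a)) (real a - y)\<bar> \<le> v / 2 / sqrt (S (t a))"
    using heat_lipschitz[of "S (t a)" "N - y" "real a - y"] S[of "t a"] s0 unfolding N by simp
  also have "\<dots> \<le> v / 2 / sqrt s0" using S[of "t a"] s0 v by (intro divide_left_mono) auto
  finally have "sg * (heat (S (t a)) (N - y) - heat (S (t a)) (real a - y)) \<le> v / 2 / sqrt s0"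
    by (rule sgm)
  moreover have "G (t a) N = sg * heat (S (t a)) (N - y) - (\<kappa> + \<beta> * v) * real_of_int (t a) + \<beta> * v\<^sup>2 / 4"
    using \<open>te a \<ge> t a\<close> N(2) by (simp add: G_def max_def algebra_simps)
  ultimately have "sg * (E (\<lambda>x. heat s0 (real x - y)) a - heat (s0 + v * T a) (real a - y))
     \<le> v / sqrt s0 + A * (moment_const * sqrt (T a)) + (\<kappa> + \<beta> * v) * T a + \<beta> * v\<^sup>2 / 4"
    using main unfolding St N_def[symmetric] B_def by (simp add: algebra_simps)
  also have "\<dots> \<le> heat_const * (1 / sqrt s0) + ((v + 2 * step_const) * moment_const * (sqrt (T a) / s0)
      + step_const * (T a / (s0 * sqrt s0)) + (2 * v * moment_const + 2 * v + v\<^sup>2) * (T a / (D * sqrt s0)))"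
  proof -
    have "A * (moment_const * sqrt (T a)) \<le> (v / s0 + 2 * \<kappa>') * (moment_const * sqrt (T a)) + \<beta> * v * moment_const * T a"
    proof -
      have "A * (moment_const * sqrt (T a)) = (v / s0 + \<kappa> + \<kappa>') * (moment_const * sqrt (T a))
          + \<beta> * v * moment_const * sqrt (T a)"
        by (simp add: A_def algebra_simps)
      also have "\<dots> \<le> (v / s0 + 2 * \<kappa>') * (moment_const * sqrt (T a)) + \<beta> * v * moment_const * T a"
      proof (rule add_mono)
        show "(v / s0 + \<kappa> + \<kappa>') * (moment_const * sqrt (T a)) \<le> (v / s0 + 2 * \<kappa>') * (moment_const * sqrt (T a))"
          using \<kappa>0(3) const_pos by (intro mult_right_mono) auto
        have "sqrt (T a) \<le> T a"
          using T by (intro real_le_lsqrt) (auto simp: power2_eq_square)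
        then show "\<beta> * v * moment_const * sqrt (T a) \<le> \<beta> * v * moment_const * T a"
          using \<kappa>0(4) const_pos v by (intro mult_left_mono) auto
      qed
      finally show ?thesis .
    qed
    moreover have "(v / s0 + 2 * \<kappa>') * (moment_const * sqrt (T a))
      = (v + 2 * step_const) * moment_const * (sqrt (T a) / s0)"
      by (simp add: \<kappa>'_def algebra_simps add_divide_distrib)
    moreover have "\<kappa> * T a = step_const * (T a / (s0 * sqrt s0))" by (simp add: \<kappa>_def)
    moreover have "\<beta> * T a * (v * moment_const + v) = (2 * v * moment_const + 2 * v) * (T a / (D * sqrt s0))"
      by (simp add: \<beta>_def field_simps)
    moreover have "\<beta> * v\<^sup>2 / 4 \<le> v\<^sup>2 * (T a / (D * sqrt s0))"
    proof -
      have "\<beta> * v\<^sup>2 / 4 = v\<^sup>2 * ((1 / 2) / (D * sqrt s0))" by (simp add: \<beta>_def)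
      also have "\<dots> \<le> v\<^sup>2 * (T a / (D * sqrt s0))"
        using T D s0 by (intro mult_left_mono divide_right_mono) auto
      finally show ?thesis .
    qed
    moreover have "v / sqrt s0 \<le> heat_const * (1 / sqrt s0)"
    proof -
      have "v \<le> heat_const"
        using const_pos v by (auto simp: heat_const_def intro!: add_nonneg_nonneg mult_nonneg_nonneg)
      then show ?thesis using s0 by (simp add: divide_right_mono)
    qed
    ultimately show ?thesis by (simp add: algebra_simps)
  qed
  also have "\<dots> \<le> heat_const * (1 / sqrt s0) + (heat_const * (sqrt (T a) / s0)
      + heat_const * (T a / (s0 * sqrt s0)) + heat_const * (T a / (D * sqrt s0)))"
  proof -
    have "0 \<le> (v + 2 * step_const) * moment_const" "0 \<le> step_const" "0 \<le> 2 * v * moment_const + 2 * v + v\<^sup>2"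
      using const_pos v by auto
    then have "(v + 2 * step_const) * moment_const \<le> heat_const" "step_const \<le> heat_const"
      "2 * v * moment_const + 2 * v + v\<^sup>2 \<le> heat_const"
      using v unfolding heat_const_def by linarith+
    then show ?thesis
      using s0 D by (intro add_mono order_refl mult_right_mono) auto
  qed
  finally show ?thesis by (simp add: distrib_left)
qed

lemma heat_expectation:
  assumes "a \<in> {1..n}" "1 \<le> T a" "1 \<le> s0" "0 < D" "D \<le> real a" "D \<le> real n - real a"
  shows "\<bar>E (\<lambda>x. heat s0 (real x - y)) a - heat (s0 + v * T a) (real a - y)\<bar>
    \<le> heat_const * (1 / sqrt s0 + sqrt (T a) / s0 + T a / (s0 * sqrt s0) + T a / (D * sqrt s0))"
  using heat_expectation_one_sided[OF assms, of 1 y] heat_expectation_one_sided[OF assms, of "-1" y]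
  by (simp add: abs_le_iff)

end

section \<open>Pairs of walks\<close>

lemma harm_le_ln: "1 \<le> n \<Longrightarrow> (\<Sum>k=1..n. 1 / real k) \<le> 1 + ln (real n)"
proof (induction n rule: dec_induct)
  case (step n)
  have "ln (real n / real (Suc n)) \<le> real n / real (Suc n) - 1"
    using step by (intro ln_le_minus_one) auto
  then have "1 / real (Suc n) \<le> ln (real (Suc n)) - ln (real n)"
    using step by (simp add: ln_div field_simps)
  with step show ?case by simp
qed simp

lemma sum_inverse_squares_tail:
  assumes "0 < m"
  shows "(\<Sum>k\<in>{m<..M}. 1 / (real k)\<^sup>2) \<le> 1 / real m"
proof (cases "m \<le> M")
  case True
  then have "(\<Sum>k\<in>{m<..M}. 1 / (real k)\<^sup>2) \<le> 1 / real m - 1 / real M"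
  proof (induction M rule: dec_induct)
    case (step M)
    have "1 / (real (Suc M))\<^sup>2 \<le> 1 / real M - 1 / real (Suc M)"
    proof -
      have M: "0 < real M" using step assms by simp
      have "1 / (real (Suc M))\<^sup>2 \<le> 1 / (real M * real (Suc M))"
        using M unfolding power2_eq_square by (intro frac_le mult_right_mono) auto
      also have "\<dots> = 1 / real M - 1 / real (Suc M)" using M by (simp add: field_simps)
      finally show ?thesis .
    qed
    moreover have "{m<..Suc M} = insert (Suc M) {m<..M}" using step by auto
    ultimately show ?case using step by simp
  qed simp
  then show ?thesis by (smt (verit) zero_le_divide_1_iff of_nat_0_le_iff)
qed simp

lemma heat_mono_variance:
  assumes "0 < s" "s \<le> s'" "x \<le> 0"
  shows "heat s x \<le> heat s' x"
  unfolding heat_def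
proof (rule gauss_cdf_mono)
  have "(- x) / sqrt s' \<le> (- x) / sqrt s" using assms by (intro divide_left_mono) auto
  then show "x / sqrt s \<le> x / sqrt s'" by simp
qed

text \<open>On either side of x the difference is a Gaussian tail, so each side sums to at most sqrt
  s / sqrt (2 pi); on the diagonal both functions are 1/2.\<close>

lemma sum_step_half_heat:
  assumes s: "0 < s" and x: "x \<in> {1..n}"
  shows "(\<Sum>y=1..n. \<bar>step_half x y - heat s (real x - real y)\<bar>) \<le> sqrt s"
proof -
  let ?h = "\<lambda>k. heat s (- real k)" and ?f = "\<lambda>y. \<bar>step_half x y - heat s (real x - real y)\<bar>"
  have lt: "?f y = ?h (x - y)" if "y < x" for y
  proof -
    have "real (x - y) = real x - real y" using that by simp
    then show ?thesis
      using that heat_minus[of s "real x - real y"] heat_bounds[of s "real x - real y"]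
      by (simp add: step_half_def)
  qed
  have gt: "?f y = ?h (y - x)" if "x < y" for y
    using that heat_bounds[of s "real x - real y"] by (simp add: step_half_def of_nat_diff)
  have eq: "?f x = 0" by (simp add: step_half_def heat_def)
  have "{1..n} = {1..<x} \<union> {x..n}" using x by auto
  then have "(\<Sum>y=1..n. ?f y) = (\<Sum>y\<in>{1..<x}. ?f y) + (\<Sum>y\<in>{x..n}. ?f y)"
    by (simp only:) (rule sum.union_disjoint, auto)
  also have "{x..n} = insert x {x<..n}" using x by auto
  then have "(\<Sum>y\<in>{x..n}. ?f y) = (\<Sum>y\<in>{x<..n}. ?f y)"
    using eq by simp
  also have "(\<Sum>y\<in>{1..<x}. ?f y) = (\<Sum>y\<in>{1..<x}. ?h (x - y))"
    using lt by (intro sum.cong) auto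
  also have "\<dots> = (\<Sum>k\<in>{1..<x}. ?h k)"
    by (intro sum.reindex_bij_witness[of _ "\<lambda>k. x - k" "\<lambda>k. x - k"]) auto
  also have "\<dots> \<le> (\<Sum>k=1..n. ?h k)"
    using x heat_bounds by (intro sum_mono2) auto
  also have "(\<Sum>y\<in>{x<..n}. ?f y) = (\<Sum>y\<in>{x<..n}. ?h (y - x))"
    using gt by (intro sum.cong) auto
  also have "\<dots> = (\<Sum>k\<in>{1..n - x}. ?h k)"
    by (intro sum.reindex_bij_witness[of _ "\<lambda>k. k + x" "\<lambda>k. k - x"]) auto
  also have "\<dots> \<le> (\<Sum>k=1..n. ?h k)"
    using x heat_bounds by (intro sum_mono2) auto
  also have "(\<Sum>k=1..n. ?h k) + (\<Sum>k=1..n. ?h k) \<le> 2 * (sqrt s / sqrt (2 * pi))"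
    using sum_heat_upper[OF s, of n] by simp
  also have "\<dots> \<le> sqrt s"
  proof -
    have "sqrt (2\<^sup>2) \<le> sqrt (2 * pi)" by (intro real_sqrt_le_mono) (use pi_ge_two in auto)
    then show ?thesis using s by (simp add: field_simps)
  qed
  finally show ?thesis by simp
qed

context alternating_walk
begin

lemma right_inv_eq_sum: "right_inv p n w a = (\<Sum>k=1..n - a. pair_exp p w step_half a (a + k))"
  unfolding right_inv_def
  by (intro sum.reindex_bij_witness[of _ "\<lambda>k. a + k" "\<lambda>b. b - a"]) auto

lemma pair_exp_step_half_bounds:
  assumes "a \<in> {1..n}" "b \<in> {1..n}"
  shows "0 \<le> pair_exp p w step_half a b" "pair_exp p w step_half a b \<le> 1"
proof -
  have i: "0 \<le> E (step_half x) b" "E (step_half x) b \<le> 1" for x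
    using walk_exp_mono[OF p_le word assms(2), of "\<lambda>_. 0" "step_half x"]
      walk_exp_mono[OF p_le word assms(2), of "step_half x" "\<lambda>_. 1"]
    by (simp_all add: step_half_def)
  show "0 \<le> pair_exp p w step_half a b" "pair_exp p w step_half a b \<le> 1"
    using walk_exp_mono[OF p_le word assms(1), of "\<lambda>_. 0" "\<lambda>x. E (step_half x) b"]
      walk_exp_mono[OF p_le word assms(1), of "\<lambda>x. E (step_half x) b" "\<lambda>_. 1"] i
    by (simp_all add: pair_exp_eq_walk_exp)
qed

text \<open>Walks that start at distance k and end in reversed order, or tied, have displacements
  adding up to at least k, so Chebyshev's inequality applies. The term 1/k stems from
  \<open>T (a + k) <= T a + 2 * k\<close>; summed over k it is the source of the logarithm.\<close>

lemma pair_exp_tail: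
  assumes a: "a \<in> {1..n}" and k: "1 \<le> k" "k \<le> n - a"
  shows "pair_exp p w step_half a (a + k)
    \<le> (16 * v * T a + 24 * v\<^sup>2) * (1 / (real k)\<^sup>2) + 16 * v * (1 / real k)"
proof -
  let ?b = "a + k"
  have b: "?b \<in> {1..n}" using a k by auto
  have k0: "0 < real k" using k by simp
  have "pair_exp p w step_half a ?b
      \<le> E (\<lambda>x. E (\<lambda>y. 2 / (real k)\<^sup>2 * (real x - real a)\<^sup>2 + 2 / (real k)\<^sup>2 * (real y - real ?b)\<^sup>2) ?b) a"
    unfolding pair_exp_eq_walk_exp
  proof (intro walk_exp_mono[OF p_le word a] walk_exp_mono[OF p_le word b])
    fix x y
    show "step_half x y \<le> 2 / (real k)\<^sup>2 * (real x - real a)\<^sup>2 + 2 / (real k)\<^sup>2 * (real y - real ?b)\<^sup>2"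
    proof (cases "y \<le> x")
      case True
      define u z where "u = real x - real a" and "z = real ?b - real y"
      have "real k \<le> u + z" using True by (simp add: u_def z_def)
      then have "(real k)\<^sup>2 \<le> (u + z)\<^sup>2" using k0 by (intro power_mono) auto
      also have "\<dots> \<le> 2 * u\<^sup>2 + 2 * z\<^sup>2"
        using zero_le_power2[of "u - z"] by (simp add: power2_eq_square algebra_simps)
      finally have "1 \<le> (2 * u\<^sup>2 + 2 * z\<^sup>2) / (real k)\<^sup>2" using k0 by simp
      moreover have "(real y - real ?b)\<^sup>2 = z\<^sup>2" by (simp add: z_def power2_commute)
      moreover have "step_half x y \<le> 1" by (simp add: step_half_def)
      ultimately show ?thesis by (simp add: u_def add_divide_distrib)
    qed (simp add: step_half_def)
  qed
  also have "\<dots> = 2 / (real k)\<^sup>2 * (E (\<lambda>x. (real x - real a)\<^sup>2) a + E (\<lambda>y. (real y - real ?b)\<^sup>2) ?b)"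
    by (simp only: walk_exp_add walk_exp_cmult walk_exp_const distrib_left)
  also have "\<dots> \<le> 2 / (real k)\<^sup>2 * ((4 * v * T a + 6 * v\<^sup>2) + (4 * v * (T a + 2 * real k) + 6 * v\<^sup>2))"
  proof (intro mult_left_mono add_mono second_moment[OF a])
    have "T ?b \<le> T a + 2 * real k" using T_lipschitz[OF b a] by simp
    then have "4 * v * T ?b \<le> 4 * v * (T a + 2 * real k)" using v by (intro mult_left_mono) auto
    with second_moment[OF b]
    show "E (\<lambda>y. (real y - real ?b)\<^sup>2) ?b \<le> 4 * v * (T a + 2 * real k) + 6 * v\<^sup>2" by linarith
  qed simp
  also have "\<dots> = (16 * v * T a + 24 * v\<^sup>2) * (1 / (real k)\<^sup>2) + 16 * v * (1 / real k)"
    using k0 by (simp add: field_simps power2_eq_square)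
  finally show ?thesis .
qed

lemma right_inv_tail:
  assumes a: "a \<in> {1..n}" and m: "0 < m"
  shows "(\<Sum>k\<in>{m<..n - a}. pair_exp p w step_half a (a + k))
    \<le> (16 * v * T a + 24 * v\<^sup>2) / real m + 16 * v * (1 + ln (real n))"
proof -
  have "(\<Sum>k\<in>{m<..n - a}. pair_exp p w step_half a (a + k))
    \<le> (\<Sum>k\<in>{m<..n - a}. (16 * v * T a + 24 * v\<^sup>2) * (1 / (real k)\<^sup>2) + 16 * v * (1 / real k))"
    using m by (intro sum_mono pair_exp_tail a) auto
  also have "\<dots> = (16 * v * T a + 24 * v\<^sup>2) * (\<Sum>k\<in>{m<..n - a}. 1 / (real k)\<^sup>2)
      + 16 * v * (\<Sum>k\<in>{m<..n - a}. 1 / real k)"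
    by (simp only: sum.distrib sum_distrib_left)
  also have "\<dots> \<le> (16 * v * T a + 24 * v\<^sup>2) * (1 / real m) + 16 * v * (1 + ln (real n))"
  proof (intro add_mono mult_left_mono sum_inverse_squares_tail m)
    have "(\<Sum>k\<in>{m<..n - a}. 1 / real k) \<le> (\<Sum>k=1..n. 1 / real k)"
      by (intro sum_mono2) auto
    also have "\<dots> \<le> 1 + ln (real n)" using n by (intro harm_le_ln) auto
    finally show "(\<Sum>k\<in>{m<..n - a}. 1 / real k) \<le> 1 + ln (real n)" .
  qed (use v in auto)
  finally show ?thesis by simp
qed

lemma right_inv_nonneg: "a \<in> {1..n} \<Longrightarrow> 0 \<le> right_inv p n w a"
  unfolding right_inv_eq_sum by (intro sum_nonneg pair_exp_step_half_bounds) auto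

lemma right_inv_split:
  "m \<le> n - a \<Longrightarrow> right_inv p n w a = (\<Sum>k=1..m. pair_exp p w step_half a (a + k))
     + (\<Sum>k\<in>{m<..n - a}. pair_exp p w step_half a (a + k))"
  unfolding right_inv_eq_sum
  by (subst sum.union_disjoint[symmetric]) (auto intro!: sum.cong)

lemma ln_n_nonneg: "0 \<le> ln (real n)"
  using n by simp

definition crude_const :: real where "crude_const = 2 + 16 * v + 24 * v\<^sup>2"

text \<open>The cut is at m of order \<open>sqrt (T a)\<close>: every nearer pair counts at most 1,
  and the Chebyshev tail contributes about \<open>T a / m\<close>.\<close>

lemma right_inv_crude:
  assumes a: "a \<in> {1..n}"
  shows "right_inv p n w a \<le> crude_const * (sqrt (T a) + 1 + ln (real n))"
proof -
  define m where "m = nat \<lceil>sqrt (T a)\<rceil> + 1"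
  have m: "0 < m" "sqrt (T a) \<le> real m" "real m \<le> sqrt (T a) + 2"
    unfolding m_def by (simp, linarith, simp) linarith
  have "right_inv p n w a \<le> real m + ((16 * v * T a + 24 * v\<^sup>2) / real m + 16 * v * (1 + ln (real n)))"
  proof (cases "m \<le> n - a")
    case True
    have "(\<Sum>k=1..m. pair_exp p w step_half a (a + k)) \<le> (\<Sum>k=1..m. 1)"
      using True a by (intro sum_mono pair_exp_step_half_bounds) auto
    then show ?thesis
      unfolding right_inv_split[OF True] using right_inv_tail[OF a m(1)] by simp
  next
    case False
    have "right_inv p n w a \<le> (\<Sum>k=1..n - a. 1)"
      unfolding right_inv_eq_sum using a by (intro sum_mono pair_exp_step_half_bounds) auto
    also have "\<dots> \<le> real m" using False by simp
    finally show ?thesis using v ln_n_nonneg m by (auto intro: add_increasing2)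
  qed
  also have "(16 * v * T a + 24 * v\<^sup>2) / real m \<le> 16 * v * sqrt (T a) + 24 * v\<^sup>2"
  proof -
    have "T a = sqrt (T a) * sqrt (T a)" by simp
    also have "\<dots> \<le> sqrt (T a) * real m" using m by (intro mult_left_mono) auto
    finally have "16 * v * T a \<le> 16 * v * (sqrt (T a) * real m)" using v by (intro mult_left_mono) auto
    moreover have "24 * v\<^sup>2 * 1 \<le> 24 * v\<^sup>2 * real m" using m by (intro mult_left_mono) auto
    ultimately show ?thesis using m by (simp add: field_simps)
  qed
  also have "real m + (16 * v * sqrt (T a) + 24 * v\<^sup>2 + 16 * v * (1 + ln (real n)))
      \<le> crude_const * (sqrt (T a) + 1 + ln (real n))"
  proof -
    have "0 \<le> 24 * v\<^sup>2 * sqrt (T a)" "0 \<le> (2 + 24 * v\<^sup>2) * ln (real n)" "0 \<le> sqrt (T a)"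
      using ln_n_nonneg by auto
    moreover have "crude_const * (sqrt (T a) + 1 + ln (real n)) = 2 + 2 * sqrt (T a)
        + 16 * v * sqrt (T a) + 24 * v\<^sup>2 + 16 * v * (1 + ln (real n))
        + 24 * v\<^sup>2 * sqrt (T a) + (2 + 24 * v\<^sup>2) * ln (real n)"
      by (simp add: crude_const_def algebra_simps)
    ultimately show ?thesis using m(3) by linarith
  qed
  finally show ?thesis by simp
qed

text \<open>The errors are summed over all partners before they are estimated. For a fixed end point
  x of the first walk, invariance of the uniform distribution reduces the sum over the starts of the
  second walk to \<open>sum_step_half_heat\<close>, so no factor m arises.\<close>

lemma smoothing_error:
  assumes a: "a \<in> {1..n}" and m: "m \<le> n - a" and s: "0 < s"
  shows "\<bar>(\<Sum>k=1..m. pair_exp p w step_half a (a + k))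
    - (\<Sum>k=1..m. pair_exp p w (\<lambda>x y. heat s (real x - real y)) a (a + k))\<bar> \<le> sqrt s"
proof -
  let ?f = "\<lambda>x y. \<bar>step_half x y - heat s (real x - real y)\<bar>"
  have "\<bar>(\<Sum>k=1..m. pair_exp p w step_half a (a + k))
    - (\<Sum>k=1..m. pair_exp p w (\<lambda>x y. heat s (real x - real y)) a (a + k))\<bar>
    \<le> (\<Sum>k=1..m. E (\<lambda>x. E (?f x) (a + k)) a)"
    unfolding sum_subtractf[symmetric]
  proof (rule order_trans[OF sum_abs], intro sum_mono)
    fix k assume "k \<in> {1..m}"
    then have b: "a + k \<in> {1..n}" using a m by auto
    have "pair_exp p w step_half a (a + k) - pair_exp p w (\<lambda>x y. heat s (real x - real y)) a (a + k)
      = E (\<lambda>x. E (\<lambda>y. step_half x y - heat s (real x - real y)) (a + k)) a"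
      by (simp only: pair_exp_eq_walk_exp walk_exp_diff)
    also have "\<bar>\<dots>\<bar> \<le> E (\<lambda>x. \<bar>E (\<lambda>y. step_half x y - heat s (real x - real y)) (a + k)\<bar>) a"
      by (rule walk_exp_abs_le[OF p_le word a])
    also have "\<dots> \<le> E (\<lambda>x. E (?f x) (a + k)) a"
      by (intro walk_exp_mono[OF p_le word a] walk_exp_abs_le[OF p_le word b])
    finally show "\<bar>pair_exp p w step_half a (a + k)
        - pair_exp p w (\<lambda>x y. heat s (real x - real y)) a (a + k)\<bar> \<le> E (\<lambda>x. E (?f x) (a + k)) a" .
  qed
  also have "\<dots> = E (\<lambda>x. \<Sum>k=1..m. E (?f x) (a + k)) a"
    by (simp only: walk_exp_sum)
  also have "\<dots> \<le> E (\<lambda>_. sqrt s) a"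
  proof (rule walk_exp_mono[OF p_le word a])
    fix x assume x: "x \<in> {1..n}"
    have "(\<Sum>k=1..m. E (?f x) (a + k)) = (\<Sum>b\<in>{a<..a + m}. E (?f x) b)"
      by (intro sum.reindex_bij_witness[of _ "\<lambda>b. b - a" "\<lambda>k. a + k"]) auto
    also have "\<dots> \<le> (\<Sum>b=1..n. E (?f x) b)"
    proof (intro sum_mono2)
      show "0 \<le> E (?f x) b" if "b \<in> {1..n} - {a<..a + m}" for b
        using walk_exp_mono[OF p_le word, of b "\<lambda>_. 0" "?f x"] that by simp
    qed (use a m in auto)
    also have "\<dots> = (\<Sum>y=1..n. ?f x y)" by (rule sum_walk_exp[OF word])
    also have "\<dots> \<le> sqrt s" by (rule sum_step_half_heat[OF s x])
    finally show "(\<Sum>k=1..m. E (?f x) (a + k)) \<le> sqrt s" .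
  qed
  finally show ?thesis by simp
qed

definition heat_error :: "real \<Rightarrow> real \<Rightarrow> real \<Rightarrow> real" where
  "heat_error s c D = heat_const * (1 / sqrt s + sqrt c / s + c / (s * sqrt s) + c / (D * sqrt s))"

lemma heat_error_mono:
  assumes "1 \<le> s" "s \<le> s'" "0 \<le> c" "c \<le> c'" "0 < D"
  shows "heat_error s' c D \<le> heat_error s c' D"
  unfolding heat_error_def
  using assms const_pos
  by (intro mult_left_mono add_mono frac_le mult_mono) auto

text \<open>The walks are averaged one after the other. The second enters with a minus sign, hence
  the reflection of \<open>heat\<close>; it raises the variance to \<open>s + v * T b\<close>, and a
  larger initial variance only improves the error for the first walk.\<close>

lemma pair_heat_expectation:
  assumes a: "a \<in> {1..n}" "1 \<le> T a" "D \<le> real a" "D \<le> real n - real a"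
    and b: "b \<in> {1..n}" "1 \<le> T b" "D \<le> real b" "D \<le> real n - real b"
    and s: "1 \<le> s" and D: "0 < D"
  shows "\<bar>pair_exp p w (\<lambda>x y. heat s (real x - real y)) a b - heat (s + v * T a + v * T b) (real a - real b)\<bar>
    \<le> heat_error s (T a) D + heat_error s (T b) D"
proof -
  let ?s = "s + v * T b"
  have s': "1 \<le> ?s" using s v by (simp add: add_increasing2)
  have inner: "\<bar>E (\<lambda>y. heat s (real x - real y)) b - heat ?s (real x - real b)\<bar> \<le> heat_error s (T b) D" for x
  proof -
    have "(\<lambda>y. heat s (real x - real y)) = (\<lambda>y. 1 - heat s (real y - real x))"
      using heat_minus[of s "real _ - real x"] by (auto simp: fun_eq_iff)
    moreover have "heat ?s (real x - real b) = 1 - heat ?s (real b - real x)"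
      using heat_minus[of ?s "real b - real x"] by simp
    ultimately show ?thesis
      using heat_expectation[OF b(1,2) s D b(3,4), of "real x"]
      by (simp add: walk_exp_diff heat_error_def abs_minus_commute)
  qed
  have "\<bar>pair_exp p w (\<lambda>x y. heat s (real x - real y)) a b - E (\<lambda>x. heat ?s (real x - real b)) a\<bar>
     = \<bar>E (\<lambda>x. E (\<lambda>y. heat s (real x - real y)) b - heat ?s (real x - real b)) a\<bar>"
    by (simp only: pair_exp_eq_walk_exp walk_exp_diff)
  also have "\<dots> \<le> E (\<lambda>x. \<bar>E (\<lambda>y. heat s (real x - real y)) b - heat ?s (real x - real b)\<bar>) a"
    by (rule walk_exp_abs_le[OF p_le word a(1)])
  also have "\<dots> \<le> E (\<lambda>_. heat_error s (T b) D) a"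
    by (intro walk_exp_mono[OF p_le word a(1)] inner)
  finally have 1: "\<bar>pair_exp p w (\<lambda>x y. heat s (real x - real y)) a b - E (\<lambda>x. heat ?s (real x - real b)) a\<bar>
     \<le> heat_error s (T b) D" by simp
  have "\<bar>E (\<lambda>x. heat ?s (real x - real b)) a - heat (?s + v * T a) (real a - real b)\<bar> \<le> heat_error ?s (T a) D"
    using heat_expectation[OF a(1,2) s' D a(3,4), of "real b"] by (simp add: heat_error_def)
  also have "\<dots> \<le> heat_error s (T a) D"
    using s v D by (intro heat_error_mono) auto
  finally have 2: "\<bar>E (\<lambda>x. heat ?s (real x - real b)) a - heat (?s + v * T a) (real a - real b)\<bar>
    \<le> heat_error s (T a) D" .
  have 3: "?s + v * T a = s + v * T a + v * T b" by simp
  show ?thesis using 1 2 unfolding 3 by linarith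
qed

end

section \<open>Inversions to the right of a fixed entry\<close>

context alternating_walk
begin

definition window_const :: real where
  "window_const = 10 * heat_const + 2 + sqrt (2 * v) + 36 * v + 48 * v\<^sup>2"

text \<open>The scales are chosen so that the error, multiplied by the window length
  \<open>h * r\<close>, is of order \<open>r / h + h^4\<close>. The last summand of
  \<open>heat_error\<close> comes from the ends; a distance of order \<open>h^3 * r\<close> is what
  brings it down to 4/h^2.\<close>

lemma heat_error_window:
  assumes h: "2 \<le> h" and r: "0 < r" and c: "0 \<le> c" "c \<le> 2 * r\<^sup>2" and s: "1 \<le> (r / h)\<^sup>2"
  shows "heat_error ((r / h)\<^sup>2) c (h ^ 3 * r / 2) \<le> heat_const * (5 * h ^ 3 / r + 4 / h\<^sup>2)"
proof -
  have h0: "0 < h" using h by simp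
  have "heat_error ((r / h)\<^sup>2) c (h ^ 3 * r / 2) \<le> heat_error ((r / h)\<^sup>2) (2 * r\<^sup>2) (h ^ 3 * r / 2)"
    using s c h0 r by (intro heat_error_mono) auto
  also have "\<dots> = heat_const * (h / r + sqrt 2 * h\<^sup>2 / r + 2 * h ^ 3 / r + 4 / h\<^sup>2)"
  proof -
    have sq: "sqrt ((r / h)\<^sup>2) = r / h" "sqrt (2 * r\<^sup>2) = sqrt 2 * r"
      using r h0 by (simp_all add: real_sqrt_mult)
    have "sqrt (2 * r\<^sup>2) / (r / h)\<^sup>2 = sqrt 2 * h\<^sup>2 / r"
      unfolding sq using r h0 by (simp add: power2_eq_square)
    moreover have "2 * r\<^sup>2 / ((r / h)\<^sup>2 * sqrt ((r / h)\<^sup>2)) = 2 * h ^ 3 / r"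
      unfolding sq using r h0 by (simp add: field_simps eval_nat_numeral)
    moreover have "2 * r\<^sup>2 / (h ^ 3 * r / 2 * sqrt ((r / h)\<^sup>2)) = 4 / h\<^sup>2"
      unfolding sq using r h0 by (simp add: field_simps eval_nat_numeral)
    ultimately show ?thesis unfolding heat_error_def by (simp only: sq) simp
  qed
  also have "\<dots> \<le> heat_const * (5 * h ^ 3 / r + 4 / h\<^sup>2)"
  proof (intro mult_left_mono add_right_mono)
    have "sqrt 2 \<le> 2" by (rule real_le_lsqrt) auto
    have "h * 1 \<le> h * h\<^sup>2" using h by (intro mult_left_mono) (auto intro: one_le_power)
    moreover have "sqrt 2 * h\<^sup>2 \<le> 2 * h\<^sup>2" using \<open>sqrt 2 \<le> 2\<close> by (intro mult_right_mono) auto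
    moreover have "2 * h\<^sup>2 \<le> h * h\<^sup>2" using h by (intro mult_right_mono) auto
    moreover have "h * h\<^sup>2 = h ^ 3" by (simp add: eval_nat_numeral)
    moreover have "0 \<le> h ^ 3" using h0 by simp
    ultimately have "h + sqrt 2 * h\<^sup>2 + 2 * h ^ 3 \<le> 5 * h ^ 3" by linarith
    then have "(h + sqrt 2 * h\<^sup>2 + 2 * h ^ 3) / r \<le> 5 * h ^ 3 / r"
      using r by (intro divide_right_mono) auto
    then show "h / r + sqrt 2 * h\<^sup>2 / r + 2 * h ^ 3 / r \<le> 5 * h ^ 3 / r"
      by (simp add: add_divide_distrib)
  qed (use const_pos in auto)
  finally show ?thesis .
qed

text \<open>Tails increase with the variance, so all \<open>s k\<close> may be replaced by the
  extreme values \<open>lo\<close> and \<open>hi\<close>. Both have square root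
  \<open>sqrt (2 * v) * r\<close> up to a multiple of \<open>r / h + h^2\<close>, and sqrt(2v) /
  sqrt(2 pi) = sqrt(v / pi).\<close>

lemma window_main_term:
  assumes h: "2 \<le> h" and r: "4 * h \<le> r" and m: "real m \<le> h * r" "h * r / 2 \<le> real m"
    and s: "\<And>k. k \<in> {1..m} \<Longrightarrow> \<bar>s k - ((r / h)\<^sup>2 + 2 * v * r\<^sup>2)\<bar> \<le> 2 * v * (h * r)"
  shows "\<bar>(\<Sum>k=1..m. heat (s k) (- real k)) - sqrt (v / pi) * r\<bar>
    \<le> (1 + sqrt (2 * v) + 4 * v) * (r / h) + sqrt (2 * v) * h\<^sup>2 + 1 / 2"
proof -
  have h0: "0 < h" and r0: "0 < r" using h r by auto
  have hr: "h * r * 4 \<le> r\<^sup>2" "h * r < r\<^sup>2"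
  proof -
    have "4 * h * r \<le> r * r" using r r0 by (intro mult_right_mono) auto
    then show "h * r * 4 \<le> r\<^sup>2" by (simp add: power2_eq_square mult_ac)
    moreover have "0 < h * r" using h0 r0 by simp
    ultimately show "h * r < r\<^sup>2" by linarith
  qed
  have m0: "0 < m" using m(2) mult_pos_pos[OF h0 r0] by (cases m) auto
  define lo hi where "lo = 2 * v * (r\<^sup>2 - h * r)" and "hi = (r / h)\<^sup>2 + 2 * v * r\<^sup>2 + 2 * v * (h * r)"
  have lo: "0 < lo" using v hr by (simp add: lo_def)
  have lohi: "lo \<le> s k" "s k \<le> hi" if "k \<in> {1..m}" for k
  proof -
    have "0 \<le> (r / h)\<^sup>2" by simp
    moreover have "lo = 2 * v * r\<^sup>2 - 2 * v * (h * r)" by (simp add: lo_def algebra_simps)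
    ultimately show "lo \<le> s k" "s k \<le> hi"
      using s[OF that] unfolding abs_le_iff hi_def by linarith+
  qed
  have hi: "0 < hi" using v h0 r0 by (auto simp: hi_def intro!: add_pos_pos)
  define q where "q = sqrt (2 * pi)"
  have "sqrt 1 \<le> sqrt (2 * pi)" by (intro real_sqrt_le_mono) (use pi_ge_two in auto)
  then have q: "1 \<le> q" by (simp add: q_def)
  have cst: "sqrt (2 * v) * r / q = sqrt (v / pi) * r"
    by (simp add: q_def real_sqrt_mult real_sqrt_divide)
  \<comment> \<open>Since (r/h) h^2 = h r, the mixed term of the square on the right is already 2 h
    r.\<close>
  have g: "sqrt (h * r) \<le> r / h + h\<^sup>2"
  proof (rule real_le_lsqrt)
    have "(r / h + h\<^sup>2)\<^sup>2 = (r / h)\<^sup>2 + 2 * (h * r) + (h\<^sup>2)\<^sup>2"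
      using h0 by (simp add: power2_sum) (simp add: power2_eq_square)
    moreover have "0 \<le> (r / h)\<^sup>2" "0 \<le> (h\<^sup>2)\<^sup>2" "0 \<le> h * r" using h0 r0 by auto
    ultimately show "h * r \<le> (r / h + h\<^sup>2)\<^sup>2" by linarith
  qed (use h0 r0 in auto)
  have g': "sqrt (2 * v) * sqrt (h * r) \<le> sqrt (2 * v) * (r / h + h\<^sup>2)"
    using g v by (intro mult_left_mono) auto
  have upper: "(\<Sum>k=1..m. heat (s k) (- real k)) \<le> sqrt (v / pi) * r + (r / h + sqrt (2 * v) * (r / h + h\<^sup>2))"
  proof -
    have "(\<Sum>k=1..m. heat (s k) (- real k)) \<le> (\<Sum>k=1..m. heat hi (- real k))"
    proof (intro sum_mono)
      fix k assume k: "k \<in> {1..m}"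
      show "heat (s k) (- real k) \<le> heat hi (- real k)"
        using lohi[OF k] lo by (intro heat_mono_variance) auto
    qed
    also have "\<dots> \<le> sqrt hi / q" unfolding q_def by (rule sum_heat_upper[OF hi])
    also have "\<dots> \<le> (r / h + sqrt (2 * v) * r + sqrt (2 * v) * sqrt (h * r)) / q"
    proof (intro divide_right_mono)
      have nn: "0 \<le> (r / h)\<^sup>2" "0 \<le> 2 * v * r\<^sup>2" "0 \<le> 2 * v * (h * r)" using v h0 r0 by auto
      have "sqrt hi \<le> sqrt ((r / h)\<^sup>2) + sqrt (2 * v * r\<^sup>2) + sqrt (2 * v * (h * r))"
        using sqrt_add_le_add_sqrt[of "(r / h)\<^sup>2 + 2 * v * r\<^sup>2" "2 * v * (h * r)"]
          sqrt_add_le_add_sqrt[of "(r / h)\<^sup>2" "2 * v * r\<^sup>2"] nn by (simp add: hi_def)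
      also have "\<dots> = r / h + sqrt (2 * v) * r + sqrt (2 * v) * sqrt (h * r)"
        using h0 r0 by (simp add: real_sqrt_mult)
      finally show "sqrt hi \<le> r / h + sqrt (2 * v) * r + sqrt (2 * v) * sqrt (h * r)" .
    qed (use q in auto)
    also have "\<dots> = sqrt (v / pi) * r + (r / h + sqrt (2 * v) * sqrt (h * r)) / q"
      unfolding cst[symmetric] by (simp add: add_divide_distrib)
    also have "(r / h + sqrt (2 * v) * sqrt (h * r)) / q \<le> (r / h + sqrt (2 * v) * sqrt (h * r)) / 1"
      using q h0 r0 v by (intro divide_left_mono) auto
    also have "\<dots> \<le> r / h + sqrt (2 * v) * (r / h + h\<^sup>2)" using g' by simp
    finally show ?thesis by simp
  qed
  have lower: "sqrt (v / pi) * r - (sqrt (2 * v) * (r / h + h\<^sup>2) + 4 * v * (r / h) + 1 / 2)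
    \<le> (\<Sum>k=1..m. heat (s k) (- real k))"
  proof -
    have "sqrt (v / pi) * r - sqrt (2 * v) * sqrt (h * r) \<le> sqrt lo / q"
    proof -
      have "sqrt (h * r) \<le> r" using hr r0 by (intro real_le_lsqrt) auto
      then have "h * r \<le> r * sqrt (h * r)"
        using h0 r0 mult_right_mono[of "sqrt (h * r)" r "sqrt (h * r)"] by simp
      then have "(r - sqrt (h * r))\<^sup>2 \<le> r\<^sup>2 - h * r"
        using h0 r0 by (simp add: power2_diff)
      then have "r - sqrt (h * r) \<le> sqrt (r\<^sup>2 - h * r)"
        by (rule real_le_rsqrt)
      then have "sqrt (2 * v) * (r - sqrt (h * r)) \<le> sqrt (2 * v) * sqrt (r\<^sup>2 - h * r)"
        using v by (intro mult_left_mono) auto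
      also have "\<dots> = sqrt lo" by (simp only: lo_def real_sqrt_mult)
      finally have "sqrt (2 * v) * (r - sqrt (h * r)) / q \<le> sqrt lo / q"
        using q by (intro divide_right_mono) auto
      moreover have "sqrt (2 * v) * (r - sqrt (h * r)) / q
          = sqrt (v / pi) * r - sqrt (2 * v) * sqrt (h * r) / q"
        unfolding cst[symmetric] by (simp add: right_diff_distrib diff_divide_distrib)
      moreover have "sqrt (2 * v) * sqrt (h * r) / q \<le> sqrt (2 * v) * sqrt (h * r) / 1"
        using q h0 r0 v by (intro divide_left_mono) auto
      ultimately show ?thesis by simp
    qed
    moreover have "lo / real m \<le> 4 * v * (r / h)"
    proof -
      have "lo / real m \<le> 2 * v * r\<^sup>2 / (h * r / 2)"
        using m h0 r0 v by (intro frac_le) (auto simp: lo_def)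
      also have "\<dots> = 4 * v * (r / h)" using h0 r0 by (simp add: power2_eq_square)
      finally show ?thesis .
    qed
    moreover have "sqrt lo / q - lo / real m - 1 / 2 \<le> (\<Sum>k=1..m. heat lo (- real k))"
      unfolding q_def by (rule sum_heat_lower[OF lo m0])
    moreover have "(\<Sum>k=1..m. heat lo (- real k)) \<le> (\<Sum>k=1..m. heat (s k) (- real k))"
    proof (intro sum_mono)
      fix k assume k: "k \<in> {1..m}"
      show "heat lo (- real k) \<le> heat (s k) (- real k)"
        using lohi[OF k] lo by (intro heat_mono_variance) auto
    qed
    ultimately show ?thesis using g' by linarith
  qed
  have nn: "0 \<le> r / h" "0 \<le> v * (r / h)" using h0 r0 v by auto
  have "(1 + sqrt (2 * v) + 4 * v) * (r / h) + sqrt (2 * v) * h\<^sup>2 + 1 / 2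
    = r / h + sqrt (2 * v) * (r / h + h\<^sup>2) + 4 * v * (r / h) + 1 / 2"
    by (simp add: algebra_simps)
  with upper lower nn show ?thesis unfolding abs_le_iff by linarith
qed

text \<open>
  With \<open>r = sqrt (T a)\<close>, pairs at distance at most \<open>h * r\<close> are compared with the heat kernel after
  smoothing at scale \<open>r / h\<close>; the more distant pairs contribute \<open>O(r / h + ln n)\<close> by Chebyshev.
\<close>

lemma right_inv_asymp_large:
  assumes a: "a \<in> {1..n}" and h: "2 \<le> h" and r: "4 * h \<le> sqrt (T a)"
    and dist: "h ^ 3 * sqrt (T a) \<le> real a" "h ^ 3 * sqrt (T a) \<le> real n - real a"
  shows "\<bar>right_inv p n w a - sqrt (v / pi) * sqrt (T a)\<bar>
    \<le> window_const * (sqrt (T a) / h + h ^ 4 + 1 + ln (real n))"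
proof -
  define r where "r = sqrt (T a)"
  have rr: "r\<^sup>2 = T a" by (simp add: r_def)
  note r = r[folded r_def] and dist = dist[folded r_def]
  have h0: "0 < h" and r0: "0 < r" using h r by auto
  have h1: "1 \<le> h" using h by simp
  have r8: "8 \<le> r" using h r by linarith
  have hr: "8 * 2 \<le> r * h" using r8 h by (intro mult_mono) auto
  define m where "m = nat \<lfloor>h * r\<rfloor>"
  have m: "real m \<le> h * r" "h * r / 2 \<le> real m"
    using hr by (simp_all add: m_def mult.commute) linarith
  have m0: "0 < m" using m(2) hr by (cases m) (auto simp: mult.commute)
  have h3: "h ^ 3 = h * h\<^sup>2" by (simp add: eval_nat_numeral)
  have "2 * 2 \<le> h * h" using h by (intro mult_mono) auto
  then have hh: "4 \<le> h\<^sup>2" by (simp add: power2_eq_square)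
  have hD: "h * r \<le> h ^ 3 * r / 2" "h * r \<le> h ^ 3 * r"
  proof -
    have "h * r * 4 \<le> h * r * h\<^sup>2" using hh h0 r0 by (intro mult_left_mono) auto
    then have "4 * (h * r) \<le> h ^ 3 * r" by (simp add: h3 mult_ac)
    moreover have "0 \<le> h * r" using h0 r0 by simp
    ultimately show "h * r \<le> h ^ 3 * r / 2" "h * r \<le> h ^ 3 * r" by linarith+
  qed
  have "real m \<le> real n - real a" using m hD dist by linarith
  then have mn: "m \<le> n - a" by linarith
  define s where "s = (r / h)\<^sup>2"
  \<comment> \<open>Half of the assumed distance to the ends: a partner \<open>a + k\<close> lies up
    to \<open>h * r\<close> further right, and \<open>h * r\<close> is at most the other
    half.\<close>
  define D where "D = h ^ 3 * r / 2"
  have "1 \<le> r / h" using r h0 by (simp add: field_simps)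
  then have s: "1 \<le> s" unfolding s_def by (rule one_le_power)
  have D: "0 < D" "D \<le> real a" "D \<le> real n - real a"
  proof -
    have D': "0 \<le> D" "D * 2 = h ^ 3 * r" using h0 r0 by (simp_all add: D_def)
    then show "D \<le> real a" "D \<le> real n - real a" using dist by linarith+
    show "0 < D" using h0 r0 by (simp add: D_def)
  qed
  have "64 \<le> r\<^sup>2" using r8 power_mono[of 8 r 2] by simp
  then have Ta: "1 \<le> T a" using rr by simp
  have pair: "\<bar>pair_exp p w (\<lambda>x y. heat s (real x - real y)) a (a + k)
      - heat (s + v * T a + v * T (a + k)) (- real k)\<bar> \<le> 2 * (heat_const * (5 * h ^ 3 / r + 4 / h\<^sup>2))"
    and Tb: "\<bar>T (a + k) - T a\<bar> \<le> 2 * (h * r)"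
    if k: "k \<in> {1..m}" for k
  proof -
    have b: "a + k \<in> {1..n}" using a k mn by auto
    have kr: "real k \<le> h * r" using k m by auto
    have Tk: "\<bar>T (a + k) - T a\<bar> \<le> 2 * real k" using T_lipschitz[OF b a] by simp
    with kr show "\<bar>T (a + k) - T a\<bar> \<le> 2 * (h * r)" by linarith
    have "h * r * 4 \<le> r\<^sup>2"
      using mult_right_mono[OF r, of r] r0 by (simp add: power2_eq_square mult_ac)
    then have Tb: "1 \<le> T (a + k)" "T (a + k) \<le> 2 * r\<^sup>2"
      using Tk kr rr \<open>64 \<le> r\<^sup>2\<close> by linarith+
    have Db: "D \<le> real (a + k)" "D \<le> real n - real (a + k)"
      using D(2) dist kr hD unfolding D_def by simp_all
    have "\<bar>pair_exp p w (\<lambda>x y. heat s (real x - real y)) a (a + k)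
      - heat (s + v * T a + v * T (a + k)) (real a - real (a + k))\<bar>
      \<le> heat_error s (T a) D + heat_error s (T (a + k)) D"
      by (rule pair_heat_expectation[OF a Ta D(2,3) b Tb(1) Db s D(1)])
    also have "\<dots> \<le> heat_const * (5 * h ^ 3 / r + 4 / h\<^sup>2) + heat_const * (5 * h ^ 3 / r + 4 / h\<^sup>2)"
      unfolding s_def D_def
      by (intro add_mono heat_error_window h r0 s[unfolded s_def]) (use Tb rr Ta in auto)
    finally show "\<bar>pair_exp p w (\<lambda>x y. heat s (real x - real y)) a (a + k)
      - heat (s + v * T a + v * T (a + k)) (- real k)\<bar> \<le> 2 * (heat_const * (5 * h ^ 3 / r + 4 / h\<^sup>2))"
      by simp
  qed
  let ?P = "\<Sum>k=1..m. pair_exp p w step_half a (a + k)"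
  let ?Q = "\<Sum>k=1..m. pair_exp p w (\<lambda>x y. heat s (real x - real y)) a (a + k)"
  let ?R = "\<Sum>k=1..m. heat (s + v * T a + v * T (a + k)) (- real k)"
  let ?tail = "\<Sum>k\<in>{m<..n - a}. pair_exp p w step_half a (a + k)"
  have 1: "\<bar>?P - ?Q\<bar> \<le> r / h"
    using smoothing_error[OF a mn, of s] s h0 r0 by (simp add: s_def)
  have 2: "\<bar>?Q - ?R\<bar> \<le> heat_const * (10 * h ^ 4 + 8 * (r / h))"
  proof -
    have "\<bar>?Q - ?R\<bar> \<le> (\<Sum>k=1..m. 2 * (heat_const * (5 * h ^ 3 / r + 4 / h\<^sup>2)))"
      unfolding sum_subtractf[symmetric]
      by (rule order_trans[OF sum_abs]) (intro sum_mono pair)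
    also have "\<dots> = real m * (2 * (heat_const * (5 * h ^ 3 / r + 4 / h\<^sup>2)))" by simp
    also have "\<dots> \<le> h * r * (2 * (heat_const * (5 * h ^ 3 / r + 4 / h\<^sup>2)))"
      using m const_pos h0 r0 by (intro mult_right_mono) auto
    also have "\<dots> = heat_const * (10 * h ^ 4 + 8 * (r / h))"
      using h0 r0 by (simp add: field_simps eval_nat_numeral)
    finally show ?thesis .
  qed
  have 3: "\<bar>?R - sqrt (v / pi) * r\<bar> \<le> (1 + sqrt (2 * v) + 4 * v) * (r / h) + sqrt (2 * v) * h\<^sup>2 + 1 / 2"
  proof (rule window_main_term[OF h r m])
    fix k assume k: "k \<in> {1..m}"
    have "s + v * T a + v * T (a + k) - ((r / h)\<^sup>2 + 2 * v * r\<^sup>2) = v * (T (a + k) - T a)"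
      unfolding rr s_def by (simp add: algebra_simps)
    also have "\<bar>\<dots>\<bar> = v * \<bar>T (a + k) - T a\<bar>" using v by (simp add: abs_mult)
    also have "\<dots> \<le> v * (2 * (h * r))" using Tb[OF k] v by (intro mult_left_mono) auto
    finally show "\<bar>s + v * T a + v * T (a + k) - ((r / h)\<^sup>2 + 2 * v * r\<^sup>2)\<bar> \<le> 2 * v * (h * r)"
      by simp
  qed
  have 4: "0 \<le> ?tail" using a by (intro sum_nonneg pair_exp_step_half_bounds) auto
  have 5: "?tail \<le> 32 * v * (r / h) + 48 * v\<^sup>2 + 16 * v * (1 + ln (real n))"
  proof -
    have "(16 * v * T a + 24 * v\<^sup>2) / real m \<le> (16 * v * r\<^sup>2 + 24 * v\<^sup>2) / (h * r / 2)"
      unfolding rr[symmetric] using m m0 v h0 r0 by (intro divide_left_mono) auto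
    also have "\<dots> = 32 * v * (r / h) + 48 * v\<^sup>2 / (h * r)"
      using h0 r0 by (simp add: field_simps power2_eq_square)
    also have "48 * v\<^sup>2 / (h * r) \<le> 48 * v\<^sup>2 / 1"
      using hr by (intro divide_left_mono) (auto simp: mult.commute)
    finally show ?thesis using right_inv_tail[OF a m0] by simp
  qed
  have nn: "0 \<le> r / h" "0 \<le> v * (r / h)" "0 \<le> v * h ^ 4" "0 \<le> h ^ 4" "0 \<le> v\<^sup>2" "0 \<le> v\<^sup>2 * (r / h)" "0 \<le> v\<^sup>2 * h ^ 4"
    "0 \<le> sqrt (2 * v)" "0 \<le> sqrt (2 * v) * ln (real n)" "0 \<le> v * ln (real n)" "0 \<le> v\<^sup>2 * ln (real n)"
    "0 \<le> heat_const * (r / h)" "0 \<le> heat_const * ln (real n)" "0 \<le> heat_const" "0 \<le> ln (real n)"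
    using h0 r0 v const_pos ln_n_nonneg by auto
  have "sqrt (2 * v) * h\<^sup>2 \<le> sqrt (2 * v) * h ^ 4"
    using h1 v by (intro mult_left_mono power_increasing) auto
  moreover have "window_const * (r / h + h ^ 4 + 1 + ln (real n))
     = 10 * (heat_const * (r / h)) + 10 * (heat_const * h ^ 4) + 10 * heat_const + 10 * (heat_const * ln (real n))
      + 2 * (r / h) + 2 * h ^ 4 + 2 + 2 * ln (real n)
      + sqrt (2 * v) * (r / h) + sqrt (2 * v) * h ^ 4 + sqrt (2 * v) + sqrt (2 * v) * ln (real n)
      + 36 * (v * (r / h)) + 36 * (v * h ^ 4) + 36 * v + 36 * (v * ln (real n))
      + 48 * (v\<^sup>2 * (r / h)) + 48 * (v\<^sup>2 * h ^ 4) + 48 * v\<^sup>2 + 48 * (v\<^sup>2 * ln (real n))"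
    unfolding window_const_def by (simp only: distrib_left distrib_right mult_1_right mult.assoc)
  moreover have "heat_const * (10 * h ^ 4 + 8 * (r / h)) = 10 * (heat_const * h ^ 4) + 8 * (heat_const * (r / h))"
    by (simp add: algebra_simps)
  moreover have "(1 + sqrt (2 * v) + 4 * v) * (r / h) = r / h + sqrt (2 * v) * (r / h) + 4 * (v * (r / h))"
    by (simp only: distrib_right mult_1_left mult.assoc)
  moreover have "16 * v * (1 + ln (real n)) = 16 * v + 16 * (v * ln (real n))"
    by (simp add: algebra_simps)
  moreover have "32 * v * (r / h) = 32 * (v * (r / h))" by simp
  ultimately have bound: "r / h + heat_const * (10 * h ^ 4 + 8 * (r / h))
      + ((1 + sqrt (2 * v) + 4 * v) * (r / h) + sqrt (2 * v) * h\<^sup>2 + 1 / 2)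
      + (32 * v * (r / h) + 48 * v\<^sup>2 + 16 * v * (1 + ln (real n)))
    \<le> window_const * (r / h + h ^ 4 + 1 + ln (real n))"
    using nn v by linarith
  have "\<bar>P + t - c\<bar> \<le> e1 + e2 + e3 + e4"
    if "\<bar>P - Q\<bar> \<le> e1" "\<bar>Q - R\<bar> \<le> e2" "\<bar>R - c\<bar> \<le> e3" "0 \<le> t" "t \<le> e4" for P Q R c t e1 e2 e3 e4 :: real
    using that by linarith
  from order_trans[OF this[OF 1 2 3 4 5] bound]
  show ?thesis unfolding right_inv_split[OF mn] r_def .
qed

definition vertex_const :: real where "vertex_const = window_const + 4 * crude_const + 4 * sqrt v"

lemma crude_const_ge: "2 \<le> crude_const" and window_const_ge: "2 \<le> window_const"
  using v const_pos by (auto simp: crude_const_def window_const_def intro!: add_nonneg_nonneg)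

lemma sqrt_v_pi: "sqrt (v / pi) \<le> sqrt v"
  using v pi_ge_two by (intro real_sqrt_le_mono) (simp add: field_simps)

text \<open>If \<open>sqrt (T a) < 4 * h\<close>, both quantities are bounded by multiples of
  \<open>h^4 + 1 + ln n\<close>, so the crude bound suffices; it is the origin of the last two
  summands of \<open>vertex_const\<close>.\<close>

lemma right_inv_asymp:
  assumes a: "a \<in> {1..n}" and h: "2 \<le> h"
    and dist: "h ^ 3 * sqrt (T a) \<le> real a" "h ^ 3 * sqrt (T a) \<le> real n - real a"
  shows "\<bar>right_inv p n w a - sqrt (v / pi) * sqrt (T a)\<bar>
    \<le> vertex_const * (sqrt (T a) / h + h ^ 4 + 1 + ln (real n))"
proof (cases "4 * h \<le> sqrt (T a)")
  case True
  have "\<bar>right_inv p n w a - sqrt (v / pi) * sqrt (T a)\<bar>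
      \<le> window_const * (sqrt (T a) / h + h ^ 4 + 1 + ln (real n))"
    by (rule right_inv_asymp_large[OF a h True dist])
  also have "\<dots> \<le> vertex_const * (sqrt (T a) / h + h ^ 4 + 1 + ln (real n))"
    using h v crude_const_ge ln_n_nonneg
    by (intro mult_right_mono) (auto simp: vertex_const_def intro!: add_nonneg_nonneg)
  finally show ?thesis .
next
  case False
  have "h * 1 \<le> h * h ^ 3" using h by (intro mult_left_mono one_le_power) auto
  then have "h \<le> h ^ 4" by (simp add: eval_nat_numeral)
  with False have T: "sqrt (T a) \<le> 4 * h ^ 4" by linarith
  define L where "L = h ^ 4 + 1 + ln (real n)"
  have L: "0 \<le> L" using h ln_n_nonneg by (simp add: L_def)
  have "sqrt (T a) + 1 + ln (real n) \<le> 4 * L" "sqrt (T a) \<le> 4 * L"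
    using T ln_n_nonneg h unfolding L_def by (simp_all add: algebra_simps)
  then have "crude_const * (sqrt (T a) + 1 + ln (real n)) \<le> crude_const * (4 * L)"
    "sqrt (v / pi) * sqrt (T a) \<le> sqrt v * (4 * L)"
    using crude_const_ge sqrt_v_pi v by (auto intro!: mult_left_mono mult_mono)
  moreover have "0 \<le> sqrt (v / pi) * sqrt (T a)" using v by simp
  ultimately have "\<bar>right_inv p n w a - sqrt (v / pi) * sqrt (T a)\<bar> \<le> (4 * crude_const + 4 * sqrt v) * L"
    using right_inv_crude[OF a] right_inv_nonneg[OF a] by (simp add: distrib_right)
  also have "\<dots> \<le> vertex_const * (sqrt (T a) / h + L)"
    using L h crude_const_ge window_const_ge v
    by (intro mult_mono) (auto simp: vertex_const_def intro!: add_nonneg_nonneg)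
  finally show ?thesis by (simp add: L_def add.assoc)
qed

end

section \<open>Summation over all entries\<close>

context alternating_walk
begin

lemma T_count_close:
  assumes "a \<in> {1..n - 1}"
  shows "\<bar>T a - 2 * real (count_list w a)\<bar> \<le> 1"
proof (cases "a = 1")
  case False
  then have "\<bar>int (count_list w (a - 1)) - int (count_list w a)\<bar> \<le> 1"
    using assms by (intro count_lipschitz[OF adm leg]) auto
  moreover have "touches n w a = count_list w (a - 1) + count_list w a"
    using False assms by (auto simp: touches_def)
  ultimately show ?thesis by (auto simp: abs_le_iff)
qed (simp add: touches_def)

lemma sqrt_T_close:
  assumes "a \<in> {1..n - 1}"
  shows "\<bar>sqrt (T a) - sqrt 2 * sqrt (real (count_list w a))\<bar> \<le> 1"
proof -
  have aux: "sqrt x \<le> sqrt y + 1" if "x \<le> y + 1" "0 \<le> y" for x y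
  proof -
    have "sqrt x \<le> sqrt (y + 1)" using that by simp
    also have "\<dots> \<le> sqrt y + 1" using that sqrt_add_le_add_sqrt[of y 1] by simp
    finally show ?thesis .
  qed
  have "sqrt 2 * sqrt (real (count_list w a)) = sqrt (2 * real (count_list w a))"
    by (simp add: real_sqrt_mult)
  then show ?thesis
    using T_count_close[OF assms] aux[of "T a" "2 * real (count_list w a)"]
      aux[of "2 * real (count_list w a)" "T a"] by (simp add: abs_le_iff)
qed

lemma sqrt_T_le:
  assumes "a \<in> {1..n - 1}"
  shows "sqrt (T a) \<le> 2 * sqrt (real (count_list w a)) + 1"
proof -
  have "sqrt 2 \<le> 2" by (rule real_le_lsqrt) auto
  then have "sqrt 2 * sqrt (real (count_list w a)) \<le> 2 * sqrt (real (count_list w a))"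
    by (intro mult_right_mono) auto
  then show ?thesis using sqrt_T_close[OF assms] by linarith
qed

definition total_const :: real where
  "total_const = 2 * vertex_const + 2 * crude_const + 3 * sqrt v"

lemma vertex_const_ge: "2 \<le> vertex_const"
proof -
  have "0 \<le> sqrt v" using v by simp
  then show ?thesis using crude_const_ge window_const_ge unfolding vertex_const_def by linarith
qed

lemma total_const_pos: "0 < total_const"
  using v vertex_const_ge crude_const_ge by (auto simp: total_const_def intro!: add_pos_nonneg)

lemma right_inv_close:
  assumes a: "a \<in> {1..n - 1}" and h: "2 \<le> h"
    and dist: "h ^ 3 * sqrt (T a) \<le> real a" "h ^ 3 * sqrt (T a) \<le> real n - real a"
  shows "\<bar>right_inv p n w a - sqrt (2 / pi) * sqrt v * sqrt (real (count_list w a))\<bar>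
    \<le> total_const * (sqrt (real (count_list w a)) / h + (h ^ 4 + 1 + ln (real n)))"
proof -
  define q L where "q = sqrt (real (count_list w a))" and "L = h ^ 4 + 1 + ln (real n)"
  have a': "a \<in> {1..n}" using a by auto
  have h0: "0 < h" using h by simp
  have q: "0 \<le> q" by (simp add: q_def)
  have L: "1 \<le> L" using h ln_n_nonneg by (simp add: L_def)
  have "sqrt (v / pi) * sqrt 2 = sqrt (2 / pi) * sqrt v"
    by (simp add: real_sqrt_divide mult.commute)
  then have "sqrt (v / pi) * sqrt (T a) - sqrt (2 / pi) * sqrt v * q
      = sqrt (v / pi) * (sqrt (T a) - sqrt 2 * q)"
    by (simp add: right_diff_distrib flip: mult.assoc)
  also have "\<bar>\<dots>\<bar> \<le> sqrt v * 1"
    using sqrt_T_close[OF a] sqrt_v_pi v unfolding abs_mult q_def by (intro mult_mono) auto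
  finally have 1: "\<bar>sqrt (v / pi) * sqrt (T a) - sqrt (2 / pi) * sqrt v * q\<bar> \<le> sqrt v" by simp
  have "sqrt (T a) / h \<le> (2 * q + 1) / h"
    using sqrt_T_le[OF a] h0 unfolding q_def by (intro divide_right_mono) auto
  also have "\<dots> \<le> 2 * (q / h) + 1" using h by (simp add: add_divide_distrib)
  finally have "sqrt (T a) / h + L \<le> 2 * (q / h + L)" using L by simp
  then have "vertex_const * (sqrt (T a) / h + L) \<le> vertex_const * (2 * (q / h + L))"
    using vertex_const_ge by (intro mult_left_mono) auto
  moreover have "sqrt v * 1 \<le> sqrt v * (q / h + L)"
    using v q L h0 by (intro mult_left_mono) (auto intro: add_increasing)
  moreover have "\<bar>right_inv p n w a - sqrt (v / pi) * sqrt (T a)\<bar> \<le> vertex_const * (sqrt (T a) / h + L)"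
    using right_inv_asymp[OF a' h dist] by (simp add: L_def add.assoc)
  moreover have "(2 * vertex_const + sqrt v) * (q / h + L)
      = vertex_const * (2 * (q / h + L)) + sqrt v * (q / h + L)"
    by (simp only: distrib_right) simp
  ultimately have "\<bar>right_inv p n w a - sqrt (2 / pi) * sqrt v * q\<bar> \<le> (2 * vertex_const + sqrt v) * (q / h + L)"
    using 1 unfolding abs_le_iff by linarith
  also have "\<dots> \<le> total_const * (q / h + L)"
    using q L h0 v crude_const_ge by (intro mult_right_mono) (auto simp: total_const_def)
  finally show ?thesis by (simp add: q_def L_def)
qed

lemma right_inv_close_crude:
  assumes a: "a \<in> {1..n - 1}"
  shows "\<bar>right_inv p n w a - sqrt (2 / pi) * sqrt v * sqrt (real (count_list w a))\<bar>
    \<le> total_const * (sqrt (real (count_list w a)) + (1 + ln (real n)))"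
proof -
  define q L where "q = sqrt (real (count_list w a))" and "L = 1 + ln (real n)"
  have a': "a \<in> {1..n}" using a by auto
  have q: "0 \<le> q" by (simp add: q_def)
  have L: "1 \<le> L" using ln_n_nonneg by (simp add: L_def)
  have "sqrt (2 / pi) \<le> sqrt 1" by (intro real_sqrt_le_mono) (use pi_ge_two in auto)
  then have "sqrt (2 / pi) * (sqrt v * q) \<le> 1 * (sqrt v * q)"
    using v q by (intro mult_right_mono) auto
  moreover have "0 \<le> sqrt (2 / pi) * (sqrt v * q)" "0 \<le> sqrt v * L" using q v L by auto
  moreover have "crude_const * (sqrt (T a) + L) \<le> crude_const * (2 * (q + L))"
    using sqrt_T_le[OF a] crude_const_ge L by (intro mult_left_mono) (auto simp: q_def)
  moreover have "right_inv p n w a \<le> crude_const * (sqrt (T a) + L)"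
    using right_inv_crude[OF a'] by (simp add: L_def add.assoc)
  moreover have "(2 * crude_const + sqrt v) * (q + L) = crude_const * (2 * (q + L)) + sqrt v * q + sqrt v * L"
    by (simp add: algebra_simps)
  ultimately have "\<bar>right_inv p n w a - sqrt (2 / pi) * sqrt v * q\<bar> \<le> (2 * crude_const + sqrt v) * (q + L)"
    using right_inv_nonneg[OF a'] unfolding mult.assoc[of "sqrt (2 / pi)"] abs_le_iff by linarith
  also have "\<dots> \<le> total_const * (q + L)"
    using q L v vertex_const_ge by (intro mult_right_mono) (auto simp: total_const_def)
  finally show ?thesis by (simp add: q_def L_def)
qed

text \<open>Entries too close to an end are handled by the crude bound. With R = sqrt(2K) there are
  at most 2 h^3 R of them, and each costs at most R beyond the common terms, which gives 4 h^3
  K.\<close>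

lemma sum_right_inv_close:
  assumes h: "2 \<le> h" and K: "\<And>i. i \<in> {1..n - 1} \<Longrightarrow> real (count_list w i) \<le> K"
  shows "\<bar>(\<Sum>a=1..n. right_inv p n w a)
      - sqrt (2 / pi) * sqrt v * (\<Sum>i=1..n - 1. sqrt (real (count_list w i)))\<bar>
    \<le> total_const * ((\<Sum>i=1..n - 1. sqrt (real (count_list w i))) / h
        + real n * (h ^ 4 + 1 + ln (real n)) + 4 * h ^ 3 * K)"
proof -
  let ?q = "\<lambda>a. sqrt (real (count_list w a))"
  define L where "L = h ^ 4 + 1 + ln (real n)"
  define B where "B = {a \<in> {1..n - 1}. real a < h ^ 3 * sqrt (T a) \<or> real n - real a < h ^ 3 * sqrt (T a)}"
  have h0: "0 < h" using h by simp
  have L: "0 \<le> L" "1 + ln (real n) \<le> L" using h0 ln_n_nonneg by (simp_all add: L_def)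
  have "count_list w 1 \<le> K" using K[of 1] n by simp
  then have K0: "0 \<le> K" using of_nat_0_le_iff[of "count_list w 1"] by linarith
  have each: "\<bar>right_inv p n w a - sqrt (2 / pi) * sqrt v * ?q a\<bar>
      \<le> total_const * (?q a / h + L + (if a \<in> B then ?q a else 0))" if a: "a \<in> {1..n - 1}" for a
  proof (cases "a \<in> B")
    case True
    have "0 \<le> ?q a / h" using h0 by simp
    have "\<bar>right_inv p n w a - sqrt (2 / pi) * sqrt v * ?q a\<bar> \<le> total_const * (?q a + (1 + ln (real n)))"
      by (rule right_inv_close_crude[OF a])
    also have "\<dots> \<le> total_const * (?q a / h + L + ?q a)"
      using total_const_pos L \<open>0 \<le> ?q a / h\<close> by (intro mult_left_mono) linarith+
    finally show ?thesis using True by simp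
  next
    case False
    then show ?thesis using right_inv_close[OF a h] a by (auto simp: B_def L_def not_less)
  qed
  have "right_inv p n w n = 0" by (simp add: right_inv_def)
  moreover have "{1..n} = insert n {1..n - 1}" using n by auto
  ultimately have "(\<Sum>a=1..n. right_inv p n w a) = (\<Sum>a=1..n - 1. right_inv p n w a)"
    using n by simp
  then have "\<bar>(\<Sum>a=1..n. right_inv p n w a) - sqrt (2 / pi) * sqrt v * (\<Sum>i=1..n - 1. ?q i)\<bar>
      = \<bar>\<Sum>a=1..n - 1. right_inv p n w a - sqrt (2 / pi) * sqrt v * ?q a\<bar>"
    by (simp add: sum_subtractf sum_distrib_left)
  also have "\<dots> \<le> (\<Sum>a=1..n - 1. total_const * (?q a / h + L + (if a \<in> B then ?q a else 0)))"
    by (rule order_trans[OF sum_abs]) (intro sum_mono each)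
  also have "\<dots> = total_const * ((\<Sum>a=1..n - 1. ?q a) / h + real (n - 1) * L + (\<Sum>a\<in>B. ?q a))"
  proof -
    have "(\<Sum>a=1..n - 1. if a \<in> B then ?q a else 0) = (\<Sum>a\<in>B. ?q a)"
      by (subst sum.If_cases) (auto simp: B_def intro!: sum.cong)
    then show ?thesis
      by (simp add: sum.distrib sum_divide_distrib flip: sum_distrib_left)
  qed
  also have "\<dots> \<le> total_const * ((\<Sum>a=1..n - 1. ?q a) / h + real n * L + 4 * h ^ 3 * K)"
  proof (intro mult_left_mono add_mono order_refl mult_right_mono)
    define R where "R = sqrt (2 * K)"
    define m where "m = nat \<lfloor>h ^ 3 * R\<rfloor>"
    have R: "0 \<le> R" "R * R = 2 * K" using K0 by (auto simp: R_def)
    have m: "real m \<le> h ^ 3 * R" using R h0 by (simp add: m_def)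
    have TR: "sqrt (T a) \<le> R" if a: "a \<in> {1..n - 1}" for a
    proof -
      have "T a \<le> 2 * K"
      proof (cases "a = 1")
        case False
        then have "touches n w a = count_list w (a - 1) + count_list w a" "a - 1 \<in> {1..n - 1}"
          using a by (auto simp: touches_def)
        then show ?thesis using K[OF a] K[of "a - 1"] by simp
      qed (use K[OF a] in \<open>simp add: touches_def\<close>)
      then show ?thesis by (simp add: R_def)
    qed
    have "B \<subseteq> {1..m} \<union> (\<lambda>k. n - k) ` {1..m}"
    proof
      fix a assume "a \<in> B"
      then have a: "a \<in> {1..n - 1}"
        and c: "real a < h ^ 3 * sqrt (T a) \<or> real n - real a < h ^ 3 * sqrt (T a)"
        by (auto simp: B_def)
      have "h ^ 3 * sqrt (T a) \<le> h ^ 3 * R" using TR[OF a] h0 by (intro mult_left_mono) auto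
      with c have "real a \<le> h ^ 3 * R \<or> real (n - a) \<le> h ^ 3 * R" using a by (auto simp: of_nat_diff)
      then have "a \<le> m \<or> n - a \<le> m" unfolding m_def by (auto simp: le_nat_floor)
      then show "a \<in> {1..m} \<union> (\<lambda>k. n - k) ` {1..m}"
      proof
        assume "n - a \<le> m"
        then have "a = n - (n - a)" "n - a \<in> {1..m}" using a by auto
        then show ?thesis by blast
      qed (use a in auto)
    qed
    then have "card B \<le> card ({1..m} \<union> (\<lambda>k. n - k) ` {1..m})" by (intro card_mono) auto
    also have "\<dots> \<le> card {1..m} + card ((\<lambda>k. n - k) ` {1..m})" by (rule card_Un_le)
    also have "\<dots> \<le> m + m" using card_image_le[of "{1..m}" "\<lambda>k. n - k"] by simp
    finally have cB: "real (card B) \<le> 2 * (h ^ 3 * R)" using m by simp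
    have "(\<Sum>a\<in>B. ?q a) \<le> (\<Sum>a\<in>B. R)"
    proof (intro sum_mono)
      fix a assume "a \<in> B"
      then have "real (count_list w a) \<le> K" using K by (auto simp: B_def)
      then show "?q a \<le> R" using K0 by (simp add: R_def)
    qed
    also have "\<dots> = real (card B) * R" by simp
    also have "\<dots> \<le> 2 * (h ^ 3 * R) * R" using cB R by (intro mult_right_mono) auto
    also have "\<dots> = 4 * h ^ 3 * K" using R(2) by (simp add: mult.assoc)
    finally show "(\<Sum>a\<in>B. ?q a) \<le> 4 * h ^ 3 * K" .
  qed (use total_const_pos L in auto)
  finally show ?thesis by (simp add: L_def)
qed

end

text \<open>The order of quantifiers is the point: \<open>C\<close> depends on \<open>p\<close>
  alone and is fixed before the word, \<open>n\<close>, \<open>h\<close> and \<open>K\<close>. This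
  is possible because all constants of the locale are functions of \<open>v\<close>.\<close>

lemma expectation_inversions_close:
  assumes p: "0 < p" "p < 1"
  obtains C where "0 < C"
    "\<And>n w (h :: real) K. \<lbrakk>2 \<le> n; is_word n w; alternating n w; 2 \<le> h;
       \<And>i. i \<in> {1..n - 1} \<Longrightarrow> real (count_list w i) \<le> K\<rbrakk> \<Longrightarrow>
     \<bar>measure_pmf.expectation (random_perm p w) (\<lambda>v. real (inversions n v))
        - sqrt (2 / pi) * sqrt (p / (1 - p)) * (\<Sum>i=1..n - 1. sqrt (real (count_list w i)))\<bar>
      \<le> C * ((\<Sum>i=1..n - 1. sqrt (real (count_list w i))) / h
          + real n * (h ^ 4 + 1 + ln (real n)) + 4 * h ^ 3 * K)"
proof
  define C where "C = alternating_walk.total_const (p / (1 - p))"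
  have loc: "\<exists>d t. alternating_walk p (p / (1 - p)) n w d t"
    if "2 \<le> n" "is_word n w" "alternating n w" for n w
    using exists_admissible_legal[OF that(3,2,1)] p that(1) by (auto simp: alternating_walk_def)
  \<comment> \<open>Positivity of the constant is a fact of the locale, so one instance is required;
    the empty word over two positions provides it.\<close>
  have "is_word 2 []" "alternating 2 []" by (auto simp: is_word_def alternating_def)
  from loc[OF _ this] obtain d t where "alternating_walk p (p / (1 - p)) 2 [] d t" by auto
  then show "0 < C" unfolding C_def by (rule alternating_walk.total_const_pos)
  fix n w K and h :: real
  assume a: "2 \<le> n" "is_word n w" "alternating n w" "2 \<le> h"
    "\<And>i. i \<in> {1..n - 1} \<Longrightarrow> real (count_list w i) \<le> K"
  from loc[OF a(1-3)] obtain d t where "alternating_walk p (p / (1 - p)) n w d t" by auto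
  then interpret alternating_walk p "p / (1 - p)" n w d t .
  show "\<bar>measure_pmf.expectation (random_perm p w) (\<lambda>v. real (inversions n v))
        - sqrt (2 / pi) * sqrt (p / (1 - p)) * (\<Sum>i=1..n - 1. sqrt (real (count_list w i)))\<bar>
      \<le> C * ((\<Sum>i=1..n - 1. sqrt (real (count_list w i))) / h
          + real n * (h ^ 4 + 1 + ln (real n)) + 4 * h ^ 3 * K)"
    unfolding expectation_inversions[OF p_le] C_def using sum_right_inv_close[OF a(4,5)] .
qed

lemma alternating_count_lipschitz:
  assumes "alternating n w" "is_word n w" "i \<in> {1..n - 1}" "j \<in> {1..n - 1}"
  shows "real (count_list w i) \<le> real (count_list w j) + real n"
proof -
  have "2 \<le> n" using assms(3) by auto
  then obtain d t where dt: "admissible n d t" "legal n w d"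
    using exists_admissible_legal[OF assms(1,2)] by blast
  have aux: "\<bar>int (count_list w (x + k)) - int (count_list w x)\<bar> \<le> int k" if "1 \<le> x" "x + k < n" for x k
    using that
  proof (induction k)
    case (Suc k)
    then show ?case using count_lipschitz[OF dt, of "x + Suc k"] by auto
  qed simp
  have ij: "1 \<le> i" "i < n" "1 \<le> j" "j < n" using assms(3,4) by auto
  have "\<bar>int (count_list w i) - int (count_list w j)\<bar> \<le> int n"
  proof (cases "i \<le> j")
    case True
    then show ?thesis using aux[of i "j - i"] ij by (auto simp: of_nat_diff)
  next
    case False
    then show ?thesis using aux[of j "i - j"] ij by (auto simp: of_nat_diff)
  qed
  then show ?thesis by linarith
qed

section \<open>Asymptotics\<close>

lemma eventually_ln_le_powr:
  fixes A B c \<epsilon> :: real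
  assumes "0 < \<epsilon>" "0 < c"
  shows "eventually (\<lambda>n. A + B * ln (real n) \<le> c * real n powr \<epsilon>) sequentially"
proof -
  have "(\<lambda>n. A * (1 / real n powr \<epsilon>) + B * (ln (real n) / real n powr \<epsilon>)) \<longlonglongrightarrow> A * 0 + B * 0"
    using assms by (intro tendsto_add tendsto_mult tendsto_const lim_1_over_real_power lim_ln_over_power)
  then have "eventually (\<lambda>n. A * (1 / real n powr \<epsilon>) + B * (ln (real n) / real n powr \<epsilon>) < c) sequentially"
    by (rule order_tendstoD) (use assms in simp)
  with eventually_gt_at_top[of 0] show ?thesis
  proof eventually_elim
    case (elim n)
    have "0 < real n powr \<epsilon>" using elim by simp
    with elim show ?case by (simp add: field_simps)
  qed
qed

text \<open>As n - 1 >= n/2, at least n/4 indices lie outside the exceptional set, and each of them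
  contributes at least n^\<epsilon>.\<close>

lemma sum_sqrt_count_lower:
  assumes \<epsilon>: "0 < \<epsilon>" and n: "2 \<le> n"
    and few: "real (card {i\<in>{1..n - 1}. real (f i) \<le> real n powr (2 * \<epsilon>)}) \<le> real n / 4"
  shows "real n / 4 * real n powr \<epsilon> \<le> (\<Sum>i=1..n - 1. sqrt (real (f i)))"
proof -
  let ?B = "{i\<in>{1..n - 1}. real (f i) \<le> real n powr (2 * \<epsilon>)}"
  have "card ({1..n - 1} - ?B) = card {1..n - 1} - card ?B"
    by (intro card_Diff_subset) auto
  then have "real (n - 1) - real (card ?B) \<le> real (card ({1..n - 1} - ?B))" by simp
  then have "real n / 4 \<le> real (card ({1..n - 1} - ?B))" using few n by linarith
  then have "real n / 4 * real n powr \<epsilon> \<le> real (card ({1..n - 1} - ?B)) * real n powr \<epsilon>"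
    by (intro mult_right_mono) auto
  also have "\<dots> = (\<Sum>i\<in>{1..n - 1} - ?B. real n powr \<epsilon>)" by simp
  also have "\<dots> \<le> (\<Sum>i\<in>{1..n - 1} - ?B. sqrt (real (f i)))"
  proof (intro sum_mono real_le_rsqrt)
    fix i assume "i \<in> {1..n - 1} - ?B"
    then have "real n powr (2 * \<epsilon>) \<le> real (f i)" by auto
    moreover have "(real n powr \<epsilon>)\<^sup>2 = real n powr (2 * \<epsilon>)"
      using n by (simp add: powr_power mult.commute)
    ultimately show "(real n powr \<epsilon>)\<^sup>2 \<le> real (f i)" by simp
  qed
  also have "\<dots> \<le> (\<Sum>i=1..n - 1. sqrt (real (f i)))"
    by (intro sum_mono2) auto
  finally show ?thesis .
qed

text \<open>For the case in which a relative error cannot be formed: all counts vanish, so the word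
  is empty and the permutation is the identity.\<close>

lemma expectation_inversions_no_letters:
  assumes "is_word n w" and "(\<Sum>i=1..n - 1. sqrt (real (count_list w i))) = 0"
  shows "measure_pmf.expectation (random_perm p w) (\<lambda>v. real (inversions n v)) = 0"
proof -
  have zero: "count_list w i = 0" if "i \<in> {1..n - 1}" for i
    using assms(2) that by (subst (asm) sum_nonneg_eq_0_iff) auto
  have "i \<notin> set w" for i
  proof
    assume "i \<in> set w"
    then have "i \<in> {1..n - 1}" using assms(1) unfolding is_word_def by (rule subsetD[rotated])
    from zero[OF this] \<open>i \<in> set w\<close> show False by (simp add: count_list_0_iff)
  qed
  then have "w = []" by (cases w) auto
  moreover have "{(j, j'). 1 \<le> j \<and> j < j' \<and> j' \<le> n \<and> inv id j > inv id (j' :: nat)} = {}"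
    by (auto simp: inv_id)
  then have "inversions n id = 0" unfolding inversions_def by (simp only: card.empty)
  ultimately show ?thesis by (simp add: random_perm_def)
qed

lemma expectation_inversions_asymp:
  fixes p \<epsilon> \<delta> :: real and w :: "nat \<Rightarrow> nat list"
  assumes p: "0 < p" "p < 1" and \<epsilon>: "0 < \<epsilon>" and \<delta>: "0 < \<delta>"
    and w: "\<And>n. 2 \<le> n \<Longrightarrow> is_word n (w n) \<and> alternating n (w n)"
    and max: "(\<lambda>n. real (MAX i\<in>{1..n - 1}. count_list (w n) i)) \<in> o(\<lambda>n. real n ^ 2 / ln (real n) powr (1 + \<epsilon>))"
    and few: "(\<lambda>n. real (card {i\<in>{1..n - 1}. real (count_list (w n) i) \<le> real n powr (2 * \<epsilon>)}))
        \<in> o(\<lambda>n. real n powr (1 - \<epsilon>))"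
  defines "S \<equiv> \<lambda>n. \<Sum>i=1..n - 1. sqrt (real (count_list (w n) i))"
  shows "eventually (\<lambda>n. \<bar>measure_pmf.expectation (random_perm p (w n)) (\<lambda>v. real (inversions n v))
      - sqrt (2 / pi) * sqrt (p / (1 - p)) * S n\<bar> \<le> \<delta> * S n) sequentially"
proof -
  obtain C where C: "0 < C"
    "\<And>n w (h :: real) K. \<lbrakk>2 \<le> n; is_word n w; alternating n w; 2 \<le> h;
       \<And>i. i \<in> {1..n - 1} \<Longrightarrow> real (count_list w i) \<le> K\<rbrakk> \<Longrightarrow>
     \<bar>measure_pmf.expectation (random_perm p w) (\<lambda>v. real (inversions n v))
        - sqrt (2 / pi) * sqrt (p / (1 - p)) * (\<Sum>i=1..n - 1. sqrt (real (count_list w i)))\<bar>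
      \<le> C * ((\<Sum>i=1..n - 1. sqrt (real (count_list w i))) / h
          + real n * (h ^ 4 + 1 + ln (real n)) + 4 * h ^ 3 * K)"
    using expectation_inversions_close[OF p] by blast
  define K where "K = (\<lambda>n. real (MAX i\<in>{1..n - 1}. count_list (w n) i))"
  \<comment> \<open>Independent of n, and so large that the error term \<open>C * S n / h\<close> is
    at most a third of the allowed error.\<close>
  define h where "h = max 2 (3 * C / \<delta>)"
  have h: "2 \<le> h" "C / h \<le> \<delta> / 3"
  proof -
    show "2 \<le> h" by (simp add: h_def)
    have "3 * C / \<delta> \<le> h" by (simp add: h_def)
    then show "C / h \<le> \<delta> / 3" using \<open>2 \<le> h\<close> \<delta> by (simp add: field_simps)
  qed
  \<comment> \<open>Chosen so that 4 C h^3 c = \<delta>/12, which is \<delta>/3 times the factor 1/4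
    in the bound \<open>n / 4 * sqrt (K n) <= S n\<close> proved below.\<close>
  define c where "c = \<delta> / (48 * C * h ^ 3)"
  have h3: "0 < h ^ 3" using h by simp
  have c: "0 < c" using C(1) \<delta> h3 by (simp add: c_def)
  have ev_max: "eventually (\<lambda>n. norm (K n) \<le> c\<^sup>2 * norm (real n ^ 2 / ln (real n) powr (1 + \<epsilon>))) sequentially"
    using c unfolding K_def by (intro landau_o.smallD[OF max]) simp
  have ev_few: "eventually (\<lambda>n. norm (real (card {i\<in>{1..n - 1}. real (count_list (w n) i) \<le> real n powr (2 * \<epsilon>)}))
     \<le> 1 / 4 * norm (real n powr (1 - \<epsilon>))) sequentially"
    by (intro landau_o.smallD[OF few]) simp
  have ev_ln: "eventually (\<lambda>n. C * (h ^ 4 + 1) + C * ln (real n) \<le> \<delta> / 12 * real n powr \<epsilon>) sequentially"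
    using \<epsilon> \<delta> by (intro eventually_ln_le_powr) auto
  have ev_const: "eventually (\<lambda>n. 8 * C * h ^ 3 + 0 * ln (real n) \<le> \<delta> / 12 * real n powr \<epsilon>) sequentially"
    using \<epsilon> \<delta> by (intro eventually_ln_le_powr) auto
  from ev_max ev_few ev_ln ev_const eventually_ge_at_top[of 3] show ?thesis
  proof eventually_elim
    case (elim n)
    then have n: "2 \<le> n" and n3: "3 \<le> n" by auto
    have word: "is_word n (w n)" and alt: "alternating n (w n)" using w[OF n] by auto
    have S0: "0 \<le> S n" unfolding S_def by (intro sum_nonneg) auto
    have Kle: "real (count_list (w n) i) \<le> K n" if "i \<in> {1..n - 1}" for i
      using that unfolding K_def by (intro of_nat_mono Max_ge) auto
    have "real n powr (1 - \<epsilon>) \<le> real n powr 1"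
      using n \<epsilon> by (intro powr_mono) auto
    then have "real (card {i\<in>{1..n - 1}. real (count_list (w n) i) \<le> real n powr (2 * \<epsilon>)}) \<le> real n / 4"
      using elim(2) n by simp
    then have S: "real n / 4 * real n powr \<epsilon> \<le> S n"
      unfolding S_def by (intro sum_sqrt_count_lower \<epsilon> n)
    have part1: "C * (S n / h) \<le> \<delta> / 3 * S n"
      using mult_right_mono[OF h(2) S0] by simp
    have by_S: "real n * A \<le> \<delta> / 3 * S n" if "A \<le> \<delta> / 12 * real n powr \<epsilon>" for A
    proof -
      have "real n * A \<le> real n * (\<delta> / 12 * real n powr \<epsilon>)" using that by (intro mult_left_mono) auto
      also have "\<dots> = \<delta> / 3 * (real n / 4 * real n powr \<epsilon>)" by simp
      also have "\<dots> \<le> \<delta> / 3 * S n" using S \<delta> by (intro mult_left_mono) auto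
      finally show ?thesis .
    qed
    have "C * (real n * (h ^ 4 + 1 + ln (real n))) = real n * (C * (h ^ 4 + 1) + C * ln (real n))"
      by (simp add: algebra_simps)
    then have part2: "C * (real n * (h ^ 4 + 1 + ln (real n))) \<le> \<delta> / 3 * S n"
      using by_S[OF elim(3)] by (simp only:)
    have part3: "C * (4 * h ^ 3 * K n) \<le> \<delta> / 3 * S n"
    \<comment> \<open>If \<open>K n > 2 * n\<close>, all counts are at least \<open>K n / 2\<close> because neighbouring counts differ by at most 1.\<close>
    proof (cases "K n \<le> 2 * real n")
      case True
      then have "C * (4 * h ^ 3 * K n) \<le> C * (4 * h ^ 3 * (2 * real n))"
        using C(1) h3 by (intro mult_left_mono) auto
      also have "\<dots> = real n * (8 * C * h ^ 3 + 0 * ln (real n))" by simp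
      also have "\<dots> \<le> \<delta> / 3 * S n" by (rule by_S[OF elim(4)])
      finally show ?thesis .
    next
      case False
      have K0: "0 < K n" using False n by linarith
      \<comment> \<open>From n = 3 on the logarithm is at least 1, so the bound on
        \<open>K n\<close> implies \<open>sqrt (K n) <= c * n\<close>.\<close>
      have "exp 1 \<le> real n" using exp_le n3 by linarith
      then have "1 \<le> ln (real n)" using n by (subst ln_ge_iff) auto
      then have "1 \<le> ln (real n) powr (1 + \<epsilon>)" using \<epsilon> by (intro ge_one_powr_ge_zero) auto
      then have "(real n)\<^sup>2 / ln (real n) powr (1 + \<epsilon>) \<le> (real n)\<^sup>2"
        by (intro divide_le_eq[THEN iffD2]) (auto simp: mult_le_cancel_left1)
      then have "c\<^sup>2 * ((real n)\<^sup>2 / ln (real n) powr (1 + \<epsilon>)) \<le> c\<^sup>2 * (real n)\<^sup>2"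
        by (intro mult_left_mono) auto
      then have "K n \<le> (c * real n)\<^sup>2"
        using elim(1) K0 by (simp add: power_mult_distrib)
      then have sK: "sqrt (K n) \<le> c * real n"
        using c by (intro real_le_lsqrt) auto
      have "{1..n - 1} \<noteq> {}" using n by auto
      then have "Max (count_list (w n) ` {1..n - 1}) \<in> count_list (w n) ` {1..n - 1}"
        by (intro Max_in) auto
      then obtain j where j: "j \<in> {1..n - 1}" "K n = real (count_list (w n) j)"
        by (auto simp: K_def)
      have "real n / 4 * sqrt (K n) \<le> S n"
      proof -
        have "real n / 4 * sqrt (K n) \<le> real (n - 1) * (sqrt (K n) / 2)"
        proof -
          have "real n / 2 \<le> real (n - 1)" using n by (simp add: of_nat_diff)
          then have "real n / 2 * (sqrt (K n) / 2) \<le> real (n - 1) * (sqrt (K n) / 2)"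
            using K0 by (intro mult_right_mono) auto
          then show ?thesis by simp
        qed
        also have "\<dots> = (\<Sum>i=1..n - 1. sqrt (K n) / 2)" by simp
        also have "\<dots> \<le> S n"
          unfolding S_def
        proof (intro sum_mono real_le_rsqrt)
          fix i assume i: "i \<in> {1..n - 1}"
          have "K n \<le> real (count_list (w n) i) + real n"
            unfolding j(2) by (rule alternating_count_lipschitz[OF alt word j(1) i])
          then show "(sqrt (K n) / 2)\<^sup>2 \<le> real (count_list (w n) i)"
            using False K0 by (simp add: power_divide)
        qed
        finally show ?thesis .
      qed
      then have "\<delta> / 3 * (real n / 4 * sqrt (K n)) \<le> \<delta> / 3 * S n"
        using \<delta> by (intro mult_left_mono) auto
      moreover have "C * (4 * h ^ 3 * K n) \<le> \<delta> / 3 * (real n / 4 * sqrt (K n))"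
      proof -
        have "C * (4 * h ^ 3 * K n) = 4 * C * h ^ 3 * sqrt (K n) * sqrt (K n)"
          using K0 by simp
        also have "\<dots> \<le> 4 * C * h ^ 3 * (c * real n) * sqrt (K n)"
          using sK C(1) h3 K0 by (intro mult_left_mono mult_right_mono) auto
        also have "4 * C * h ^ 3 * (c * real n) = \<delta> / 12 * real n"
          using C(1) h3 by (simp add: c_def)
        finally show ?thesis by simp
      qed
      ultimately show ?thesis by linarith
    qed
    have "\<bar>measure_pmf.expectation (random_perm p (w n)) (\<lambda>v. real (inversions n v))
        - sqrt (2 / pi) * sqrt (p / (1 - p)) * S n\<bar>
      \<le> C * (S n / h + real n * (h ^ 4 + 1 + ln (real n)) + 4 * h ^ 3 * K n)"
      unfolding S_def by (rule C(2)[OF n word alt h(1) Kle])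
    also have "\<dots> = C * (S n / h) + C * (real n * (h ^ 4 + 1 + ln (real n))) + C * (4 * h ^ 3 * K n)"
      by (simp only: distrib_left)
    also have "\<dots> \<le> \<delta> / 3 * S n + \<delta> / 3 * S n + \<delta> / 3 * S n"
      by (intro add_mono part1 part2 part3)
    finally show ?case by simp
  qed
qed

theorem theorem1p1:
  fixes p :: real
  assumes "0 < p" and "p < 1"
  shows "\<exists>\<epsilon>0 > 0. \<forall>\<epsilon>::real. 0 < \<epsilon> \<and> \<epsilon> < \<epsilon>0 \<longrightarrow>
    (\<forall>w :: nat \<Rightarrow> nat list.
      (\<forall>n\<ge>2. is_word n (w n) \<and> alternating n (w n)) \<longrightarrow>
      (\<lambda>n. real (MAX i\<in>{1..n - 1}. count_list (w n) i))
        \<in> o(\<lambda>n. real n ^ 2 / ln (real n) powr (1 + \<epsilon>)) \<longrightarrow>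
      (\<lambda>n. real (card {i\<in>{1..n - 1}. real (count_list (w n) i) \<le> real n powr (2 * \<epsilon>)}))
        \<in> o(\<lambda>n. real n powr (1 - \<epsilon>)) \<longrightarrow>
      (\<exists>\<delta> :: nat \<Rightarrow> real. \<delta> \<in> o(\<lambda>_. 1) \<and>
        (\<forall>n\<ge>2. measure_pmf.expectation (random_perm p (w n)) (\<lambda>v. real (inversions n v)) =
          (sqrt (2 / pi) + \<delta> n) * sqrt (p / (1 - p)) *
            (\<Sum>i=1..n - 1. sqrt (real (count_list (w n) i))))))"
proof (intro exI[of _ "1 :: real"] conjI allI impI zero_less_one)
  fix \<epsilon> :: real and w :: "nat \<Rightarrow> nat list"
  assume \<epsilon>: "0 < \<epsilon> \<and> \<epsilon> < 1" and w: "\<forall>n\<ge>2. is_word n (w n) \<and> alternating n (w n)"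
    and max: "(\<lambda>n. real (MAX i\<in>{1..n - 1}. count_list (w n) i)) \<in> o(\<lambda>n. real n ^ 2 / ln (real n) powr (1 + \<epsilon>))"
    and few: "(\<lambda>n. real (card {i\<in>{1..n - 1}. real (count_list (w n) i) \<le> real n powr (2 * \<epsilon>)}))
        \<in> o(\<lambda>n. real n powr (1 - \<epsilon>))"
  define S where "S = (\<lambda>n. \<Sum>i=1..n - 1. sqrt (real (count_list (w n) i)))"
  define E where "E = (\<lambda>n. measure_pmf.expectation (random_perm p (w n)) (\<lambda>v. real (inversions n v)))"
  define q where "q = sqrt (p / (1 - p))"
  \<comment> \<open>The identity is solved for the relative error. If \<open>S n = 0\<close>, both
    sides of the identity vanish and the value 0 keeps \<delta> small.\<close>
  define \<delta> where "\<delta> = (\<lambda>n. if S n = 0 then 0 else E n / (q * S n) - sqrt (2 / pi))"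
  have q: "0 < q" using assms by (simp add: q_def)
  have S0: "0 \<le> S n" for n unfolding S_def by (intro sum_nonneg) auto
  have "\<delta> \<in> o(\<lambda>_. 1)"
  proof (rule landau_o.smallI)
    fix c :: real assume c: "0 < c"
    have "eventually (\<lambda>n. \<bar>E n - sqrt (2 / pi) * q * S n\<bar> \<le> c * q * S n) sequentially"
      unfolding E_def S_def q_def
      by (rule expectation_inversions_asymp[where \<epsilon> = \<epsilon>]) (use assms \<epsilon> c w max few in auto)
    then show "eventually (\<lambda>n. norm (\<delta> n) \<le> c * norm (1 :: real)) sequentially"
    proof eventually_elim
      case (elim n)
      show ?case
      proof (cases "S n = 0")
        case False
        then have qS: "0 < q * S n" using q S0[of n] by simp
        then have "\<delta> n = (E n - sqrt (2 / pi) * q * S n) / (q * S n)"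
          using False q by (simp add: \<delta>_def diff_divide_distrib)
        also have "\<bar>\<dots>\<bar> \<le> c * q * S n / (q * S n)"
          using elim qS by (simp only: abs_divide abs_of_pos) (intro divide_right_mono, auto)
        also have "\<dots> = c" using False q by simp
        finally show ?thesis by simp
      qed (use c in \<open>simp add: \<delta>_def\<close>)
    qed
  qed
  moreover have "E n = (sqrt (2 / pi) + \<delta> n) * q * S n" if "2 \<le> n" for n
  proof (cases "S n = 0")
    case True
    then show ?thesis
      using expectation_inversions_no_letters[of n "w n" p] w that by (simp add: E_def S_def)
  next
    case False
    then show ?thesis using q by (simp add: \<delta>_def)
  qed
  ultimately show "\<exists>\<delta> :: nat \<Rightarrow> real. \<delta> \<in> o(\<lambda>_. 1) \<and>
        (\<forall>n\<ge>2. measure_pmf.expectation (random_perm p (w n)) (\<lambda>v. real (inversions n v)) =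
          (sqrt (2 / pi) + \<delta> n) * sqrt (p / (1 - p)) *
            (\<Sum>i=1..n - 1. sqrt (real (count_list (w n) i))))"
    unfolding E_def S_def q_def by blast
qed

end
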